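(* Suppose $l\ge 5$. The ideal $J=\ker(S\to H^0(Y,\mathcal{O}_Y))$ of $S$ defining the closed subscheme $X$ is generated by: $\operatorname{tr}(M)$, $\operatorname{tr}(N)$ (degree 1); $\operatorname{tr}(M^2)$, $\operatorname{tr}(MN)$, $\operatorname{tr}(N^2)$ and the entries of $MN-NM$ (degree 2); and $\operatorname{tr}(M^3)$, $\operatorname{tr}(N^3)$ and the entries of $M^2N$ and $MN^2$ (degree 3).
   Context: Let $\mathbb{F}$ be a field of characteristic $l$, $G=SL_3$ over $\mathbb{F}$, $B$ the upper triangular Borel subgroup, $\mathfrak{g}=\mathfrak{sl}_3$, $\mathfrak{n}$ the strictly upper triangular matrices, $C(\mathfrak{n})=\{(M,N)\in\mathfrak{n}^2:[M,N]=0\}$ and $Y=G\times^B C(\mathfrak{n})$, with the map $Y\to\mathfrak{g}\times\mathfrak{g}$, $(g,(M,N))\mapsto(\mathrm{Ad}(g)M,\mathrm{Ad}(g)N)$. Let $S=\operatorname{Sym}((\mathfrak{g}^* )^2)$ be the coordinate ring of $\mathfrak{g}\times\mathfrak{g}$, with universal pair $(M,N)$, and $S\to H^0(Y,\mathcal{O}_Y)$ the induced map; $X$ is the closed subscheme of $\mathfrak{g}^2$ it defines (the image of $Y$). In the arithmetic setting (local field with residue field of order $q\equiv1\bmod l$), $X$ is identified with the reduced special fibre of the Steinberg component of $GL_3$ with $\operatorname{tr}\Phi=1+q+q^2$, via $(\Phi,\Sigma)\mapsto(\Phi-1,\log\Sigma)$. *)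

theory Defs
  imports
    "HOL-Analysis.Analysis"
    "HOL-Algebra.Algebraic_Closure_Type"
    "HOL-Library.Poly_Mapping"
begin

text \<open>
  \<open>('k, 'f) mat_poly\<close> is the polynomial ring over \<open>'f\<close> in the entries of a family of
  3-by-3 matrices indexed by \<open>'k\<close>. Closed subschemes of the corresponding affine space are
  handled through their coordinate rings, that is, quotients of this ring. The rows and
  columns are indexed by the three-element type \<open>3\<close>, ordered by \<open>0 < 1 < 2\<close>.
\<close>

type_synonym ('k, 'f) mat_poly = "(('k \<times> 3 \<times> 3) \<Rightarrow>\<^sub>0 nat) \<Rightarrow>\<^sub>0 'f"

definition coord :: "'k \<Rightarrow> ('k, 'f::comm_ring_1) mat_poly ^ 3 ^ 3"
  where "coord k = (\<chi> i j. Poly_Mapping.single (Poly_Mapping.single (k, i, j) 1) 1)"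

text \<open>Pullback of polynomials along the morphism with matrix components \<open>\<sigma> k\<close>.\<close>

definition mat_subst ::
  "('k \<Rightarrow> ('l, 'f) mat_poly ^ 3 ^ 3) \<Rightarrow> ('k, 'f::comm_ring_1) mat_poly \<Rightarrow> ('l, 'f) mat_poly"
  where "mat_subst \<sigma> p =
    (\<Sum>m\<in>Poly_Mapping.keys p. Poly_Mapping.single 0 (Poly_Mapping.lookup p m) *
      (\<Prod>(k, i, j)\<in>Poly_Mapping.keys m. (\<sigma> k $ i $ j) ^ Poly_Mapping.lookup m (k, i, j)))"

abbreviation poly_ring :: "('k, 'f::comm_ring_1) mat_poly ring"
  where "poly_ring \<equiv> ring_of_type_algebra"

definition entries :: "'a ^ 3 ^ 3 \<Rightarrow> 'a set"
  where "entries A = {A $ i $ j |i j. True}"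

definition quot_ring :: "('k, 'f::comm_ring_1) mat_poly set \<Rightarrow> ('k, 'f) mat_poly set ring"
  where "quot_ring E = poly_ring Quot (Idl\<^bsub>poly_ring\<^esub> E)"

definition quot_class ::
  "('k, 'f::comm_ring_1) mat_poly set \<Rightarrow> ('k, 'f) mat_poly \<Rightarrow> ('k, 'f) mat_poly set"
  where "quot_class E p = (Idl\<^bsub>poly_ring\<^esub> E) +>\<^bsub>poly_ring\<^esub> p"

text \<open>
  The map induced by \<open>mat_subst \<sigma>\<close> from a quotient of the source to the quotient by
  \<open>Idl E\<close> of the target; meaningful when \<open>mat_subst \<sigma>\<close> carries the ideal divided out in the
  source into \<open>Idl E\<close>.
\<close>

definition quot_pullback ::
  "('l, 'f::comm_ring_1) mat_poly set \<Rightarrow> ('k \<Rightarrow> ('l, 'f) mat_poly ^ 3 ^ 3) \<Rightarrow>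
    ('k, 'f) mat_poly set \<Rightarrow> ('l, 'f) mat_poly set"
  where "quot_pullback E \<sigma> c = the_elem ((\<lambda>p. quot_class E (mat_subst \<sigma> p)) ` c)"

text \<open>The adjugate; it is the inverse of a matrix of determinant 1 over any commutative ring.\<close>

definition adj3 :: "'a::comm_ring_1 ^ 3 ^ 3 \<Rightarrow> 'a ^ 3 ^ 3"
  where "adj3 A =
    (\<chi> i j. det (\<chi> k l. if k = j then (if l = i then 1 else 0) else A $ k $ l))"

lemma mult_adj3: "A ** adj3 A = mat (det A)"
  and adj3_mult: "adj3 A ** A = mat (det A)"
proof -
  have d: "(1::3) \<noteq> 2" "(1::3) \<noteq> 3" "(2::3) \<noteq> 3" "(2::3) \<noteq> 1" "(3::3) \<noteq> 1" "(3::3) \<noteq> 2"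
    by simp_all
  show "A ** adj3 A = mat (det A)"
    unfolding vec_eq_iff forall_3
    by (simp add: matrix_matrix_mult_def adj3_def mat_def det_3 sum_3 d algebra_simps)
  show "adj3 A ** A = mat (det A)"
    unfolding vec_eq_iff forall_3
    by (simp add: matrix_matrix_mult_def adj3_def mat_def det_3 sum_3 d algebra_simps)
qed

definition conj3 :: "'a::comm_ring_1 ^ 3 ^ 3 \<Rightarrow> 'a ^ 3 ^ 3 \<Rightarrow> 'a ^ 3 ^ 3"
  where "conj3 g A = g ** A ** adj3 g"


subsection \<open>The coordinate ring of \<open>\<gg> \<times> \<gg>\<close>\<close>

datatype gg_mat = gg_M | gg_N

definition gg_eqs :: "(gg_mat, 'f::comm_ring_1) mat_poly set"
  where "gg_eqs = {trace (coord gg_M), trace (coord gg_N)}"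

text \<open>\<open>Sym((\<gg>*)\<^sup>2)\<close> for \<open>\<gg> = sl\<^sub>3\<close>, since \<open>\<gg>*\<close> is the dual of \<open>gl\<^sub>3\<close> modulo the trace form.\<close>

definition S_ring :: "(gg_mat, 'f::comm_ring_1) mat_poly set ring"
  where "S_ring = quot_ring gg_eqs"


subsection \<open>The variety \<open>Y = G \<times>\<^sup>B C(\<nn>)\<close>\<close>

text \<open>Equations saying that \<open>(M, N)\<close> is a commuting pair of strictly upper triangular matrices.\<close>

definition Cn_eqs :: "'a::comm_ring_1 ^ 3 ^ 3 \<Rightarrow> 'a ^ 3 ^ 3 \<Rightarrow> 'a set"
  where "Cn_eqs M N =
    {M $ i $ j |i j. j \<le> i} \<union> {N $ i $ j |i j. j \<le> i} \<union> entries (M ** N - N ** M)"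

datatype GC_mat = GC_g | GC_M | GC_N

definition GC_eqs :: "(GC_mat, 'f::comm_ring_1) mat_poly set"
  where "GC_eqs = {det (coord GC_g) - 1} \<union> Cn_eqs (coord GC_M) (coord GC_N)"

definition GC_ring :: "(GC_mat, 'f::comm_ring_1) mat_poly set ring"
  where "GC_ring = quot_ring GC_eqs"

datatype BGC_mat = BGC_b | BGC_g | BGC_M | BGC_N

definition BGC_eqs :: "(BGC_mat, 'f::comm_ring_1) mat_poly set"
  where "BGC_eqs = {coord BGC_b $ i $ j |i j. j < i} \<union> {det (coord BGC_b) - 1} \<union>
    {det (coord BGC_g) - 1} \<union> Cn_eqs (coord BGC_M) (coord BGC_N)"

text \<open>
  The action \<open>b \<cdot> (g, (M, N)) = (g b\<^sup>-\<^sup>1, (Ad b M, Ad b N))\<close> of \<open>B\<close> on \<open>G \<times> C(\<nn>)\<close>, whose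
  quotient is \<open>Y\<close>, and the projection \<open>B \<times> G \<times> C(\<nn>) \<rightarrow> G \<times> C(\<nn>)\<close>.
\<close>

fun B_act :: "GC_mat \<Rightarrow> (BGC_mat, 'f::comm_ring_1) mat_poly ^ 3 ^ 3"
  where
    "B_act GC_g = coord BGC_g ** adj3 (coord BGC_b)"
  | "B_act GC_M = conj3 (coord BGC_b) (coord BGC_M)"
  | "B_act GC_N = conj3 (coord BGC_b) (coord BGC_N)"

fun B_proj :: "GC_mat \<Rightarrow> (BGC_mat, 'f::comm_ring_1) mat_poly ^ 3 ^ 3"
  where
    "B_proj GC_g = coord BGC_g"
  | "B_proj GC_M = coord BGC_M"
  | "B_proj GC_N = coord BGC_N"

text \<open>
  \<open>G \<times> C(\<nn>) \<rightarrow> Y\<close> is a \<open>B\<close>-torsor, so \<open>H\<^sup>0(Y, O\<^sub>Y)\<close> is the ring of (scheme-theoretic)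
  \<open>B\<close>-invariants in the coordinate ring of \<open>G \<times> C(\<nn>)\<close>.
\<close>

definition H0_Y :: "(GC_mat, 'f::comm_ring_1) mat_poly set ring"
  where "H0_Y = GC_ring \<lparr>carrier :=
    {h \<in> carrier GC_ring. quot_pullback BGC_eqs B_act h = quot_pullback BGC_eqs B_proj h}\<rparr>"

fun Y_map :: "gg_mat \<Rightarrow> (GC_mat, 'f::comm_ring_1) mat_poly ^ 3 ^ 3"
  where
    "Y_map gg_M = conj3 (coord GC_g) (coord GC_M)"
  | "Y_map gg_N = conj3 (coord GC_g) (coord GC_N)"

definition S_to_H0 ::
  "(gg_mat, 'f::comm_ring_1) mat_poly set \<Rightarrow> (GC_mat, 'f) mat_poly set"
  where "S_to_H0 = quot_pullback GC_eqs Y_map"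

definition J_ideal :: "(gg_mat, 'f::comm_ring_1) mat_poly set set"
  where "J_ideal = a_kernel S_ring H0_Y S_to_H0"

end

theory Submission
  imports Defs "HOL-Library.Multiset" "HOL-Computational_Algebra.Fraction_Field"
    "HOL-Computational_Algebra.Polynomial"
begin

text \<open>
  Let \<open>I\<close> be the ideal of the stated generators and \<open>f\<close> the coordinate \<open>M 3 1\<close>.
  No leading monomial of an explicit Groebner basis of \<open>I\<close> over \<open>\<int>[1/6]\<close> contains \<open>f\<close>, hence \<open>f\<close>
  is a nonzerodivisor modulo \<open>I\<close>. Modulo \<open>I\<close>, and up to a power of \<open>f\<close>, every polynomial is a
  linear combination of words in five coordinates and six derived polynomials which satisfy
  binomial relations. At the generic point of \<open>Y\<close>, parametrised birationally by eight variables,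
  these words become distinct monomials up to sign. So if \<open>p\<close> vanishes on \<open>Y\<close>, then
  \<open>f ^ k * p \<in> I\<close> for some \<open>k\<close>, and therefore \<open>p \<in> I\<close>.
\<close>

subsection \<open>Groebner bases with respect to a weight\<close>

text \<open>The relations hold on Y for an elementary reason: they involve traces of nilpotent
  products, products of three strictly triangular matrices, and the commutator. The difficulty is
  the converse, since nothing in a list of generators shows that every function vanishing on Y lies
  in their ideal \<open>I\<close>. Where \<open>M 3 1\<close> is invertible the quotient by
  \<open>I\<close> becomes transparent: all eighteen coordinates are solved for in terms of eleven
  letters, and a single evaluation separates the normal words in them, so no primary decomposition
  or dimension count enters. The price is the way back from this open set, where an element of S/I
  killed by a power of \<open>M 3 1\<close> has to be excluded. A Groebner basis settles this
  through its leading monomials alone. It is also the means of checking the binomial relations. All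
  computations are carried out with integer coefficients and then transferred to the field; scalings
  by 2 and 3 are undone there by invertibility.\<close>

abbreviation mono_of :: "'m \<Rightarrow> 'a \<Rightarrow> 'm \<Rightarrow>\<^sub>0 'a::zero"
  where "mono_of \<equiv> Poly_Mapping.single"

lemma additive_induct [consumes 1, case_names zero plus single]:
  fixes p :: "'m \<Rightarrow>\<^sub>0 'a::ab_group_add"
  assumes "Poly_Mapping.keys p \<subseteq> A" and zero: "P 0"
    and plus: "\<And>p q. P p \<Longrightarrow> P q \<Longrightarrow> P (p + q)"
    and single: "\<And>t c. t \<in> A \<Longrightarrow> P (mono_of t c)"
  shows "P p"
proof -
  have "P q" if "Poly_Mapping.keys q \<subseteq> A" "card (Poly_Mapping.keys q) = n" for n q
    using that
  proof (induction n arbitrary: q)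
    case 0
    then show ?case using zero by simp
  next
    case (Suc n)
    then have "Poly_Mapping.keys q \<noteq> {}" by auto
    then obtain t where t: "t \<in> Poly_Mapping.keys q" by blast
    define r where "r = q - mono_of t (Poly_Mapping.lookup q t)"
    have "Poly_Mapping.keys r = Poly_Mapping.keys q - {t}"
      unfolding r_def
      by (auto simp: in_keys_iff lookup_minus lookup_single when_def split: if_splits)
    then have "P r"
      using Suc.prems t by (intro Suc.IH) auto
    moreover have "r + mono_of t (Poly_Mapping.lookup q t) = q"
      by (simp add: r_def)
    moreover have "P (mono_of t (Poly_Mapping.lookup q t))"
      using single t Suc.prems(1) by blast
    ultimately show ?case
      using plus[of r "mono_of t (Poly_Mapping.lookup q t)"] by simp
  qed
  then show ?thesis using assms(1) by blast
qed

lemma lookup_mono_mult: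
  fixes p :: "'m::cancel_comm_monoid_add \<Rightarrow>\<^sub>0 'a::comm_ring_1"
  shows "Poly_Mapping.lookup (mono_of e 1 * p) (e + t) = Poly_Mapping.lookup p t"
proof -
  have "Poly_Mapping.keys p \<subseteq> UNIV" by simp
  then show ?thesis
    by (induction rule: additive_induct)
      (simp_all add: distrib_left lookup_add mult_single lookup_single when_def)
qed

text \<open>
  Leading terms outweigh the tails strictly, so the weight takes the place of a monomial order.
  The set \<open>low D\<close> consists of the combinations of basis elements whose summands have weight
  below \<open>D\<close>; Buchberger's criterion asks that each S-polynomial lies in \<open>low\<close> of the weight of
  the common multiple.
\<close>

locale weighted_basis =
  fixes K :: "'i set" and lead :: "'i \<Rightarrow> 'm::cancel_comm_monoid_add"
    and lc :: "'i \<Rightarrow> 'f::field" and tail :: "'i \<Rightarrow> ('m \<Rightarrow>\<^sub>0 'f)" and wt :: "'m \<Rightarrow> nat"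
  assumes wt_add: "wt (s + t) = wt s + wt t"
    and lc_nonzero: "i \<in> K \<Longrightarrow> lc i \<noteq> 0"
    and wt_tail: "i \<in> K \<Longrightarrow> t \<in> Poly_Mapping.keys (tail i) \<Longrightarrow> wt t < wt (lead i)"
begin

definition elt :: "'i \<Rightarrow> ('m \<Rightarrow>\<^sub>0 'f)"
  where "elt i = mono_of (lead i) (lc i) + tail i"

inductive_set low :: "nat \<Rightarrow> ('m \<Rightarrow>\<^sub>0 'f) set" for D where
  low_zero: "0 \<in> low D"
| low_step: "\<lbrakk>p \<in> low D; i \<in> K; wt (t + lead i) < D\<rbrakk> \<Longrightarrow> p + mono_of t c * elt i \<in> low D"

lemma low_elt: "\<lbrakk>i \<in> K; wt (t + lead i) < D\<rbrakk> \<Longrightarrow> mono_of t c * elt i \<in> low D"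
  using low_step[OF low_zero] by force

lemma low_add: "p \<in> low D \<Longrightarrow> q \<in> low D \<Longrightarrow> p + q \<in> low D"
proof (induction rule: low.induct)
  case (low_step p i t c)
  then show ?case
    using low.low_step[of "p + q" D i t c] by (simp add: algebra_simps)
qed simp

lemma low_mult_mono: "p \<in> low D \<Longrightarrow> mono_of s c * p \<in> low (wt s + D)"
proof (induction rule: low.induct)
  case (low_step p i t d)
  have "mono_of (s + t) (c * d) * elt i \<in> low (wt s + D)"
    using low_step by (intro low_elt) (auto simp: wt_add add.assoc)
  from low_add[OF low_step.IH this] show ?case
    by (simp only: distrib_left mult.assoc[symmetric] mult_single)
qed (simp add: low_zero)

lemma low_scale: "p \<in> low D \<Longrightarrow> mono_of 0 c * p \<in> low D"
proof -
  have "wt 0 = 0" using wt_add[of 0 0] by simp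
  then show "p \<in> low D \<Longrightarrow> mono_of 0 c * p \<in> low D"
    using low_mult_mono[of p D 0 c] by simp
qed

lemma low_uminus: "p \<in> low D \<Longrightarrow> - p \<in> low D"
  using low_scale[of p D "- 1"] by (simp add: single_uminus)

lemma low_diff: "p \<in> low D \<Longrightarrow> q \<in> low D \<Longrightarrow> p - q \<in> low D"
  using low_add[of p D "- q"] low_uminus by simp

lemma low_scale_cancel: "c \<noteq> 0 \<Longrightarrow> mono_of 0 c * p \<in> low D \<Longrightarrow> p \<in> low D"
  using low_scale[of "mono_of 0 c * p" D "inverse c"]
  by (simp add: mult.assoc[symmetric] mult_single)

lemma low_mono: "p \<in> low D \<Longrightarrow> D \<le> D' \<Longrightarrow> p \<in> low D'"
  by (induction rule: low.induct) (auto intro: low.intros)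

lemma low_mult_poly:
  assumes "Poly_Mapping.keys q \<subseteq> {t. i \<in> K \<and> wt (t + lead i) < D}"
  shows "q * elt i \<in> low D"
  using assms
proof (induction rule: additive_induct)
  case (plus p q)
  then show ?case by (simp add: distrib_right low_add)
qed (auto intro: low_zero low_elt)

lemma low_mult: "p \<in> low D \<Longrightarrow> \<exists>D'. q * p \<in> low D'"
proof -
  assume p: "p \<in> low D"
  have "Poly_Mapping.keys q \<subseteq> UNIV" by simp
  then show ?thesis
  proof (induction rule: additive_induct)
    case zero
    then show ?case using low_zero by force
  next
    case (plus q r)
    then obtain D1 D2 where "q * p \<in> low D1" "r * p \<in> low D2" by blast
    then have "q * p \<in> low (max D1 D2)" "r * p \<in> low (max D1 D2)"
      by (auto intro: low_mono)
    then show ?case by (auto simp: distrib_right intro: low_add)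
  next
    case (single t c)
    then show ?case using low_mult_mono[OF p] by blast
  qed
qed

definition basis_ideal :: "('m \<Rightarrow>\<^sub>0 'f) set"
  where "basis_ideal = (\<Union>D. low D)"

lemma basis_ideal_add: "p \<in> basis_ideal \<Longrightarrow> q \<in> basis_ideal \<Longrightarrow> p + q \<in> basis_ideal"
proof -
  assume "p \<in> basis_ideal" "q \<in> basis_ideal"
  then obtain D1 D2 where "p \<in> low D1" "q \<in> low D2" unfolding basis_ideal_def by blast
  then have "p \<in> low (max D1 D2)" "q \<in> low (max D1 D2)"
    by (auto intro: low_mono)
  then show ?thesis unfolding basis_ideal_def using low_add by blast
qed

lemma basis_ideal_mult: "p \<in> basis_ideal \<Longrightarrow> q * p \<in> basis_ideal"
  unfolding basis_ideal_def by (auto dest: low_mult[where q = q])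

text \<open>The pair is tested at every common multiple \<open>T\<close> of the two leading
  monomials, not only at the least one, so that the chain criterion can compose pairs at a fixed
  \<open>T\<close>. For other \<open>T\<close> the condition is vacuous.\<close>

definition spair_low :: "'m \<Rightarrow> 'i \<Rightarrow> 'i \<Rightarrow> bool"
  where "spair_low T i j \<longleftrightarrow> (\<forall>s t. s + lead i = T \<longrightarrow> t + lead j = T \<longrightarrow>
    mono_of s (lc j) * elt i - mono_of t (lc i) * elt j \<in> low (wt T))"

lemma spair_lowI:
  "(\<And>s t. s + lead i = T \<Longrightarrow> t + lead j = T \<Longrightarrow>
    mono_of s (lc j) * elt i - mono_of t (lc i) * elt j \<in> low (wt T)) \<Longrightarrow> spair_low T i j"
  by (simp add: spair_low_def)

lemma spair_lowD:
  "spair_low T i j \<Longrightarrow> s + lead i = T \<Longrightarrow> t + lead j = T \<Longrightarrow>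
    mono_of s (lc j) * elt i - mono_of t (lc i) * elt j \<in> low (wt T)"
  by (simp add: spair_low_def)

lemma spair_low_sym:
  assumes "spair_low T i j"
  shows "spair_low T j i"
proof (rule spair_lowI)
  fix s t assume "s + lead j = T" "t + lead i = T"
  from low_uminus[OF spair_lowD[OF assms this(2,1)]]
  show "mono_of s (lc i) * elt j - mono_of t (lc j) * elt i \<in> low (wt T)"
    by simp
qed

lemma spair_low_refl: "spair_low T i i"
proof (rule spair_lowI)
  fix s t assume "s + lead i = T" "t + lead i = T"
  then have "s = t" using add_right_cancel[of s "lead i" t] by simp
  then show "mono_of s (lc i) * elt i - mono_of t (lc i) * elt i \<in> low (wt T)"
    by (simp add: low_zero)
qed

text \<open>Buchberger's second criterion. Up to the scalar \<open>lc k\<close>, the S-polynomial of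
  \<open>i\<close> and \<open>j\<close> at \<open>T\<close> is a combination of those of
  \<open>i\<close>, \<open>k\<close> and of \<open>k\<close>, \<open>j\<close> at the same
  \<open>T\<close>, because the multiples of \<open>elt k\<close> cancel.\<close>

lemma spair_low_chain:
  assumes ik: "spair_low T i k" and kj: "spair_low T k j" and "k \<in> K"
    and r: "r + lead k = T"
  shows "spair_low T i j"
proof (rule spair_lowI)
  fix s t assume s: "s + lead i = T" and t: "t + lead j = T"
  note 1 = spair_lowD[OF ik s r] and 2 = spair_lowD[OF kj r t]
  have e: "mono_of s (lc j) = mono_of 0 (lc j) * mono_of s 1"
    "mono_of s (lc k) = mono_of 0 (lc k) * mono_of s 1"
    "mono_of t (lc i) = mono_of 0 (lc i) * mono_of t 1"
    "mono_of t (lc k) = mono_of 0 (lc k) * mono_of t 1"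
    "mono_of r (lc i) = mono_of 0 (lc i) * mono_of r 1"
    "mono_of r (lc j) = mono_of 0 (lc j) * mono_of r 1"
    by (simp_all add: mult_single)
  have "mono_of 0 (lc k) * (mono_of s (lc j) * elt i - mono_of t (lc i) * elt j)
    = mono_of 0 (lc j) * (mono_of s (lc k) * elt i - mono_of r (lc i) * elt k)
      + mono_of 0 (lc i) * (mono_of r (lc j) * elt k - mono_of t (lc k) * elt j)"
    unfolding e by (simp add: algebra_simps)
  also have "\<dots> \<in> low (wt T)"
    by (intro low_add low_scale 1 2)
  finally show "mono_of s (lc j) * elt i - mono_of t (lc i) * elt j \<in> low (wt T)"
    by (rule low_scale_cancel[OF lc_nonzero[OF \<open>k \<in> K\<close>]])
qed

text \<open>Buchberger's product criterion. Writing each leading term as element minus tail, the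
  product of the two elements cancels; what remains are tail multiples of the elements, which are
  lighter than the product of the leading monomials.\<close>

lemma spair_low_coprime:
  assumes K: "i \<in> K" "j \<in> K"
    and cop: "\<And>s t. s + lead i = t + lead j \<Longrightarrow> \<exists>u. s = u + lead j"
  shows "spair_low T i j"
proof (rule spair_lowI)
  fix s t assume s: "s + lead i = T" and t: "t + lead j = T"
  then obtain u where u: "s = u + lead j" using cop[of s t] by auto
  then have "t + lead j = (u + lead i) + lead j" using s t by (simp add: add_ac)
  then have u': "t = u + lead i" by (simp only: add_right_cancel)
  have e: "mono_of (lead i) (lc i) = elt i - tail i" "mono_of (lead j) (lc j) = elt j - tail j"
    by (simp_all add: elt_def)
  have s': "mono_of s (lc j) = mono_of u 1 * mono_of (lead j) (lc j)"
    and t': "mono_of t (lc i) = mono_of u 1 * mono_of (lead i) (lc i)"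
    by (simp_all add: u u' mult_single)
  have "mono_of s (lc j) * elt i - mono_of t (lc i) * elt j
      = mono_of u 1 * (tail i * elt j - tail j * elt i)"
    unfolding s' t' e by (simp add: algebra_simps)
  moreover have "tail i * elt j \<in> low (wt (lead i + lead j))" "tail j * elt i \<in> low (wt (lead i + lead j))"
    using K wt_tail by (auto intro!: low_mult_poly simp: wt_add)
  then have "mono_of u 1 * (tail i * elt j - tail j * elt i) \<in> low (wt u + wt (lead i + lead j))"
    by (intro low_mult_mono low_diff)
  moreover have "wt T = wt u + wt (lead i + lead j)"
    unfolding s[symmetric] u by (simp add: wt_add add_ac)
  ultimately show "mono_of s (lc j) * elt i - mono_of t (lc i) * elt j \<in> low (wt T)"
    by simp
qed

text \<open>The cofactors at any common multiple are a single monomial \<open>u\<close> times those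
  at the least one, so one computation per pair is enough.\<close>

lemma spair_low_least:
  assumes ij: "a + lead i = b + lead j"
    and least: "\<And>s t. s + lead i = t + lead j \<Longrightarrow> \<exists>u. s = u + a"
    and low: "mono_of a (lc j) * elt i - mono_of b (lc i) * elt j \<in> low (wt (a + lead i))"
  shows "spair_low T i j"
proof (rule spair_lowI)
  fix s t assume s: "s + lead i = T" and t: "t + lead j = T"
  then obtain u where u: "s = u + a" using least[of s t] by auto
  have "t + lead j = (u + b) + lead j"
    using s t ij by (simp add: u add.assoc)
  then have u': "t = u + b" by (simp only: add_right_cancel)
  have "mono_of u 1 * (mono_of a (lc j) * elt i - mono_of b (lc i) * elt j)
      \<in> low (wt u + wt (a + lead i))"
    by (rule low_mult_mono[OF low])
  moreover have "wt T = wt u + wt (a + lead i)"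
    unfolding s[symmetric] u by (simp add: wt_add add.assoc)
  ultimately show "mono_of s (lc j) * elt i - mono_of t (lc i) * elt j \<in> low (wt T)"
    unfolding right_diff_distrib mult.assoc[symmetric] mult_single by (simp add: u u')
qed

definition reducible :: "'m \<Rightarrow> bool"
  where "reducible T \<longleftrightarrow> (\<exists>i\<in>K. \<exists>s. T = s + lead i)"

text \<open>A fixed choice, for each reducible \<open>T\<close>, of a basis multiple with leading
  monomial \<open>T\<close> and leading coefficient 1. Fixing it makes \<open>top_part\<close>
  additive; the value 0 elsewhere makes \<open>top_part\<close> vanish on irreducible
  polynomials.\<close>

definition top_elt :: "'m \<Rightarrow> ('m \<Rightarrow>\<^sub>0 'f)"
  where "top_elt T = (if reducible T
    then (SOME b. \<exists>i\<in>K. \<exists>s. T = s + lead i \<and> b = mono_of s (inverse (lc i)) * elt i) else 0)"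

lemma top_elt:
  assumes "reducible T"
  obtains i s where "i \<in> K" "T = s + lead i" "top_elt T = mono_of s (inverse (lc i)) * elt i"
proof -
  have "\<exists>b. \<exists>i\<in>K. \<exists>s. T = s + lead i \<and> b = mono_of s (inverse (lc i)) * elt i"
    using assms unfolding reducible_def by blast
  from someI_ex[OF this]
  have "\<exists>i\<in>K. \<exists>s. T = s + lead i \<and> top_elt T = mono_of s (inverse (lc i)) * elt i"
    by (simp only: top_elt_def assms if_True)
  then show ?thesis using that by blast
qed

definition top_part :: "nat \<Rightarrow> ('m \<Rightarrow>\<^sub>0 'f) \<Rightarrow> ('m \<Rightarrow>\<^sub>0 'f)"
  where "top_part D p = (\<Sum>T\<in>Poly_Mapping.keys p.
    if wt T = D then mono_of 0 (Poly_Mapping.lookup p T) * top_elt T else 0)"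

lemma top_part_superset:
  assumes "finite A" "Poly_Mapping.keys p \<subseteq> A"
  shows "top_part D p = (\<Sum>T\<in>A. if wt T = D then mono_of 0 (Poly_Mapping.lookup p T) * top_elt T else 0)"
  unfolding top_part_def using assms
  by (intro sum.mono_neutral_left) (auto simp: in_keys_iff)

lemma top_part_add: "top_part D (p + q) = top_part D p + top_part D q"
proof -
  let ?A = "Poly_Mapping.keys p \<union> Poly_Mapping.keys q"
  have "top_part D (p + q) = (\<Sum>T\<in>?A. if wt T = D then mono_of 0 (Poly_Mapping.lookup (p + q) T) * top_elt T else 0)"
    by (intro top_part_superset) (use keys_add[of p q] in auto)
  also have "\<dots> = (\<Sum>T\<in>?A. (if wt T = D then mono_of 0 (Poly_Mapping.lookup p T) * top_elt T else 0)
      + (if wt T = D then mono_of 0 (Poly_Mapping.lookup q T) * top_elt T else 0))"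
    by (intro sum.cong) (auto simp: lookup_add single_add distrib_right)
  also have "\<dots> = top_part D p + top_part D q"
    by (simp add: sum.distrib top_part_superset[of ?A])
  finally show ?thesis .
qed

lemma keys_mono_mult: "Poly_Mapping.keys (mono_of s c * p) \<subseteq> (+) s ` Poly_Mapping.keys p"
  using keys_mult[of "mono_of s c" p] by (auto split: if_splits)

lemma keys_elt_mult:
  assumes "i \<in> K" "T \<in> Poly_Mapping.keys (mono_of s c * tail i)"
  shows "wt T < wt (s + lead i)"
  using assms keys_mono_mult[of s c "tail i"] wt_tail by (fastforce simp: wt_add)

lemma top_part_low: "(\<And>T. T \<in> Poly_Mapping.keys p \<Longrightarrow> wt T < D) \<Longrightarrow> top_part D p = 0"
  unfolding top_part_def by (intro sum.neutral) auto

lemma top_part_single: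
  "top_part (wt T) (mono_of T c) = mono_of 0 c * top_elt T"
  by (simp add: top_part_def)

text \<open>By additivity of \<open>top_part\<close>, one summand \<open>mono_of t c * elt i\<close>
  suffices. If its leading monomial has weight \<open>D\<close>, its tail does not contribute to
  \<open>top_part\<close>, and it differs from the chosen multiple with the same leading monomial by
  a scaled S-polynomial. Otherwise it lies in \<open>low D\<close> already.\<close>

lemma diff_top_part_low:
  assumes pairs: "\<And>T i j. i \<in> K \<Longrightarrow> j \<in> K \<Longrightarrow> spair_low T i j"
    and "p \<in> low (Suc D)"
  shows "p - top_part D p \<in> low D"
  using assms(2)
proof (induction rule: low.induct)
  case low_zero
  then show ?case by (simp add: top_part_def low.low_zero)
next
  case (low_step p i t c)
  let ?T = "t + lead i" and ?x = "mono_of t c * elt i"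
  have x: "?x = mono_of ?T (c * lc i) + mono_of t c * tail i"
    by (simp add: elt_def distrib_left mult_single)
  have "?x - top_part D ?x \<in> low D"
  proof (cases "wt ?T = D")
    case True
    have "reducible ?T" using low_step unfolding reducible_def by blast
    then obtain j s where js: "j \<in> K" "?T = s + lead j"
        "top_elt ?T = mono_of s (inverse (lc j)) * elt j"
      by (rule top_elt)
    have "top_part D (mono_of t c * tail i) = 0"
      using keys_elt_mult[OF low_step(2)] True by (intro top_part_low) blast
    moreover have "top_part D (mono_of ?T (c * lc i)) = mono_of 0 (c * lc i) * top_elt ?T"
      using top_part_single[of ?T] True by simp
    ultimately have "top_part D ?x = mono_of 0 (c * lc i) * top_elt ?T"
      by (simp add: x top_part_add)
    also have "\<dots> = mono_of s (c * lc i / lc j) * elt j"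
      unfolding js(3) mult.assoc[symmetric] mult_single by (simp add: divide_inverse)
    finally have R: "top_part D ?x = mono_of s (c * lc i / lc j) * elt j" .
    have "mono_of t (lc j) * elt i - mono_of s (lc i) * elt j \<in> low D"
      using spair_lowD[OF pairs[OF low_step(2) js(1)] refl js(2)[symmetric]] unfolding True .
    then have "mono_of 0 (c / lc j) * (mono_of t (lc j) * elt i - mono_of s (lc i) * elt j) \<in> low D"
      by (rule low_scale)
    then show ?thesis
      using lc_nonzero[OF js(1)] unfolding R right_diff_distrib mult.assoc[symmetric] mult_single
      by simp
  next
    case False
    then have "wt ?T < D" using low_step by simp
    moreover have "top_part D ?x = 0"
    proof -
      have "top_part D (mono_of t c * tail i) = 0"
        using keys_elt_mult[OF low_step(2)] \<open>wt ?T < D\<close> by (intro top_part_low) (meson less_trans)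
      moreover have "top_part D (mono_of ?T (c * lc i)) = 0"
        using \<open>wt ?T < D\<close> by (intro top_part_low) (auto split: if_splits)
      ultimately show ?thesis by (simp add: x top_part_add)
    qed
    ultimately show ?thesis using low_elt low_step by simp
  qed
  then have "(p - top_part D p) + (?x - top_part D ?x) \<in> low D"
    using low_step.IH low_add by blast
  then show ?case by (simp add: top_part_add algebra_simps)
qed

text \<open>Descent on the weight bound: without reducible monomials \<open>top_part D p\<close> is
  0, so membership in \<open>low (Suc D)\<close> improves to \<open>low D\<close>, and finally to
  \<open>low 0 = {0}\<close>.\<close>

theorem irreducible_eq_zero:
  assumes pairs: "\<And>T i j. i \<in> K \<Longrightarrow> j \<in> K \<Longrightarrow> spair_low T i j"
    and irr: "\<And>T. T \<in> Poly_Mapping.keys p \<Longrightarrow> \<not> reducible T"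
    and "p \<in> basis_ideal"
  shows "p = 0"
proof -
  have "p \<in> low D \<Longrightarrow> p = 0" for D
  proof (induction D)
    case 0
    then show ?case by (rule low.induct) simp_all
  next
    case (Suc D)
    have "top_part D p = 0"
      unfolding top_part_def by (intro sum.neutral ballI) (simp add: top_elt_def irr del: in_keys_iff)
    then have "p \<in> low D" using diff_top_part_low[OF pairs Suc.prems] by simp
    then show ?case by (rule Suc.IH)
  qed
  moreover obtain D where "p \<in> low D" using assms(3) unfolding basis_ideal_def by blast
  ultimately show ?thesis by blast
qed

text \<open>Division with remainder. Trading a leading term for its tail lowers the weight strictly,
  so the process ends although the weight does not order the monomials totally.\<close>

lemma irreducible_representative:
  "\<exists>q. (\<forall>T\<in>Poly_Mapping.keys q. \<not> reducible T) \<and> p - q \<in> basis_ideal"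
proof -
  let ?R = "\<lambda>p. \<exists>q. (\<forall>T\<in>Poly_Mapping.keys q. \<not> reducible T) \<and> p - q \<in> basis_ideal"
  have zero: "?R 0"
    by (intro exI[of _ 0]) (auto simp: basis_ideal_def low_zero)
  have plus: "?R (p + p')" if R: "?R p" "?R p'" for p p'
  proof -
    obtain q q' where "\<forall>T\<in>Poly_Mapping.keys q. \<not> reducible T" "p - q \<in> basis_ideal"
      "\<forall>T\<in>Poly_Mapping.keys q'. \<not> reducible T" "p' - q' \<in> basis_ideal"
      using R by blast
    then show ?thesis
      using keys_add[of q q'] basis_ideal_add[of "p - q" "p' - q'"]
      by (intro exI[of _ "q + q'"]) (auto simp: algebra_simps)
  qed
  have mono: "?R (mono_of T c)" for T c
  proof (induction "wt T" arbitrary: T c rule: less_induct)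
    case less
    show ?case
    proof (cases "reducible T")
      case False
      then show ?thesis
        by (intro exI[of _ "mono_of T c"]) (auto simp: basis_ideal_def low_zero)
    next
      case True
      then obtain i s where i: "i \<in> K" "T = s + lead i" unfolding reducible_def by blast
      let ?d = "c / lc i"
      have "Poly_Mapping.keys (- (mono_of s ?d * tail i)) \<subseteq> {t. wt t < wt T}"
        using keys_elt_mult[OF i(1)] i(2) by auto
      then have "?R (- (mono_of s ?d * tail i))"
        by (induction rule: additive_induct) (use zero plus less in auto)
      then obtain q where q: "\<forall>T\<in>Poly_Mapping.keys q. \<not> reducible T"
        "- (mono_of s ?d * tail i) - q \<in> basis_ideal" by blast
      have "mono_of s ?d * elt i \<in> basis_ideal"
        unfolding basis_ideal_def using low_elt[OF i(1), of s] by blast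
      from basis_ideal_add[OF q(2) this]
      have "mono_of T c - q \<in> basis_ideal"
        using lc_nonzero[OF i(1)] by (simp add: i(2) elt_def distrib_left mult_single)
      then show ?thesis using q(1) by blast
    qed
  qed
  have "Poly_Mapping.keys p \<subseteq> UNIV" by simp
  then show ?thesis
    by (induction rule: additive_induct) (use zero plus mono in auto)
qed

text \<open>The hypothesis on \<open>e\<close> is coprimality with the leading monomials.
  Multiplication by \<open>e\<close> then preserves irreducibility, so an irreducible representative
  \<open>q\<close> of \<open>p\<close> satisfies \<open>mono_of e 1 * q = 0\<close>.\<close>

theorem mono_nonzerodivisor:
  assumes pairs: "\<And>T i j. i \<in> K \<Longrightarrow> j \<in> K \<Longrightarrow> spair_low T i j"
    and e: "\<And>i s t. i \<in> K \<Longrightarrow> e + t = s + lead i \<Longrightarrow> \<exists>u. t = u + lead i"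
    and p: "mono_of e 1 * p \<in> basis_ideal"
  shows "p \<in> basis_ideal"
proof -
  obtain q where q: "\<forall>T\<in>Poly_Mapping.keys q. \<not> reducible T" "p - q \<in> basis_ideal"
    using irreducible_representative by blast
  let ?m = "mono_of e 1 :: 'm \<Rightarrow>\<^sub>0 'f"
  have "- ?m * (p - q) \<in> basis_ideal"
    by (rule basis_ideal_mult[OF q(2)])
  from basis_ideal_add[OF p this] have "?m * q \<in> basis_ideal"
    by (simp add: algebra_simps)
  moreover have "\<not> reducible T" if T: "T \<in> Poly_Mapping.keys (?m * q)" for T
  proof -
    obtain t where t: "t \<in> Poly_Mapping.keys q" "T = e + t"
      using subsetD[OF keys_mono_mult T] by blast
    show ?thesis
    proof
      assume "reducible T"
      then obtain i s where "i \<in> K" "e + t = s + lead i"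
        unfolding reducible_def t(2) by blast
      then have "reducible t" using e[of i t s] unfolding reducible_def by blast
      then show False using q(1) t(1) by blast
    qed
  qed
  ultimately have m0: "?m * q = 0"
    by (intro irreducible_eq_zero[OF pairs])
  have "q = 0"
  proof (rule poly_mapping_eqI)
    fix t
    show "Poly_Mapping.lookup q t = Poly_Mapping.lookup 0 t"
      using lookup_mono_mult[of e q t] m0 by simp
  qed
  then show ?thesis using q(2) by simp
qed

end

subsection \<open>Polynomials as sorted lists\<close>

text \<open>A monomial is the weakly decreasing list of its variables.\<close>

type_synonym mon = "int list"
type_synonym lpoly = "(int \<times> mon) list"

fun mon_mult :: "mon \<Rightarrow> mon \<Rightarrow> mon" where
  "mon_mult [] bs = bs"
| "mon_mult as [] = as"
| "mon_mult (a # as) (b # bs) =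
    (if b \<le> a then a # mon_mult as (b # bs) else b # mon_mult (a # as) bs)"

fun mon_div :: "mon \<Rightarrow> mon \<Rightarrow> mon option" where
  "mon_div as [] = Some as"
| "mon_div [] (b # bs) = None"
| "mon_div (a # as) (b # bs) = (if a = b then mon_div as bs
    else if b < a then map_option ((#) a) (mon_div as (b # bs)) else None)"

fun mon_diff :: "mon \<Rightarrow> mon \<Rightarrow> mon" where
  "mon_diff as [] = as"
| "mon_diff as (b # bs) = mon_diff (remove1 b as) bs"

text \<open>On monomials of equal degree, \<open>mon_less s t\<close> says that \<open>s\<close> is
  larger in the degree reverse lexicographic order with variable 1 largest; hence sorted homogeneous
  polynomials start with their leading term. Sortedness only makes cancellation happen:
  \<open>leval_add\<close> holds for arbitrary lists.\<close>

fun mon_less :: "mon \<Rightarrow> mon \<Rightarrow> bool" where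
  "mon_less [] bs = (bs \<noteq> [])"
| "mon_less as [] = False"
| "mon_less (a # as) (b # bs) = (a < b \<or> a = b \<and> mon_less as bs)"

fun ladd :: "lpoly \<Rightarrow> lpoly \<Rightarrow> lpoly" where
  "ladd [] q = q"
| "ladd p [] = p"
| "ladd ((c, s) # p) ((d, t) # q) =
    (if s = t then (if c + d = 0 then ladd p q else (c + d, s) # ladd p q)
     else if mon_less s t then (c, s) # ladd p ((d, t) # q)
     else (d, t) # ladd ((c, s) # p) q)"

definition lscale :: "int \<Rightarrow> mon \<Rightarrow> lpoly \<Rightarrow> lpoly"
  where "lscale c m p = map (\<lambda>(d, t). (c * d, mon_mult m t)) p"

fun lmult :: "lpoly \<Rightarrow> lpoly \<Rightarrow> lpoly" where
  "lmult [] q = []"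
| "lmult ((c, m) # p) q = ladd (lscale c m q) (lmult p q)"

definition mon_eval :: "(int \<Rightarrow> 'v) \<Rightarrow> mon \<Rightarrow> 'v \<Rightarrow>\<^sub>0 nat"
  where "mon_eval v m = (\<Sum>a\<leftarrow>m. Poly_Mapping.single (v a) 1)"

definition leval :: "(int \<Rightarrow> 'v) \<Rightarrow> lpoly \<Rightarrow> ('v \<Rightarrow>\<^sub>0 nat) \<Rightarrow>\<^sub>0 'f::comm_ring_1"
  where "leval v p = (\<Sum>(c, m)\<leftarrow>p. mono_of (mon_eval v m) (of_int c))"

lemma leval_simps [simp]:
  "leval v [] = 0"
  "leval v ((c, m) # p) = mono_of (mon_eval v m) (of_int c) + leval v p"
  by (simp_all add: leval_def)

lemma mon_eval_simps [simp]:
  "mon_eval v [] = 0"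
  "mon_eval v (a # m) = Poly_Mapping.single (v a) 1 + mon_eval v m"
  by (simp_all add: mon_eval_def)

lemma mon_eval_mult: "mon_eval v (mon_mult m n) = mon_eval v m + mon_eval v n"
  by (induction m n rule: mon_mult.induct) (simp_all add: add_ac)

lemma mon_eval_div: "mon_div t l = Some m \<Longrightarrow> mon_eval v t = mon_eval v m + mon_eval v l"
  by (induction t l arbitrary: m rule: mon_div.induct) (auto simp: add_ac split: if_splits)

lemma leval_add: "leval v (ladd p q) = leval v p + (leval v q :: _ \<Rightarrow>\<^sub>0 'f::comm_ring_1)"
proof (induction p q rule: ladd.induct)
  case (3 c s p d t q)
  then show ?case
    by (auto simp: add_ac single_add[symmetric] simp flip: of_int_add)
qed simp_all

lemma leval_scale:
  "leval v (lscale c m p) = mono_of (mon_eval v m) (of_int c) * (leval v p :: _ \<Rightarrow>\<^sub>0 'f::comm_ring_1)"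
  by (induction p) (auto simp: lscale_def mon_eval_mult mult_single distrib_left)

lemma leval_mult: "leval v (lmult p q) = leval v p * (leval v q :: _ \<Rightarrow>\<^sub>0 'f::comm_ring_1)"
  by (induction p q rule: lmult.induct) (simp_all add: leval_add leval_scale distrib_right)

lemma mset_mon_diff: "mset (mon_diff as bs) = mset as - mset bs"
  by (induction as bs rule: mon_diff.induct) simp_all

lemma lookup_mon_eval:
  assumes "inj_on v A" "set m \<subseteq> A" "a \<in> A"
  shows "Poly_Mapping.lookup (mon_eval v m) (v a) = count (mset m) a"
  using assms(2) by (induction m)
    (use assms in \<open>auto simp: lookup_add lookup_single when_def dest: inj_onD\<close>)

lemma lookup_mon_eval_notin:
  "y \<notin> v ` set m \<Longrightarrow> Poly_Mapping.lookup (mon_eval v m) y = 0"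
  by (induction m) (auto simp: lookup_add lookup_single when_def)

lemma mon_dividesI:
  fixes s t :: "'v \<Rightarrow>\<^sub>0 nat"
  assumes "\<And>y. Poly_Mapping.lookup s y \<le> Poly_Mapping.lookup t y"
  shows "\<exists>u. t = u + s"
  by (rule exI[of _ "t - s"], rule poly_mapping_eqI) (simp add: lookup_add lookup_minus assms)

subsection \<open>The Groebner basis\<close>

text \<open>
  The variables are numbered as in \<open>var_pos\<close> below. Each polynomial starts with its leading term;
  the elements 33 and 34 are the traces of \<open>M\<close> and \<open>N\<close>.
\<close>

definition basis_poly :: "int \<Rightarrow> lpoly"
  where "basis_poly i = (if i = 0 then [(2, [11, 6]), (1, [11, 8]), (-1, [12, 9]), (-2, [14, 3]), (-1, [16, 3]), (1, [17, 4])]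
    else if i = 1 then [(1, [11, 5]), (-1, [12, 6]), (1, [12, 8]), (-1, [13, 3]), (1, [14, 4]), (-1, [16, 4])]
    else if i = 2 then [(1, [11, 10]), (-1, [14, 9]), (-2, [16, 9]), (1, [17, 6]), (2, [17, 8]), (-1, [18, 3])]
    else if i = 3 then [(1, [14, 14]), (1, [15, 11]), (1, [16, 14]), (1, [16, 16]), (1, [17, 13]), (1, [18, 12])]
    else if i = 4 then [(1, [11, 7]), (2, [14, 6]), (1, [14, 8]), (1, [15, 3]), (1, [16, 6]), (2, [16, 8]), (2, [17, 5]), (2, [18, 4])]
    else if i = 5 then [(1, [12, 10]), (-2, [14, 6]), (-1, [14, 8]), (-2, [15, 3]), (-1, [16, 6]), (-2, [16, 8]), (-2, [17, 5]), (-3, [18, 4])]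
    else if i = 6 then [(1, [13, 9]), (2, [14, 6]), (1, [14, 8]), (2, [15, 3]), (1, [16, 6]), (2, [16, 8]), (1, [17, 5]), (2, [18, 4])]
    else if i = 7 then [(1, [6, 6]), (1, [7, 3]), (1, [8, 6]), (1, [8, 8]), (1, [9, 5]), (1, [10, 4])]
    else if i = 8 then [(1, [12, 7]), (-1, [13, 6]), (-2, [13, 8]), (1, [14, 5]), (-1, [15, 4]), (2, [16, 5])]
    else if i = 9 then [(1, [14, 10]), (1, [15, 9]), (-1, [16, 10]), (-1, [17, 7]), (-1, [18, 6]), (1, [18, 8])]
    else if i = 10 then [(1, [13, 10]), (-2, [14, 7]), (2, [15, 6]), (1, [15, 8]), (-1, [16, 7]), (-1, [18, 5])]
    else if i = 11 then [(1, [16, 11, 8]), (-1, [16, 12, 9]), (-1, [16, 16, 3]), (2, [17, 12, 6]), (-2, [17, 14, 4]), (1, [17, 16, 4]), (2, [18, 11, 4]), (-2, [18, 12, 3])]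
    else if i = 12 then [(1, [11, 8, 8]), (2, [12, 9, 6]), (-1, [12, 9, 8]), (-4, [14, 6, 3]), (-2, [14, 8, 3]), (-4, [15, 3, 3]), (-2, [16, 6, 3]), (-5, [16, 8, 3]), (4, [16, 9, 4]), (-4, [17, 5, 3]), (-2, [17, 6, 4]), (-3, [17, 8, 4]), (-4, [18, 4, 3])]
    else if i = 13 then [(1, [13, 11, 8]), (1, [14, 12, 8]), (-1, [16, 12, 6]), (2, [16, 12, 8]), (-1, [16, 13, 3]), (-2, [16, 16, 4]), (1, [17, 12, 5]), (-1, [17, 13, 4])]
    else if i = 14 then [(1, [12, 8, 6]), (1, [12, 8, 8]), (1, [12, 9, 5]), (1, [13, 8, 3]), (2, [14, 6, 4]), (1, [14, 8, 4]), (2, [15, 4, 3]), (-1, [16, 5, 3]), (1, [16, 8, 4]), (1, [17, 5, 4]), (2, [18, 4, 4])]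
    else if i = 15 then [(2, [16, 16, 9]), (-2, [17, 14, 6]), (-2, [17, 15, 3]), (-2, [17, 16, 6]), (-4, [17, 16, 8]), (-2, [17, 17, 5]), (-1, [18, 11, 8]), (1, [18, 12, 9]), (1, [18, 16, 3]), (-3, [18, 17, 4])]
    else if i = 16 then [(1, [16, 9, 6]), (-1, [16, 10, 3]), (-1, [17, 8, 6]), (1, [17, 10, 4]), (1, [18, 8, 3]), (-1, [18, 9, 4])]
    else if i = 17 then [(1, [16, 16, 16]), (-1, [17, 14, 13]), (1, [17, 15, 12]), (1, [17, 16, 13]), (1, [18, 13, 11]), (1, [18, 14, 12]), (2, [18, 16, 12])]
    else if i = 18 then [(1, [16, 14, 6]), (1, [16, 15, 3]), (1, [16, 16, 6]), (1, [17, 13, 6]), (-1, [17, 15, 4]), (-1, [18, 13, 3]), (-1, [18, 14, 4]), (-1, [18, 16, 4])]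
    else if i = 19 then [(1, [16, 16, 8]), (1, [17, 13, 8]), (-1, [17, 14, 5]), (1, [17, 15, 4]), (1, [18, 12, 6]), (1, [18, 13, 3]), (2, [18, 16, 4])]
    else if i = 20 then [(1, [14, 8, 6]), (1, [14, 8, 8]), (1, [14, 9, 5]), (1, [15, 8, 3]), (-1, [15, 9, 4]), (-1, [18, 5, 3]), (-1, [18, 6, 4]), (-1, [18, 8, 4])]
    else if i = 21 then [(1, [16, 8, 8]), (1, [16, 9, 5]), (1, [16, 10, 4]), (-1, [17, 6, 5]), (1, [17, 7, 4]), (1, [18, 5, 3]), (1, [18, 6, 4]), (1, [18, 8, 4])]
    else if i = 22 then [(1, [8, 8, 8]), (-1, [9, 6, 5]), (1, [9, 7, 4]), (1, [9, 8, 5]), (1, [10, 5, 3]), (1, [10, 6, 4]), (2, [10, 8, 4])]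
    else if i = 23 then [(1, [14, 13, 8]), (-1, [15, 12, 8]), (-1, [16, 14, 5]), (1, [16, 15, 4]), (1, [18, 12, 5]), (-1, [18, 13, 4])]
    else if i = 24 then [(1, [13, 8, 8]), (-1, [14, 6, 5]), (1, [14, 7, 4]), (-1, [14, 8, 5]), (-1, [15, 5, 3]), (-1, [15, 6, 4]), (-2, [16, 8, 5]), (-1, [17, 5, 5]), (-1, [18, 5, 4])]
    else if i = 25 then [(1, [16, 16, 10]), (1, [17, 14, 7]), (-1, [17, 15, 6]), (-1, [17, 15, 8]), (1, [17, 16, 7]), (1, [18, 14, 6]), (1, [18, 15, 3]), (1, [18, 16, 6]), (1, [18, 17, 5]), (1, [18, 18, 4])]
    else if i = 26 then [(1, [14, 9, 7]), (-2, [15, 9, 6]), (-1, [15, 9, 8]), (1, [15, 10, 3]), (1, [16, 10, 6]), (1, [16, 10, 8]), (1, [17, 7, 6]), (1, [17, 8, 7]), (-1, [18, 7, 3]), (-1, [18, 8, 6]), (-1, [18, 8, 8])]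
    else if i = 27 then [(1, [16, 9, 7]), (1, [16, 10, 6]), (1, [16, 10, 8]), (-1, [17, 8, 7]), (1, [17, 10, 5]), (-1, [18, 8, 6]), (-1, [18, 8, 8]), (-1, [18, 9, 5])]
    else if i = 28 then [(1, [16, 14, 7]), (-1, [16, 15, 6]), (-1, [16, 15, 8]), (1, [16, 16, 7]), (1, [17, 13, 7]), (-1, [17, 15, 5]), (1, [18, 13, 6]), (1, [18, 13, 8]), (-1, [18, 14, 5]), (-1, [18, 16, 5])]
    else if i = 29 then [(1, [14, 8, 7]), (-1, [15, 8, 6]), (1, [15, 9, 5]), (1, [15, 10, 4]), (-1, [16, 10, 5]), (-1, [17, 7, 5]), (-1, [18, 7, 4]), (1, [18, 8, 5])]
    else if i = 30 then [(1, [15, 9, 8, 6]), (1, [15, 9, 8, 8]), (1, [15, 9, 9, 5]), (-1, [15, 10, 8, 3]), (1, [15, 10, 9, 4]), (-1, [16, 10, 8, 6]), (1, [16, 10, 10, 4]), (-1, [17, 8, 7, 6]), (-1, [17, 8, 8, 7]), (-1, [17, 9, 7, 5]), (-1, [17, 10, 6, 5]), (1, [17, 10, 7, 4]), (1, [18, 8, 7, 3]), (1, [18, 8, 8, 6]), (1, [18, 9, 6, 5]), (-2, [18, 9, 7, 4]), (-1, [18, 10, 8, 4])]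
    else if i = 31 then [(1, [15, 9, 9, 7]), (2, [15, 10, 9, 6]), (1, [15, 10, 9, 8]), (-1, [15, 10, 10, 3]), (-1, [17, 9, 7, 7]), (-1, [17, 10, 7, 6]), (-2, [17, 10, 8, 7]), (1, [17, 10, 10, 5]), (-1, [18, 9, 7, 6]), (1, [18, 9, 8, 7]), (1, [18, 10, 7, 3]), (-1, [18, 10, 9, 5])]
    else if i = 32 then [(1, [15, 9, 8, 7]), (1, [15, 10, 8, 6]), (-1, [15, 10, 9, 5]), (-1, [15, 10, 10, 4]), (-1, [16, 10, 8, 7]), (1, [16, 10, 10, 5]), (-1, [17, 8, 7, 7]), (1, [17, 10, 7, 5]), (-1, [18, 8, 7, 6]), (1, [18, 8, 8, 7]), (1, [18, 10, 7, 4]), (-1, [18, 10, 8, 5])]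
    else if i = 33 then [(1, [1]), (1, [6]), (1, [8])]
    else [(1, [2]), (1, [14]), (1, [16])])"

definition basis_lead :: "int \<Rightarrow> mon"
  where "basis_lead i = snd (hd (basis_poly i))"

definition basis_coeff :: "int \<Rightarrow> int"
  where "basis_coeff i = fst (hd (basis_poly i))"

definition lead_table :: "(mon \<times> int) list"
  where "lead_table = map (\<lambda>i. (basis_lead i, i)) [0..34]"

text \<open>As a literal code equation the table is not recomputed from \<open>basis_poly\<close> at
  every division step.\<close>

lemma lead_table_code [code]:
  "lead_table = [([11, 6], 0), ([11, 5], 1), ([11, 10], 2), ([14, 14], 3), ([11, 7], 4), ([12, 10], 5),
    ([13, 9], 6), ([6, 6], 7), ([12, 7], 8), ([14, 10], 9), ([13, 10], 10), ([16, 11, 8], 11),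
    ([11, 8, 8], 12), ([13, 11, 8], 13), ([12, 8, 6], 14), ([16, 16, 9], 15), ([16, 9, 6], 16), ([16, 16, 16], 17),
    ([16, 14, 6], 18), ([16, 16, 8], 19), ([14, 8, 6], 20), ([16, 8, 8], 21), ([8, 8, 8], 22), ([14, 13, 8], 23),
    ([13, 8, 8], 24), ([16, 16, 10], 25), ([14, 9, 7], 26), ([16, 9, 7], 27), ([16, 14, 7], 28), ([14, 8, 7], 29),
    ([15, 9, 8, 6], 30), ([15, 9, 9, 7], 31), ([15, 9, 8, 7], 32), ([1], 33), ([2], 34)]"
  by code_simp

text \<open>
  The weights solve the linear inequalities which say that the chosen leading terms outweigh the
  tails. The value 1000 is for numbers that are not variables.
\<close>

definition var_weight :: "int \<Rightarrow> int"
  where "var_weight a = (if a = 1 then 60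
    else if a = 2 then 60
    else if a = 3 then 23
    else if a = 4 then 10
    else if a = 5 then 15
    else if a = 6 then 30
    else if a = 7 then 34
    else if a = 8 then 29
    else if a = 9 then 41
    else if a = 10 then 42
    else if a = 11 then 47
    else if a = 12 then 31
    else if a = 13 then 34
    else if a = 14 then 41
    else if a = 15 then 34
    else if a = 16 then 30
    else if a = 17 then 6
    else if a = 18 then 1
    else 1000)"

definition mon_weight :: "mon \<Rightarrow> int"
  where "mon_weight m = (\<Sum>a\<leftarrow>m. var_weight a)"

fun find_div :: "(mon \<times> int) list \<Rightarrow> mon \<Rightarrow> (int \<times> mon) option" where
  "find_div [] t = None"
| "find_div ((l, i) # ls) t =
    (case mon_div t l of None \<Rightarrow> find_div ls t | Some m \<Rightarrow> Some (i, m))"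

text \<open>Reduction without fractions: the polynomial is scaled by the leading coefficient before
  the subtraction. The subtracted multiple has leading monomial \<open>t\<close>, so the guard on
  \<open>mon_weight t\<close> is the weight bound that \<open>low\<close> asks for.\<close>

fun reduces :: "nat \<Rightarrow> int \<Rightarrow> lpoly \<Rightarrow> bool" where
  "reduces n W [] = True"
| "reduces 0 W (x # p) = False"
| "reduces (Suc n) W ((c, t) # p) = (mon_weight t < W \<and> (case find_div lead_table t of
      None \<Rightarrow> False
    | Some (i, m) \<Rightarrow> reduces n W
        (ladd (lscale (basis_coeff i) [] ((c, t) # p)) (lscale (- c) m (basis_poly i)))))"

text \<open>The value is 128, a bound on the number of reduction steps, built from
  \<open>Suc\<close> and addition because \<open>reduces\<close> recurses on it.\<close>

definition fuel :: nat
  where "fuel = (let f = (\<lambda>n. n + n + n + n) in f (f (f (Suc (Suc 0)))))"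

definition spair_reduces :: "int \<Rightarrow> int \<Rightarrow> bool"
  where "spair_reduces i j = (let a = mon_diff (basis_lead j) (basis_lead i);
      b = mon_diff (basis_lead i) (basis_lead j) in
    reduces fuel (mon_weight (mon_mult a (basis_lead i)))
      (ladd (lscale (basis_coeff j) a (basis_poly i)) (lscale (- basis_coeff i) b (basis_poly j))))"

text \<open>
  Pairs that are neither coprime nor listed in \<open>checked_pairs\<close> are dealt with by the chain
  criterion, along the intermediate elements given in \<open>chains\<close>.
\<close>

definition checked_pairs :: "int \<Rightarrow> int list"
  where "checked_pairs i = (if i = 0 then [1, 2, 4, 7, 11, 12, 13, 14, 16, 18, 20, 30]
    else if i = 1 then [2, 4, 11, 12, 13]
    else if i = 2 then [4, 5, 9, 10, 11, 12, 13, 25]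
    else if i = 3 then [9, 18, 20, 23, 26, 28, 29]
    else if i = 4 then [8, 11, 12, 13, 26, 27, 28, 29, 31, 32]
    else if i = 5 then [8, 9, 10, 14, 25]
    else if i = 6 then [10, 13, 15, 16, 23, 24, 26, 27, 30, 31, 32]
    else if i = 7 then [14, 16, 18, 20, 30]
    else if i = 8 then [14, 26, 27, 28, 29, 31, 32]
    else if i = 9 then [10, 18, 20, 23, 25, 26, 28, 29]
    else if i = 10 then [24, 25]
    else if i = 11 then [12, 13, 19, 21]
    else if i = 12 then [13, 22]
    else if i = 13 then [23, 24]
    else if i = 14 then [16, 19, 20, 21, 22, 24, 30]
    else if i = 15 then [16, 17, 19, 25, 27]
    else if i = 16 then [18, 21, 27, 30]
    else if i = 17 then [18, 19, 25, 28]
    else if i = 18 then [20, 21, 28]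
    else if i = 19 then [20, 21, 23, 25, 28]
    else if i = 20 then [22, 23, 29, 30]
    else if i = 21 then [22, 24, 27, 29]
    else if i = 22 then [24, 29, 30, 32]
    else if i = 23 then [24, 29]
    else if i = 26 then [27, 28, 29, 31]
    else if i = 27 then [31, 32]
    else if i = 28 then [29]
    else if i = 29 then [32]
    else if i = 30 then [32]
    else if i = 31 then [32]
    else [])"

definition chains :: "int \<Rightarrow> (int \<times> int list) list"
  where "chains i = (if i = 10 then [(23, [9]), (13, [2])]
    else if i = 11 then [(17, [19]), (23, [13]), (14, [0]), (16, [0]), (15, [19]), (20, [0]), (18, [0]), (24, [13]), (22, [12]), (25, [2]), (27, [4]), (29, [4]), (28, [4]), (30, [0]), (32, [4])]
    else if i = 12 then [(21, [11]), (24, [13]), (19, [11]), (20, [0]), (14, [0]), (23, [13]), (29, [4]), (30, [0]), (32, [4])]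
    else if i = 13 then [(19, [11]), (14, [0]), (21, [11]), (20, [0]), (29, [4]), (22, [12]), (30, [0]), (32, [4])]
    else if i = 14 then [(23, [20]), (18, [20]), (29, [8]), (32, [8])]
    else if i = 15 then [(21, [19]), (18, [16]), (28, [27, 26]), (26, [27]), (31, [27]), (32, [27]), (30, [16])]
    else if i = 16 then [(20, [18]), (25, [15]), (19, [15]), (28, [18]), (26, [27]), (17, [15]), (31, [27]), (32, [27])]
    else if i = 17 then [(21, [19]), (27, [15])]
    else if i = 18 then [(23, [20]), (19, [20]), (29, [20]), (27, [16]), (26, [28]), (25, [9]), (30, [16])]
    else if i = 19 then [(24, [21]), (27, [15]), (22, [21]), (29, [28]), (32, [15, 27]), (30, [15, 16])]
    else if i = 20 then [(26, [29]), (28, [18]), (21, [18]), (24, [23]), (32, [29])]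
    else if i = 21 then [(23, [24]), (25, [19]), (28, [29]), (32, [27]), (30, [16])]
    else if i = 22 then [(23, [24])]
    else if i = 23 then [(28, [29]), (26, [6]), (32, [6]), (30, [6])]
    else if i = 24 then [(29, [23]), (32, [6]), (30, [6])]
    else if i = 25 then [(27, [15]), (28, [9])]
    else if i = 26 then [(32, [29]), (30, [29, 20])]
    else if i = 27 then [(28, [26]), (29, [26]), (30, [16])]
    else if i = 28 then [(31, [26]), (32, [29])]
    else if i = 29 then [(31, [26]), (30, [20])]
    else if i = 30 then [(31, [32])]
    else [])"

definition coprime_mon :: "mon \<Rightarrow> mon \<Rightarrow> bool"
  where "coprime_mon s t = list_all (\<lambda>a. a \<notin> set t) s"

definition linked :: "int \<Rightarrow> int \<Rightarrow> bool"
  where "linked i j \<longleftrightarrow> coprime_mon (basis_lead i) (basis_lead j)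
    \<or> j \<in> set (checked_pairs i) \<or> i \<in> set (checked_pairs j)"

text \<open>In \<open>pair_covered\<close>, \<open>T\<close> is the least common multiple of the
  leading monomials at the two ends. Every intermediate leading monomial must divide it for the
  chain criterion to apply at \<open>T\<close>.\<close>

fun linked_path :: "mon \<Rightarrow> int \<Rightarrow> int list \<Rightarrow> int \<Rightarrow> bool" where
  "linked_path T i [] j = linked i j"
| "linked_path T i (k # ks) j = (0 \<le> k \<and> k < 35 \<and> linked i k
    \<and> mon_div T (basis_lead k) \<noteq> None \<and> linked_path T k ks j)"

definition pair_covered :: "int \<Rightarrow> int \<Rightarrow> bool"
  where "pair_covered i j \<longleftrightarrow> linked i j \<or> (case map_of (chains i) j of None \<Rightarrow> False
    | Some ks \<Rightarrow> linked_path
        (mon_mult (mon_diff (basis_lead j) (basis_lead i)) (basis_lead i)) i ks j)"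

lemma pairs_covered: "list_all (\<lambda>i. list_all (pair_covered i) [i + 1..34]) [0..34]"
  by code_simp

lemma spairs_reduce_0: "list_all (\<lambda>i. list_all (spair_reduces i) (checked_pairs i)) [0..2]"
  by code_simp

lemma spairs_reduce_1: "list_all (\<lambda>i. list_all (spair_reduces i) (checked_pairs i)) [3..4]"
  by code_simp

lemma spairs_reduce_2: "list_all (\<lambda>i. list_all (spair_reduces i) (checked_pairs i)) [5..6]"
  by code_simp

lemma spairs_reduce_3: "list_all (\<lambda>i. list_all (spair_reduces i) (checked_pairs i)) [7..9]"
  by code_simp

lemma spairs_reduce_4: "list_all (\<lambda>i. list_all (spair_reduces i) (checked_pairs i)) [10..14]"
  by code_simp

lemma spairs_reduce_5: "list_all (\<lambda>i. list_all (spair_reduces i) (checked_pairs i)) [15..19]"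
  by code_simp

lemma spairs_reduce_6: "list_all (\<lambda>i. list_all (spair_reduces i) (checked_pairs i)) [20..28]"
  by code_simp

lemma spairs_reduce_7: "list_all (\<lambda>i. list_all (spair_reduces i) (checked_pairs i)) [29..34]"
  by code_simp

lemma spairs_reduce: "list_all (\<lambda>i. list_all (spair_reduces i) (checked_pairs i)) [0..34]"
proof -
  have "[0..34] = [0..2] @ [3..4] @ [5..6] @ [7..9] @ [10..14] @ [15..19] @ [20..28] @ [29..34]"
    by code_simp
  then show ?thesis
    by (simp only: list_all_append spairs_reduce_0 spairs_reduce_1 spairs_reduce_2 spairs_reduce_3
        spairs_reduce_4 spairs_reduce_5 spairs_reduce_6 spairs_reduce_7 simp_thms)
qed

section \<open>Soundness of the list computations\<close>

definition var_pos :: "int \<Rightarrow> gg_mat \<times> 3 \<times> 3"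
  where "var_pos a = (if a = 1 then (gg_M, 2, 2)
    else if a = 2 then (gg_N, 2, 2)
    else if a = 3 then (gg_M, 2, 1)
    else if a = 4 then (gg_M, 3, 1)
    else if a = 5 then (gg_M, 3, 2)
    else if a = 6 then (gg_M, 1, 1)
    else if a = 7 then (gg_M, 1, 2)
    else if a = 8 then (gg_M, 3, 3)
    else if a = 9 then (gg_M, 2, 3)
    else if a = 10 then (gg_M, 1, 3)
    else if a = 11 then (gg_N, 2, 1)
    else if a = 12 then (gg_N, 3, 1)
    else if a = 13 then (gg_N, 3, 2)
    else if a = 14 then (gg_N, 1, 1)
    else if a = 15 then (gg_N, 1, 2)
    else if a = 16 then (gg_N, 3, 3)
    else if a = 17 then (gg_N, 2, 3)
    else (gg_N, 1, 3))"

lemma inj_var_pos: "inj_on var_pos {1..18}"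
proof -
  have "[1..18] = [1, 2, 3, 4, 5, 6, 7, 8, 9, 10, 11, 12, 13, 14, 15, 16, 17, 18]"
    by code_simp
  then have "distinct (map var_pos [1..18])"
    by (simp add: var_pos_def)
  then show ?thesis by (simp only: distinct_map set_upto)
qed

lemma var_pos_out: "a \<notin> {1..18} \<Longrightarrow> var_pos a = var_pos 18"
  by (auto simp: var_pos_def)

lemma var_weight_pos: "0 < var_weight a"
  by (simp add: var_weight_def)

lemma var_weight_out: "a \<notin> {1..18} \<Longrightarrow> var_weight a = 1000"
  by (auto simp: var_weight_def)

definition weight :: "(gg_mat \<times> 3 \<times> 3 \<Rightarrow>\<^sub>0 nat) \<Rightarrow> nat"
  where "weight t = (\<Sum>a\<in>{1..18}. Poly_Mapping.lookup t (var_pos a) * nat (var_weight a))"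

lemma weight_zero: "weight 0 = 0"
  by (simp add: weight_def)

lemma weight_add: "weight (s + t) = weight s + weight t"
  by (simp add: weight_def lookup_add distrib_right sum.distrib)

lemma weight_var: "a \<in> {1..18} \<Longrightarrow> int (weight (Poly_Mapping.single (var_pos a) 1)) = var_weight a"
proof -
  assume a: "a \<in> {1..18}"
  have "weight (Poly_Mapping.single (var_pos a) 1)
      = (\<Sum>b\<in>{1..18}. if b = a then nat (var_weight a) else 0)"
    unfolding weight_def
    by (intro sum.cong) (use a inj_onD[OF inj_var_pos] in \<open>auto simp: lookup_single when_def\<close>)
  then show ?thesis using a var_weight_pos[of a] by simp
qed

text \<open>Numbers outside 1..18 share the position of variable 18, of weight 1, while their
  nominal weight is 1000. The inequality thus survives for arbitrary lists, and reductions need no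
  check that their monomials are well formed.\<close>

lemma weight_var_le: "int (weight (Poly_Mapping.single (var_pos a) 1)) \<le> var_weight a"
proof (cases "a \<in> {1..18}")
  case True
  then show ?thesis using weight_var[OF True] by simp
next
  case False
  then show ?thesis
    using weight_var[of 18] by (simp add: var_pos_out var_weight_out) (simp add: var_weight_def)
qed

lemma weight_mon_eval_le: "int (weight (mon_eval var_pos m)) \<le> mon_weight m"
  by (induction m)
    (use weight_var_le in \<open>auto simp: mon_weight_def weight_add weight_zero add_mono\<close>)

lemma weight_mon_eval:
  "set m \<subseteq> {1..18} \<Longrightarrow> int (weight (mon_eval var_pos m)) = mon_weight m"
  by (induction m) (use weight_var in \<open>auto simp: mon_weight_def weight_add weight_zero\<close>)

lemma mon_eval_append: "mon_eval v (m @ n) = mon_eval v m + mon_eval v n"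
  by (simp add: mon_eval_def)

lemma mon_eval_mset: "mset m = mset n \<Longrightarrow> mon_eval v m = mon_eval v n"
  unfolding mon_eval_def by (metis mset_map sum_mset_sum_list)

text \<open>Variable 4 is \<open>M 3 1\<close>. Its absence from all leading monomials is what makes
  this coordinate a nonzerodivisor.\<close>

lemma basis_data:
  "list_all (\<lambda>i. basis_poly i \<noteq> [] \<and> (basis_coeff i = 1 \<or> basis_coeff i = 2)
    \<and> list_all (\<lambda>a. 1 \<le> a \<and> a \<le> 18 \<and> a \<noteq> 4) (basis_lead i)
    \<and> list_all (\<lambda>(c, t). mon_weight t < mon_weight (basis_lead i)) (tl (basis_poly i))) [0..34]"
  by code_simp

lemma
  assumes "i \<in> {0..34}"
  shows basis_poly_split: "basis_poly i = (basis_coeff i, basis_lead i) # tl (basis_poly i)"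
    and basis_coeff_cases: "basis_coeff i = 1 \<or> basis_coeff i = 2"
    and basis_lead_set: "set (basis_lead i) \<subseteq> {1..18} - {4}"
    and basis_tail_weight: "(c, t) \<in> set (tl (basis_poly i)) \<Longrightarrow> mon_weight t < mon_weight (basis_lead i)"
proof -
  have *: "basis_poly i \<noteq> [] \<and> (basis_coeff i = 1 \<or> basis_coeff i = 2)
    \<and> list_all (\<lambda>a. 1 \<le> a \<and> a \<le> 18 \<and> a \<noteq> 4) (basis_lead i)
    \<and> list_all (\<lambda>(c, t). mon_weight t < mon_weight (basis_lead i)) (tl (basis_poly i))"
    using basis_data assms unfolding list_all_iff set_upto by blast
  show "basis_poly i = (basis_coeff i, basis_lead i) # tl (basis_poly i)"
    using * by (cases "basis_poly i") (auto simp: basis_coeff_def basis_lead_def)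
  show "basis_coeff i = 1 \<or> basis_coeff i = 2"
    using * by blast
  show "set (basis_lead i) \<subseteq> {1..18} - {4}"
    using * by (auto simp: list_all_iff)
  show "(c, t) \<in> set (tl (basis_poly i)) \<Longrightarrow> mon_weight t < mon_weight (basis_lead i)"
    using * by (auto simp: list_all_iff)
qed

lemma keys_leval: "Poly_Mapping.keys (leval v p) \<subseteq> (\<lambda>(c, t). mon_eval v t) ` set p"
proof (induction p)
  case (Cons x p)
  obtain c t where x: "x = (c, t)" by force
  show ?case
    using keys_add[of "mono_of (mon_eval v t) (of_int c)" "leval v p"] Cons
    by (auto simp: x split: if_splits)
qed simp

lemma find_divD:
  "find_div ls t = Some (i, m) \<Longrightarrow> \<exists>l. (l, i) \<in> set ls \<and> mon_div t l = Some m"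
  by (induction ls t rule: find_div.induct) (auto split: option.splits)

lemma lookup_lead:
  "i \<in> {0..34} \<Longrightarrow> a \<in> {1..18} \<Longrightarrow>
    Poly_Mapping.lookup (mon_eval var_pos (basis_lead i)) (var_pos a) = count (mset (basis_lead i)) a"
  using basis_lead_set[of i] by (intro lookup_mon_eval[OF inj_var_pos]) auto

lemma lookup_lead_notin:
  "i \<in> {0..34} \<Longrightarrow> y \<notin> var_pos ` {1..18} \<Longrightarrow>
    Poly_Mapping.lookup (mon_eval var_pos (basis_lead i)) y = 0"
  using basis_lead_set[of i] by (intro lookup_mon_eval_notin) auto

lemma lead_diff:
  "mon_eval v (mon_diff s t) + mon_eval v t = mon_eval v (mon_diff t s) + mon_eval v s"
  unfolding mon_eval_append[symmetric]
  by (intro mon_eval_mset multiset_eqI) (simp add: mset_mon_diff)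

lemma lead_diff_least:
  assumes ij: "i \<in> {0..34}" "j \<in> {0..34}"
    and eq: "s + mon_eval var_pos (basis_lead i) = t + mon_eval var_pos (basis_lead j)"
  shows "\<exists>u. s = u + mon_eval var_pos (mon_diff (basis_lead j) (basis_lead i))"
proof (rule mon_dividesI)
  fix y
  let ?d = "mon_diff (basis_lead j) (basis_lead i)"
  have d: "set ?d \<subseteq> {1..18}"
  proof -
    have "set_mset (mset ?d) \<subseteq> set_mset (mset (basis_lead j))"
      unfolding mset_mon_diff by (rule set_mset_mono) simp
    then show ?thesis using basis_lead_set[OF ij(2)] by auto
  qed
  show "Poly_Mapping.lookup (mon_eval var_pos ?d) y \<le> Poly_Mapping.lookup s y"
  proof (cases "y \<in> var_pos ` {1..18}")
    case True
    then obtain a where a: "a \<in> {1..18}" "y = var_pos a" by blast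
    have "Poly_Mapping.lookup s y + count (mset (basis_lead i)) a
        = Poly_Mapping.lookup t y + count (mset (basis_lead j)) a"
      using arg_cong[OF eq, of "\<lambda>p. Poly_Mapping.lookup p y"] ij a
      by (simp add: lookup_add lookup_lead)
    moreover have "Poly_Mapping.lookup (mon_eval var_pos ?d) y
        = count (mset (basis_lead j)) a - count (mset (basis_lead i)) a"
      using lookup_mon_eval[OF inj_var_pos d a(1)] by (simp add: a(2) mset_mon_diff)
    ultimately show ?thesis by simp
  next
    case False
    then have "y \<notin> var_pos ` set ?d" using d by blast
    then show ?thesis by (simp add: lookup_mon_eval_notin)
  qed
qed

lemma coprime_lead:
  assumes ij: "i \<in> {0..34}" "j \<in> {0..34}" and cop: "coprime_mon (basis_lead i) (basis_lead j)"
    and eq: "s + mon_eval var_pos (basis_lead i) = t + mon_eval var_pos (basis_lead j)"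
  shows "\<exists>u. s = u + mon_eval var_pos (basis_lead j)"
proof (rule mon_dividesI)
  fix y
  show "Poly_Mapping.lookup (mon_eval var_pos (basis_lead j)) y \<le> Poly_Mapping.lookup s y"
  proof (cases "y \<in> var_pos ` {1..18}")
    case True
    then obtain a where a: "a \<in> {1..18}" "y = var_pos a" by blast
    have "Poly_Mapping.lookup s y + count (mset (basis_lead i)) a
        = Poly_Mapping.lookup t y + count (mset (basis_lead j)) a"
      using arg_cong[OF eq, of "\<lambda>p. Poly_Mapping.lookup p y"] ij a
      by (simp add: lookup_add lookup_lead)
    moreover have "count (mset (basis_lead i)) a = 0 \<or> count (mset (basis_lead j)) a = 0"
      using cop by (auto simp: coprime_mon_def list_all_iff count_eq_zero_iff)
    moreover have "Poly_Mapping.lookup (mon_eval var_pos (basis_lead j)) y = count (mset (basis_lead j)) a"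
      using ij a by (simp add: lookup_lead)
    ultimately show ?thesis by linarith
  next
    case False
    then show ?thesis using lookup_lead_notin ij by simp
  qed
qed

text \<open>The number 2 is a leading coefficient of some basis elements and the factor at
  \<open>M 1 3\<close> when tr(M^2) is solved for it; 3 enters through the certificates built on the
  traces of cubes.\<close>

locale six_invertible =
  fixes field_type :: "'f::field itself"
  assumes two_nonzero: "(2::'f) \<noteq> 0" and three_nonzero: "(3::'f) \<noteq> 0"
begin

sublocale W: weighted_basis "{0..34}" "\<lambda>i. mon_eval var_pos (basis_lead i)"
  "\<lambda>i. of_int (basis_coeff i) :: 'f" "\<lambda>i. leval var_pos (tl (basis_poly i))" weight
proof
  show "weight (s + t) = weight s + weight t" for s t by (rule weight_add)
next
  fix i :: int assume i: "i \<in> {0..34}"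
  show "of_int (basis_coeff i) \<noteq> (0 :: 'f)"
    using basis_coeff_cases[OF i] two_nonzero by auto
next
  fix i :: int and t assume i: "i \<in> {0..34}"
    and "t \<in> Poly_Mapping.keys (leval var_pos (tl (basis_poly i)) :: _ \<Rightarrow>\<^sub>0 'f)"
  then obtain c m where m: "(c, m) \<in> set (tl (basis_poly i))" "t = mon_eval var_pos m"
    using keys_leval[of var_pos "tl (basis_poly i)"] by fastforce
  have "int (weight t) < int (weight (mon_eval var_pos (basis_lead i)))"
  proof -
    have "set (basis_lead i) \<subseteq> {1..18}" using basis_lead_set[OF i] by blast
    then show ?thesis
      using weight_mon_eval_le[of m] basis_tail_weight[OF i m(1)] weight_mon_eval m(2) by simp
  qed
  then show "weight t < weight (mon_eval var_pos (basis_lead i))" by simp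
qed

lemma elt_eq:
  assumes "i \<in> {0..34}"
  shows "W.elt i = leval var_pos (basis_poly i)"
  unfolding W.elt_def leval_simps(2)[symmetric] basis_poly_split[OF assms, symmetric] ..

text \<open>The steps are undone from the end: each adds back a multiple of a basis element with
  leading monomial \<open>t\<close>, of weight below the bound, and then cancels the invertible
  leading coefficient.\<close>

lemma reduces_low: "reduces n B p \<Longrightarrow> leval var_pos p \<in> W.low (nat B)"
proof (induction n B p rule: reduces.induct)
  case (1 n W)
  then show ?case by (simp add: W.low_zero)
next
  case (3 n W c t p)
  let ?p = "(c, t) # p"
  obtain i m where im: "find_div lead_table t = Some (i, m)"
    and r: "reduces n W (ladd (lscale (basis_coeff i) [] ?p) (lscale (- c) m (basis_poly i)))"
    and w: "mon_weight t < W"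
    using 3(2) by (auto split: option.splits)
  obtain l where l: "(l, i) \<in> set lead_table" "mon_div t l = Some m"
    using find_divD[OF im] by blast
  have i: "i \<in> {0..34}" and li: "l = basis_lead i"
    using l(1) by (auto simp: lead_table_def)
  let ?g = "mono_of (mon_eval var_pos m) (of_int c) * W.elt i"
  have e: "leval var_pos (ladd (lscale (basis_coeff i) [] ?p) (lscale (- c) m (basis_poly i)))
      = mono_of 0 (of_int (basis_coeff i)) * leval var_pos ?p - ?g"
    unfolding leval_add leval_scale elt_eq[OF i] by (simp add: single_uminus)
  have "mono_of 0 (of_int (basis_coeff i)) * leval var_pos ?p - ?g \<in> W.low (nat W)"
    using 3(1)[OF im refl r] unfolding e .
  moreover have "?g \<in> W.low (nat W)"
  proof (rule W.low_elt[OF i])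
    have "mon_eval var_pos m + mon_eval var_pos (basis_lead i) = mon_eval var_pos t"
      using mon_eval_div[OF l(2), of var_pos] by (simp add: li)
    then show "weight (mon_eval var_pos m + mon_eval var_pos (basis_lead i)) < nat W"
      using weight_mon_eval_le[of t] w by simp
  qed
  ultimately have "mono_of 0 (of_int (basis_coeff i)) * leval var_pos ?p \<in> W.low (nat W)"
    using W.low_add by force
  then show ?case by (rule W.low_scale_cancel[OF W.lc_nonzero[OF i]])
qed simp

lemma spair_reduces_low:
  assumes ij: "i \<in> {0..34}" "j \<in> {0..34}" and r: "spair_reduces i j"
  shows "W.spair_low T i j"
proof (rule W.spair_low_least[OF lead_diff lead_diff_least[OF ij]])
  let ?a = "mon_diff (basis_lead j) (basis_lead i)" and ?b = "mon_diff (basis_lead i) (basis_lead j)"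
  let ?B = "mon_weight (mon_mult ?a (basis_lead i))"
  have "leval var_pos (ladd (lscale (basis_coeff j) ?a (basis_poly i))
      (lscale (- basis_coeff i) ?b (basis_poly j))) \<in> W.low (nat ?B)"
    using r by (intro reduces_low[of fuel]) (simp add: spair_reduces_def Let_def)
  then have *: "mono_of (mon_eval var_pos ?a) (of_int (basis_coeff j)) * W.elt i
      - mono_of (mon_eval var_pos ?b) (of_int (basis_coeff i)) * W.elt j \<in> W.low (nat ?B)"
    unfolding leval_add leval_scale elt_eq[OF ij(1)] elt_eq[OF ij(2)] by (simp add: single_uminus)
  have "set (mon_mult ?a (basis_lead i)) \<subseteq> {1..18}"
  proof -
    have "set (mon_mult s t) = set s \<union> set t" for s t
      by (induction s t rule: mon_mult.induct) auto
    moreover have "set_mset (mset ?a) \<subseteq> set_mset (mset (basis_lead j))"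
      unfolding mset_mon_diff by (rule set_mset_mono) simp
    ultimately show ?thesis
      using basis_lead_set[OF ij(1)] basis_lead_set[OF ij(2)] by simp blast
  qed
  then have "int (weight (mon_eval var_pos ?a + mon_eval var_pos (basis_lead i))) = ?B"
    using weight_mon_eval by (simp add: mon_eval_mult[symmetric])
  then have "nat ?B = weight (mon_eval var_pos ?a + mon_eval var_pos (basis_lead i))"
    by (simp only: nat_int[symmetric])
  then show "mono_of (mon_eval var_pos ?a) (of_int (basis_coeff j)) * W.elt i
      - mono_of (mon_eval var_pos ?b) (of_int (basis_coeff i)) * W.elt j
      \<in> W.low (weight (mon_eval var_pos ?a + mon_eval var_pos (basis_lead i)))"
    using * by simp
qed

lemma linked_low:
  assumes ij: "i \<in> {0..34}" "j \<in> {0..34}" and "linked i j"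
  shows "W.spair_low T i j"
proof -
  have c: "W.spair_low T k l"
    if "k \<in> {0..34}" "l \<in> {0..34}" "l \<in> set (checked_pairs k)" for k l
    using spairs_reduce that by (intro spair_reduces_low) (auto simp: list_all_iff)
  consider "coprime_mon (basis_lead i) (basis_lead j)"
    | "j \<in> set (checked_pairs i)" | "i \<in> set (checked_pairs j)"
    using \<open>linked i j\<close> unfolding linked_def by blast
  then show ?thesis
  proof cases
    case 1
    then show ?thesis by (intro W.spair_low_coprime[OF ij coprime_lead[OF ij]])
  next
    case 2
    then show ?thesis by (intro c ij)
  next
    case 3
    then show ?thesis by (intro W.spair_low_sym[OF c] ij)
  qed
qed

lemma linked_path_low:
  assumes "i \<in> {0..34}" "j \<in> {0..34}" "linked_path m i ks j"
  shows "W.spair_low (u + mon_eval var_pos m) i j"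
  using assms
proof (induction ks arbitrary: i)
  case Nil
  then show ?case by (simp add: linked_low)
next
  case (Cons k ks)
  from Cons.prems obtain q where k: "k \<in> {0..34}" "linked i k" "linked_path m k ks j"
    and q: "mon_div m (basis_lead k) = Some q" by auto
  have "(u + mon_eval var_pos q) + mon_eval var_pos (basis_lead k) = u + mon_eval var_pos m"
    using mon_eval_div[OF q, of var_pos] by (simp add: add.assoc)
  from W.spair_low_chain[OF linked_low[OF Cons.prems(1) k(1,2)]
      Cons.IH[OF k(1) Cons.prems(2) k(3)] k(1) this]
  show ?case .
qed

lemma pair_covered_low:
  assumes ij: "i \<in> {0..34}" "j \<in> {0..34}" and c: "pair_covered i j"
  shows "W.spair_low T i j"
proof (cases "linked i j")
  case True
  then show ?thesis by (intro linked_low ij)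
next
  case False
  let ?a = "mon_diff (basis_lead j) (basis_lead i)"
  obtain ks where ks: "linked_path (mon_mult ?a (basis_lead i)) i ks j"
    using c False by (auto simp: pair_covered_def split: option.splits)
  show ?thesis
  proof (rule W.spair_lowI)
    fix s t assume s: "s + mon_eval var_pos (basis_lead i) = T"
      and t: "t + mon_eval var_pos (basis_lead j) = T"
    then obtain u where "s = u + mon_eval var_pos ?a"
      using lead_diff_least[OF ij, of s t] by auto
    then have "T = u + mon_eval var_pos (mon_mult ?a (basis_lead i))"
      using s by (simp add: mon_eval_mult add.assoc)
    then have "W.spair_low T i j"
      using linked_path_low[OF ij ks] by simp
    from W.spair_lowD[OF this s t]
    show "mono_of s (of_int (basis_coeff j)) * W.elt i - mono_of t (of_int (basis_coeff i)) * W.elt j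
        \<in> W.low (weight T)" .
  qed
qed

lemma all_spairs_low: "i \<in> {0..34} \<Longrightarrow> j \<in> {0..34} \<Longrightarrow> W.spair_low T i j"
proof (induction i j rule: linorder_wlog)
  case (le i j)
  show ?case
  proof (cases "i = j")
    case False
    then have "pair_covered i j"
      using le pairs_covered by (auto simp: list_all_iff)
    then show ?thesis using le by (intro pair_covered_low)
  qed (simp add: W.spair_low_refl)
next
  case (sym i j)
  then show ?case by (intro W.spair_low_sym[OF sym(1)])
qed

lemma M31_nonzerodivisor:
  assumes "mono_of (Poly_Mapping.single (gg_M, 3, 1) 1) 1 * p \<in> W.basis_ideal"
  shows "p \<in> W.basis_ideal"
proof (rule W.mono_nonzerodivisor[OF all_spairs_low _ assms])
  fix i :: int and s t
  assume i: "i \<in> {0..34}"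
    and eq: "Poly_Mapping.single (gg_M, 3, 1) 1 + t = s + mon_eval var_pos (basis_lead i)"
  have v4: "(gg_M, 3, 1) = var_pos 4" by (simp add: var_pos_def)
  show "\<exists>u. t = u + mon_eval var_pos (basis_lead i)"
  proof (rule mon_dividesI)
    fix y
    have eq': "(if y = (gg_M, 3, 1) then 1 else 0) + Poly_Mapping.lookup t y
        = Poly_Mapping.lookup s y + Poly_Mapping.lookup (mon_eval var_pos (basis_lead i)) y"
      using arg_cong[OF eq, of "\<lambda>p. Poly_Mapping.lookup p y"]
      by (auto simp: lookup_add lookup_single when_def)
    show "Poly_Mapping.lookup (mon_eval var_pos (basis_lead i)) y \<le> Poly_Mapping.lookup t y"
    proof (cases "y = (gg_M, 3, 1)")
      case True
      have "count (mset (basis_lead i)) 4 = 0"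
        using basis_lead_set[OF i] by (auto simp: count_eq_zero_iff)
      moreover have "Poly_Mapping.lookup (mon_eval var_pos (basis_lead i)) (var_pos 4)
          = count (mset (basis_lead i)) 4"
        by (rule lookup_lead[OF i]) simp
      ultimately show ?thesis unfolding True v4 by (simp only: le0)
    next
      case False
      then show ?thesis using eq' by simp
    qed
  qed
qed

end

section \<open>The basis generates the ideal of the stated relations\<close>

type_synonym lmat = "int \<Rightarrow> int \<Rightarrow> lpoly"

definition lvar :: "int \<Rightarrow> lpoly"
  where "lvar a = [(1, [a])]"

definition lM :: lmat
  where "lM i j = lvar (if i = 1 then (if j = 1 then 6 else if j = 2 then 7 else 10)
    else if i = 2 then (if j = 1 then 3 else if j = 2 then 1 else 9)
    else (if j = 1 then 4 else if j = 2 then 5 else 8))"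

definition lN :: lmat
  where "lN i j = lvar (if i = 1 then (if j = 1 then 14 else if j = 2 then 15 else 18)
    else if i = 2 then (if j = 1 then 11 else if j = 2 then 2 else 17)
    else (if j = 1 then 12 else if j = 2 then 13 else 16))"

definition lmat_mult :: "lmat \<Rightarrow> lmat \<Rightarrow> lmat"
  where "lmat_mult A B i j =
    ladd (lmult (A i 1) (B 1 j)) (ladd (lmult (A i 2) (B 2 j)) (lmult (A i 3) (B 3 j)))"

definition ltrace :: "lmat \<Rightarrow> lpoly"
  where "ltrace A = ladd (A 1 1) (ladd (A 2 2) (A 3 3))"

datatype gen = Gen_trM | Gen_trN | Gen_trMM | Gen_trMN | Gen_trNN | Gen_comm int int
  | Gen_trMMM | Gen_trNNN | Gen_MMN int int | Gen_MNN int int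

fun gen_poly :: "gen \<Rightarrow> lpoly" where
  "gen_poly Gen_trM = ltrace lM"
| "gen_poly Gen_trN = ltrace lN"
| "gen_poly Gen_trMM = ltrace (lmat_mult lM lM)"
| "gen_poly Gen_trMN = ltrace (lmat_mult lM lN)"
| "gen_poly Gen_trNN = ltrace (lmat_mult lN lN)"
| "gen_poly (Gen_comm i j) = ladd (lmat_mult lM lN i j) (lscale (- 1) [] (lmat_mult lN lM i j))"
| "gen_poly Gen_trMMM = ltrace (lmat_mult (lmat_mult lM lM) lM)"
| "gen_poly Gen_trNNN = ltrace (lmat_mult (lmat_mult lN lN) lN)"
| "gen_poly (Gen_MMN i j) = lmat_mult (lmat_mult lM lM) lN i j"
| "gen_poly (Gen_MNN i j) = lmat_mult (lmat_mult lM lN) lN i j"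

definition gens :: "gen list"
  where "gens = [Gen_trM, Gen_trN, Gen_trMM, Gen_trMN, Gen_trNN]
    @ concat (map (\<lambda>i. map (Gen_comm i) [1, 2, 3]) [1, 2, 3])
    @ [Gen_trMMM, Gen_trNNN]
    @ concat (map (\<lambda>i. map (Gen_MMN i) [1, 2, 3]) [1, 2, 3])
    @ concat (map (\<lambda>i. map (Gen_MNN i) [1, 2, 3]) [1, 2, 3])"

text \<open>Only membership in the ideal is wanted, so 1000 is just some number above all weights
  that occur.\<close>

lemma gens_reduce: "list_all (\<lambda>g. reduces fuel 1000 (gen_poly g)) gens"
  by code_simp

text \<open>
  The entry \<open>(d, gs, bs)\<close> at position \<open>k\<close> writes \<open>d\<close> times the \<open>k\<close>-th basis element as a
  combination of generators and of earlier basis elements. The only primes dividing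
  the numbers \<open>d\<close> are 2 and 3.
\<close>

definition basis_cert :: "(int \<times> (int \<times> mon \<times> gen) list \<times> (int \<times> mon \<times> int) list) list"
  where "basis_cert = [
    (1, [(-1, [], Gen_comm 2 1), (1, [11], Gen_trM), (-1, [3], Gen_trN)], []),
    (1, [(1, [], Gen_comm 3 1)], []),
    (1, [(-1, [], Gen_comm 2 3), (-1, [9], Gen_trN), (1, [17], Gen_trM)], []),
    (2, [(1, [], Gen_trNN), (-1, [2], Gen_trN), (1, [14], Gen_trN), (1, [16], Gen_trN)], []),
    (1, [(1, [], Gen_trMN), (-1, [2], Gen_trM), (1, [6], Gen_trN), (1, [8], Gen_trN), (1, [], Gen_comm 3 3)], []),
    (1, [(-1, [], Gen_trMN), (1, [2], Gen_trM), (-1, [6], Gen_trN), (-1, [8], Gen_trN), (2, [], Gen_comm 1 1), (1, [], Gen_comm 2 2)], []),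
    (1, [(1, [], Gen_trMN), (-1, [2], Gen_trM), (1, [6], Gen_trN), (1, [8], Gen_trN), (-1, [], Gen_comm 1 1)], []),
    (2, [(1, [], Gen_trMM), (-1, [1], Gen_trM), (1, [6], Gen_trM), (1, [8], Gen_trM)], []),
    (1, [(-1, [], Gen_comm 3 2), (-1, [13], Gen_trM), (1, [5], Gen_trN)], []),
    (1, [(-1, [], Gen_comm 1 3)], []),
    (1, [(1, [], Gen_comm 1 2), (1, [15], Gen_trM), (-1, [7], Gen_trN)], []),
    (1, [(1, [14], Gen_comm 2 1), (1, [14, 3], Gen_trN), (-1, [], Gen_MNN 2 1), (1, [11, 2], Gen_trM), (-1, [11, 6], Gen_trN), (-1, [11, 8], Gen_trN), (1, [17, 12], Gen_trM)], [(-1, [3], 3), (1, [11], 6), (-1, [17], 1)]),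
    (1, [(-2, [], Gen_MMN 2 1), (2, [11, 1], Gen_trM), (-2, [11, 6], Gen_trM), (-2, [11, 8], Gen_trM), (2, [12, 9], Gen_trM), (2, [14, 3], Gen_trM)], [(1, [8], 0), (2, [3], 5), (-2, [4], 2), (2, [11], 7)]),
    (1, [(1, [], Gen_MNN 3 1), (-1, [11, 5], Gen_trN)], [(-1, [4], 3), (1, [16], 1)]),
    (1, [(2, [], Gen_MMN 3 1), (-1, [11, 5], Gen_trM), (-2, [4], Gen_comm 1 1), (-1, [5], Gen_comm 2 1), (-1, [5, 3], Gen_trN), (-1, [8], Gen_comm 3 1)], []),
    (1, [(2, [], Gen_MNN 2 3), (-2, [17, 2], Gen_trM), (-2, [18, 11], Gen_trM), (-2, [17, 16], Gen_trM), (2, [17, 6], Gen_trN), (2, [17, 8], Gen_trN)], [(1, [18], 0), (-2, [17], 6)]),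
    (1, [(-1, [], Gen_MMN 2 3), (1, [16, 9], Gen_trM), (1, [17, 1], Gen_trM), (-1, [17, 6], Gen_trM), (-1, [17, 8], Gen_trM), (1, [18, 3], Gen_trM)], [(1, [17], 7)]),
    (6, [(3, [16], Gen_trNN), (-1, [16, 2], Gen_trN), (-1, [16, 14], Gen_trN), (1, [16, 16], Gen_trN), (2, [], Gen_trNNN), (-2, [2, 2], Gen_trN), (2, [14, 2], Gen_trN), (-2, [14, 14], Gen_trN), (-6, [15, 11], Gen_trN), (-6, [17, 13], Gen_trN)], []),
    (2, [(-1, [], Gen_MNN 3 3), (1, [17, 5], Gen_trN), (1, [18], Gen_comm 3 1), (-1, [], Gen_MNN 2 2), (1, [2, 2], Gen_trM), (-1, [6, 2], Gen_trN), (-1, [8, 2], Gen_trN), (1, [15, 11], Gen_trM), (1, [13, 9], Gen_trN), (1, [14, 6], Gen_trN), (1, [14, 8], Gen_trN), (1, [16, 6], Gen_trN), (1, [16, 8], Gen_trN), (1, [15, 3], Gen_trN), (1, [17, 13], Gen_trM)], [(-1, [14], 6), (-1, [15], 0), (1, [6], 3)]),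
    (1, [(1, [], Gen_MNN 3 3), (-1, [17, 5], Gen_trN)], [(-1, [18], 1)]),
    (2, [(-1, [], Gen_MMN 2 2), (1, [2, 1], Gen_trM), (-1, [6, 2], Gen_trM), (-1, [8, 2], Gen_trM), (1, [13, 9], Gen_trM), (1, [6, 6], Gen_trN), (2, [8, 6], Gen_trN), (1, [8, 8], Gen_trN), (2, [15, 3], Gen_trM), (1, [9, 5], Gen_trN), (-1, [], Gen_MMN 3 3), (1, [17, 5], Gen_trM), (1, [3], Gen_comm 1 2), (1, [4], Gen_comm 1 3)], [(1, [14], 7), (-1, [6], 6)]),
    (1, [(1, [], Gen_MMN 3 3), (-1, [17, 5], Gen_trM)], []),
    (6, [(3, [8], Gen_trMM), (-1, [8, 1], Gen_trM), (-1, [8, 6], Gen_trM), (1, [8, 8], Gen_trM), (2, [], Gen_trMMM), (-2, [1, 1], Gen_trM), (2, [6, 1], Gen_trM), (-2, [6, 6], Gen_trM), (-6, [7, 3], Gen_trM), (-6, [9, 5], Gen_trM)], []),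
    (1, [(-1, [], Gen_MNN 3 2), (1, [5, 2], Gen_trN), (1, [13, 8], Gen_trN), (-1, [14, 5], Gen_trN), (-1, [16, 5], Gen_trN), (1, [15, 4], Gen_trN)], [(1, [5], 3)]),
    (1, [(1, [], Gen_MMN 3 2), (-1, [5, 2], Gen_trM), (1, [6, 5], Gen_trN), (-1, [4], Gen_comm 1 2), (-1, [15, 4], Gen_trM)], [(-1, [5], 6)]),
    (1, [(1, [], Gen_MNN 1 3), (-1, [17], Gen_comm 1 2), (-1, [17, 15], Gen_trM), (-1, [18], Gen_comm 1 1)], []),
    (1, [(-2, [], Gen_MMN 1 3), (2, [17, 7], Gen_trM)], [(-1, [8], 9), (1, [10], 4), (-1, [7], 2), (-2, [6], 9)]),
    (1, [(1, [], Gen_MMN 1 3), (-1, [17, 7], Gen_trM)], [(-1, [18], 7)]),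
    (1, [(2, [], Gen_MNN 1 2), (-2, [7, 2], Gen_trN), (-2, [13, 10], Gen_trN), (2, [14, 7], Gen_trN), (1, [16, 7], Gen_trN), (-3, [15, 6], Gen_trN), (1, [16], Gen_comm 1 2), (1, [16, 15], Gen_trM), (-1, [15], Gen_trMN), (1, [15, 2], Gen_trM), (-1, [15, 8], Gen_trN), (-1, [15], Gen_comm 1 1)], [(1, [13], 9), (1, [14], 10)]),
    (1, [(-1, [8], Gen_comm 1 2), (-1, [15, 8], Gen_trM), (-1, [], Gen_MMN 1 2), (1, [7, 2], Gen_trM), (1, [10, 5], Gen_trN), (-1, [7], Gen_comm 3 3)], [(1, [15], 7), (-1, [10], 8)]),
    (1, [], [(-1, [8], 26), (1, [9], 29), (-1, [18], 22), (1, [10], 21)]),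
    (1, [(-1, [9, 7], Gen_comm 1 3)], [(-1, [10], 26), (1, [10], 27)]),
    (1, [], [(1, [8, 7], 9), (-1, [10], 29)]),
    (1, [(1, [], Gen_trM)], []),
    (1, [(1, [], Gen_trN)], [])]"

definition cert_ok :: "int \<Rightarrow> int \<times> (int \<times> mon \<times> gen) list \<times> (int \<times> mon \<times> int) list \<Rightarrow> bool"
  where "cert_ok k x = (case x of (d, gs, bs) \<Rightarrow> d \<in> {1, 2, 3, 4, 6}
    \<and> list_all (\<lambda>(c, m, g). g \<in> set gens) gs \<and> list_all (\<lambda>(c, m, i). 0 \<le> i \<and> i < k) bs
    \<and> foldr (\<lambda>(c, m, g). ladd (lscale c m (gen_poly g))) gs
        (foldr (\<lambda>(c, m, i). ladd (lscale c m (basis_poly i))) bs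
          (lscale (- d) [] (basis_poly k))) = [])"

lemma basis_cert_ok: "list_all2 cert_ok [0..34] basis_cert"
  by code_simp

definition represents :: "lmat \<Rightarrow> (gg_mat, 'f::comm_ring_1) mat_poly ^ 3 ^ 3 \<Rightarrow> bool"
  where "represents A P \<longleftrightarrow>
    (\<forall>i\<in>{1, 2, 3}. \<forall>j\<in>{1, 2, 3}. leval var_pos (A i j) = P $ of_int i $ of_int j)"

lemma representsD:
  "represents A P \<Longrightarrow> i \<in> {1, 2, 3} \<Longrightarrow> j \<in> {1, 2, 3} \<Longrightarrow>
    leval var_pos (A i j) = P $ of_int i $ of_int j"
  unfolding represents_def by blast

lemma leval_lvar: "leval v (lvar a) = mono_of (Poly_Mapping.single (v a) 1) 1"
  by (simp add: lvar_def)

lemma represents_coord: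
  "represents lM (coord gg_M :: (gg_mat, 'f::comm_ring_1) mat_poly ^ 3 ^ 3)"
  "represents lN (coord gg_N :: (gg_mat, 'f::comm_ring_1) mat_poly ^ 3 ^ 3)"
  by (simp_all add: represents_def lM_def lN_def leval_lvar coord_def var_pos_def)

lemma represents_mult:
  assumes "represents A P" "represents B Y"
  shows "represents (lmat_mult A B) (P ** Y)"
  unfolding represents_def
proof (intro ballI)
  fix i j :: int assume ij: "i \<in> {1, 2, 3}" "j \<in> {1, 2, 3}"
  have A: "leval var_pos (A i k) = P $ of_int i $ of_int k" if "k \<in> {1, 2, 3}" for k
    by (rule representsD[OF assms(1) ij(1) that])
  have B: "leval var_pos (B k j) = Y $ of_int k $ of_int j" if "k \<in> {1, 2, 3}" for k
    by (rule representsD[OF assms(2) that ij(2)])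
  show "leval var_pos (lmat_mult A B i j) = (P ** Y) $ of_int i $ of_int j"
    by (simp add: lmat_mult_def leval_add leval_mult A B matrix_matrix_mult_def sum_3)
qed

lemma leval_ltrace: "represents A P \<Longrightarrow> leval var_pos (ltrace A) = trace P"
  by (simp add: ltrace_def leval_add representsD trace_def sum_3)

lemma entries_eq: "entries A = (\<lambda>(i, j). A $ of_int i $ of_int j) ` ({1, 2, 3} \<times> {1, 2, 3 :: int})"
proof -
  have *: "\<exists>k\<in>{1, 2, 3 :: int}. i = of_int k" for i :: 3
    using exhaust_3[of i] by auto
  show ?thesis
  proof (intro equalityI subsetI)
    fix x assume "x \<in> entries A"
    then obtain i j where "x = A $ i $ j" unfolding entries_def by blast
    then show "x \<in> (\<lambda>(i, j). A $ of_int i $ of_int j) ` ({1, 2, 3} \<times> {1, 2, 3 :: int})"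
      using *[of i] *[of j] by force
  qed (auto simp: entries_def)
qed

definition relations :: "(gg_mat, 'f::comm_ring_1) mat_poly set"
  where "relations = (let M = coord gg_M; N = coord gg_N in {trace M, trace N}
    \<union> {trace (M ** M), trace (M ** N), trace (N ** N)} \<union> entries (M ** N - N ** M)
    \<union> {trace (M ** M ** M), trace (N ** N ** N)}
    \<union> entries (M ** M ** N) \<union> entries (M ** N ** N))"

lemma set_gens: "set gens = {Gen_trM, Gen_trN, Gen_trMM, Gen_trMN, Gen_trNN, Gen_trMMM, Gen_trNNN}
    \<union> (\<lambda>(i, j). Gen_comm i j) ` ({1, 2, 3} \<times> {1, 2, 3})
    \<union> (\<lambda>(i, j). Gen_MMN i j) ` ({1, 2, 3} \<times> {1, 2, 3})
    \<union> (\<lambda>(i, j). Gen_MNN i j) ` ({1, 2, 3} \<times> {1, 2, 3})"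
  by (auto simp: gens_def)

lemma relations_eq:
  "relations = (\<lambda>g. leval var_pos (gen_poly g)) ` set gens"
proof -
  let ?M = "coord gg_M :: (gg_mat, 'a) mat_poly ^ 3 ^ 3" and ?N = "coord gg_N :: (gg_mat, 'a) mat_poly ^ 3 ^ 3"
  note rep = represents_coord[where 'f = 'a]
  note reps = rep represents_mult[OF rep(1) rep(1)] represents_mult[OF rep(1) rep(2)]
    represents_mult[OF rep(2) rep(1)] represents_mult[OF rep(2) rep(2)]
    represents_mult[OF represents_mult[OF rep(1) rep(1)] rep(1)]
    represents_mult[OF represents_mult[OF rep(2) rep(2)] rep(2)]
    represents_mult[OF represents_mult[OF rep(1) rep(1)] rep(2)]
    represents_mult[OF represents_mult[OF rep(1) rep(2)] rep(2)]
  have ev: "leval var_pos (gen_poly (Gen_comm i j)) = (?M ** ?N - ?N ** ?M) $ of_int i $ of_int j"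
    "leval var_pos (gen_poly (Gen_MMN i j)) = (?M ** ?M ** ?N) $ of_int i $ of_int j"
    "leval var_pos (gen_poly (Gen_MNN i j)) = (?M ** ?N ** ?N) $ of_int i $ of_int j"
    if "i \<in> {1, 2, 3}" "j \<in> {1, 2, 3}" for i j
    by (simp_all only: gen_poly.simps leval_add leval_scale representsD[OF reps(4) that]
        representsD[OF reps(5) that] representsD[OF reps(9) that] representsD[OF reps(10) that])
      (simp add: single_uminus)
  have comm: "entries (?M ** ?N - ?N ** ?M)
      = (\<lambda>g. leval var_pos (gen_poly g)) ` (\<lambda>(i, j). Gen_comm i j) ` ({1, 2, 3} \<times> {1, 2, 3})"
    unfolding entries_eq image_image
    by (intro image_cong refl, elim SigmaE) (simp only: prod.case ev)
  have MMN: "entries (?M ** ?M ** ?N)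
      = (\<lambda>g. leval var_pos (gen_poly g)) ` (\<lambda>(i, j). Gen_MMN i j) ` ({1, 2, 3} \<times> {1, 2, 3})"
    unfolding entries_eq image_image
    by (intro image_cong refl, elim SigmaE) (simp only: prod.case ev)
  have MNN: "entries (?M ** ?N ** ?N)
      = (\<lambda>g. leval var_pos (gen_poly g)) ` (\<lambda>(i, j). Gen_MNN i j) ` ({1, 2, 3} \<times> {1, 2, 3})"
    unfolding entries_eq image_image
    by (intro image_cong refl, elim SigmaE) (simp only: prod.case ev)
  show ?thesis
    unfolding relations_def Let_def set_gens image_Un comm MMN MNN
    by (simp add: reps[THEN leval_ltrace] Un_ac insert_commute)
qed

lemma ideal_ring_of_type_iff:
  "ideal I (ring_of_type_algebra :: 'a::comm_ring_1 ring) \<longleftrightarrow>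
    0 \<in> I \<and> (\<forall>x\<in>I. \<forall>y\<in>I. x + y \<in> I) \<and> (\<forall>r. \<forall>x\<in>I. r * x \<in> I)"
proof -
  let ?R = "ring_of_type_algebra :: 'a ring"
  interpret R: cring ?R by (rule cring_from_type_algebra)
  show ?thesis
  proof
    assume "ideal I ?R"
    then interpret ideal I ?R .
    show "0 \<in> I \<and> (\<forall>x\<in>I. \<forall>y\<in>I. x + y \<in> I) \<and> (\<forall>r. \<forall>x\<in>I. r * x \<in> I)"
      using additive_subgroup.zero_closed[OF is_additive_subgroup]
        additive_subgroup.a_closed[OF is_additive_subgroup] I_l_closed
      by (auto simp: ring_of_type_algebra_def)
  next
    assume I: "0 \<in> I \<and> (\<forall>x\<in>I. \<forall>y\<in>I. x + y \<in> I) \<and> (\<forall>r. \<forall>x\<in>I. r * x \<in> I)"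
    show "ideal I ?R"
    proof (rule idealI)
      show "ring ?R" by (rule R.ring_axioms)
      show "subgroup I (add_monoid ?R)"
      proof (rule R.add.subgroupI)
        show "I \<subseteq> carrier ?R" by (simp add: ring_of_type_algebra_def)
        show "I \<noteq> {}" using I by blast
        show "\<ominus>\<^bsub>?R\<^esub> a \<in> I" if a: "a \<in> I" for a
        proof -
          have "\<ominus>\<^bsub>?R\<^esub> a = - a"
            by (rule R.minus_equality) (simp_all add: ring_of_type_algebra_def)
          moreover have "(- 1) * a \<in> I" using I a by blast
          ultimately show ?thesis by simp
        qed
        show "a \<oplus>\<^bsub>?R\<^esub> b \<in> I" if "a \<in> I" "b \<in> I" for a b
          using I that by (simp add: ring_of_type_algebra_def)
      qed
      show "x \<otimes>\<^bsub>?R\<^esub> a \<in> I" if "a \<in> I" "x \<in> carrier ?R" for a x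
        using I that by (simp add: ring_of_type_algebra_def)
      then show "a \<otimes>\<^bsub>?R\<^esub> x \<in> I" if "a \<in> I" "x \<in> carrier ?R" for a x
        using that by (simp add: ring_of_type_algebra_def mult.commute[of a x])
    qed
  qed
qed

lemma
  fixes P :: "'a::comm_ring_1 set"
  shows Idl_self: "P \<subseteq> Idl\<^bsub>ring_of_type_algebra\<^esub> P"
    and Idl_zero: "0 \<in> Idl\<^bsub>ring_of_type_algebra\<^esub> P"
    and Idl_add: "\<And>x y. x \<in> Idl\<^bsub>ring_of_type_algebra\<^esub> P \<Longrightarrow>
      y \<in> Idl\<^bsub>ring_of_type_algebra\<^esub> P \<Longrightarrow> x + y \<in> Idl\<^bsub>ring_of_type_algebra\<^esub> P"
    and Idl_mult: "\<And>r x. x \<in> Idl\<^bsub>ring_of_type_algebra\<^esub> P \<Longrightarrow> r * x \<in> Idl\<^bsub>ring_of_type_algebra\<^esub> P"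
    and Idl_least: "\<And>I. 0 \<in> I \<Longrightarrow> (\<And>x y. x \<in> I \<Longrightarrow> y \<in> I \<Longrightarrow> x + y \<in> I) \<Longrightarrow>
      (\<And>r x. x \<in> I \<Longrightarrow> r * x \<in> I) \<Longrightarrow> P \<subseteq> I \<Longrightarrow> Idl\<^bsub>ring_of_type_algebra\<^esub> P \<subseteq> I"
  unfolding genideal_def ideal_ring_of_type_iff by auto

context six_invertible
begin

lemma basis_ideal_zero: "0 \<in> W.basis_ideal"
  unfolding W.basis_ideal_def using W.low_zero by blast

lemma foldr_leval:
  "leval v (foldr (\<lambda>(c, m, g). ladd (lscale c m (h g))) xs p)
    = (\<Sum>(c, m, g)\<leftarrow>xs. mono_of (mon_eval v m) (of_int c) * leval v (h g)) + (leval v p :: _ \<Rightarrow>\<^sub>0 'f)"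
  by (induction xs) (auto simp: leval_add leval_scale add.assoc)

lemma sum_list_in_Idl:
  fixes f :: "'b \<Rightarrow> 'a::comm_ring_1"
  shows "(\<And>c m g. (c, m, g) \<in> set xs \<Longrightarrow> f g \<in> Idl\<^bsub>ring_of_type_algebra\<^esub> P) \<Longrightarrow>
    (\<Sum>(c, m, g)\<leftarrow>xs. s c m * f g) \<in> Idl\<^bsub>ring_of_type_algebra\<^esub> P"
proof (induction xs)
  case (Cons x xs)
  obtain c m g where x: "x = (c, m, g)" by (cases x) auto
  have "f g \<in> Idl\<^bsub>ring_of_type_algebra\<^esub> P"
    using Cons.prems[of c m g] by (simp add: x)
  moreover have "(\<Sum>(c, m, g)\<leftarrow>xs. s c m * f g) \<in> Idl\<^bsub>ring_of_type_algebra\<^esub> P"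
    using Cons.prems by (intro Cons.IH) auto
  ultimately have "s c m * f g + (\<Sum>(c, m, g)\<leftarrow>xs. s c m * f g) \<in> Idl\<^bsub>ring_of_type_algebra\<^esub> P"
    by (intro Idl_add Idl_mult)
  then show ?case by (simp add: x)
qed (simp add: Idl_zero)

lemma basis_poly_in_Idl:
  "i \<in> {0..34} \<Longrightarrow> leval var_pos (basis_poly i) \<in> Idl\<^bsub>poly_ring\<^esub> (relations :: (gg_mat, 'f) mat_poly set)"
proof (induction "nat i" arbitrary: i rule: less_induct)
  case less
  let ?I = "Idl\<^bsub>poly_ring\<^esub> (relations :: (gg_mat, 'f) mat_poly set)"
  let ?ev = "leval var_pos :: lpoly \<Rightarrow> (gg_mat, 'f) mat_poly"
  obtain d gs bs where x: "basis_cert ! nat i = (d, gs, bs)" by (metis prod_cases3)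
  have "nat i < 35"
    using less.prems by (simp add: nat_less_iff)
  then have "cert_ok ([0..34] ! nat i) (basis_cert ! nat i)"
    by (intro list_all2_nthD[OF basis_cert_ok]) simp
  then have ok: "cert_ok i (d, gs, bs)"
    using less.prems by (simp add: x nth_upto)
  then have d: "d \<in> {1, 2, 3, 4, 6}"
    and gs: "\<And>c m g. (c, m, g) \<in> set gs \<Longrightarrow> g \<in> set gens"
    and bs: "\<And>c m j. (c, m, j) \<in> set bs \<Longrightarrow> 0 \<le> j \<and> j < i"
    and z: "foldr (\<lambda>(c, m, g). ladd (lscale c m (gen_poly g))) gs
        (foldr (\<lambda>(c, m, j). ladd (lscale c m (basis_poly j))) bs
          (lscale (- d) [] (basis_poly i))) = []"
    unfolding cert_ok_def list_all_iff by (auto simp only: prod.case)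
  let ?s = "(\<Sum>(c, m, g)\<leftarrow>gs. mono_of (mon_eval var_pos m) (of_int c) * ?ev (gen_poly g))"
  let ?t = "(\<Sum>(c, m, j)\<leftarrow>bs. mono_of (mon_eval var_pos m) (of_int c) * ?ev (basis_poly j))"
  have "?s \<in> ?I"
    using gs Idl_self[of relations] by (intro sum_list_in_Idl) (auto simp: relations_eq)
  moreover have "?t \<in> ?I"
    using bs less.prems by (intro sum_list_in_Idl less.hyps) force+
  moreover have "?s + (?t + mono_of 0 (- of_int d) * ?ev (basis_poly i)) = 0"
    using arg_cong[OF z, of ?ev] unfolding foldr_leval leval_scale by simp
  then have "?s + ?t = mono_of 0 (of_int d) * ?ev (basis_poly i)"
    by (simp add: single_uminus add_diff_eq)
  ultimately have "mono_of 0 (of_int d) * ?ev (basis_poly i) \<in> ?I"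
    using Idl_add by metis
  then have "mono_of 0 (inverse (of_int d)) * (mono_of 0 (of_int d) * ?ev (basis_poly i)) \<in> ?I"
    by (rule Idl_mult)
  moreover have "of_int d \<noteq> (0::'f)"
  proof -
    have "(4::'f) = 2 * 2" "(6::'f) = 2 * 3" by simp_all
    then have "(4::'f) \<noteq> 0" "(6::'f) \<noteq> 0"
      using two_nonzero three_nonzero by (simp_all only: mult_eq_0_iff simp_thms)
    then show ?thesis using d two_nonzero three_nonzero by auto
  qed
  ultimately show ?case unfolding mult.assoc[symmetric] mult_single by simp
qed

text \<open>The certificates place the basis in the ideal of the relations; reduction of the
  generators to zero gives the other inclusion.\<close>

lemma basis_ideal_eq: "W.basis_ideal = Idl\<^bsub>poly_ring\<^esub> relations"
proof
  have "p \<in> W.low D \<Longrightarrow> p \<in> Idl\<^bsub>poly_ring\<^esub> relations" for p D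
  proof (induction rule: W.low.induct)
    case (low_step p i t c)
    then show ?case
      using Idl_add[OF low_step.IH Idl_mult[OF basis_poly_in_Idl[OF low_step(2)], of "mono_of t c"]]
      by (simp only: elt_eq)
  qed (simp add: Idl_zero)
  then show "W.basis_ideal \<subseteq> Idl\<^bsub>poly_ring\<^esub> relations"
    unfolding W.basis_ideal_def by blast
  have "leval var_pos (gen_poly g) \<in> W.basis_ideal" if "g \<in> set gens" for g
    using reduces_low[of fuel 1000 "gen_poly g"] gens_reduce that
    unfolding W.basis_ideal_def list_all_iff by blast
  then have "relations \<subseteq> W.basis_ideal"
    unfolding relations_eq by blast
  then show "Idl\<^bsub>poly_ring\<^esub> relations \<subseteq> W.basis_ideal"
    by (intro Idl_least basis_ideal_zero W.basis_ideal_add W.basis_ideal_mult)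
qed

end

section \<open>Evaluation homomorphisms\<close>

definition mon_pow :: "('v \<Rightarrow> 'l::comm_ring_1) \<Rightarrow> ('v \<Rightarrow>\<^sub>0 nat) \<Rightarrow> 'l"
  where "mon_pow \<phi> m = (\<Prod>v\<in>Poly_Mapping.keys m. \<phi> v ^ Poly_Mapping.lookup m v)"

lemma mon_pow_superset:
  "finite A \<Longrightarrow> Poly_Mapping.keys m \<subseteq> A \<Longrightarrow> mon_pow \<phi> m = (\<Prod>v\<in>A. \<phi> v ^ Poly_Mapping.lookup m v)"
  unfolding mon_pow_def by (intro prod.mono_neutral_left) (auto simp: in_keys_iff)

lemma mon_pow_add: "mon_pow \<phi> (s + t) = mon_pow \<phi> s * mon_pow \<phi> t"
proof -
  let ?A = "Poly_Mapping.keys s \<union> Poly_Mapping.keys t"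
  have "mon_pow \<phi> (s + t) = (\<Prod>v\<in>?A. \<phi> v ^ Poly_Mapping.lookup (s + t) v)"
    by (intro mon_pow_superset) (use keys_add[of s t] in auto)
  also have "\<dots> = mon_pow \<phi> s * mon_pow \<phi> t"
    by (simp add: lookup_add power_add prod.distrib mon_pow_superset[of ?A])
  finally show ?thesis .
qed

lemma mon_pow_zero [simp]: "mon_pow \<phi> 0 = 1"
  by (simp add: mon_pow_def)

lemma mon_pow_single [simp]: "mon_pow \<phi> (Poly_Mapping.single v n) = \<phi> v ^ n"
  by (simp add: mon_pow_def)

text \<open>Coefficients travel along \<open>\<iota>\<close>, so that one notion covers both
  substitution of polynomials, with \<open>\<iota> = const_poly\<close>, and evaluation at a point
  over an extension field.\<close>

definition peval :: "('v \<Rightarrow> 'l::comm_ring_1) \<Rightarrow> ('f \<Rightarrow> 'l) \<Rightarrow> (('v \<Rightarrow>\<^sub>0 nat) \<Rightarrow>\<^sub>0 'f::comm_ring_1) \<Rightarrow> 'l"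
  where "peval \<phi> \<iota> p = (\<Sum>m\<in>Poly_Mapping.keys p. \<iota> (Poly_Mapping.lookup p m) * mon_pow \<phi> m)"

locale coeff_hom =
  fixes \<iota> :: "'f::comm_ring_1 \<Rightarrow> 'l::comm_ring_1"
  assumes hom_add: "\<iota> (a + b) = \<iota> a + \<iota> b" and hom_mult: "\<iota> (a * b) = \<iota> a * \<iota> b"
    and hom_one: "\<iota> 1 = 1"
begin

lemma hom_zero: "\<iota> 0 = 0"
  using hom_add[of 0 0] by simp

lemma peval_superset:
  "finite A \<Longrightarrow> Poly_Mapping.keys p \<subseteq> A \<Longrightarrow>
    peval \<phi> \<iota> p = (\<Sum>m\<in>A. \<iota> (Poly_Mapping.lookup p m) * mon_pow \<phi> m)"
  unfolding peval_def by (intro sum.mono_neutral_left) (auto simp: in_keys_iff hom_zero)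

lemma peval_add: "peval \<phi> \<iota> (p + q) = peval \<phi> \<iota> p + peval \<phi> \<iota> q"
proof -
  let ?A = "Poly_Mapping.keys p \<union> Poly_Mapping.keys q"
  have "peval \<phi> \<iota> (p + q) = (\<Sum>m\<in>?A. \<iota> (Poly_Mapping.lookup (p + q) m) * mon_pow \<phi> m)"
    by (intro peval_superset) (use keys_add[of p q] in auto)
  also have "\<dots> = peval \<phi> \<iota> p + peval \<phi> \<iota> q"
    by (simp add: lookup_add hom_add distrib_right sum.distrib peval_superset[of ?A])
  finally show ?thesis .
qed

lemma peval_zero [simp]: "peval \<phi> \<iota> 0 = 0"
  by (simp add: peval_def)

lemma peval_mono [simp]: "peval \<phi> \<iota> (mono_of m c) = \<iota> c * mon_pow \<phi> m"
  by (simp add: peval_def hom_zero)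

lemma peval_one [simp]: "peval \<phi> \<iota> 1 = 1"
  unfolding single_one[symmetric] by (simp only: peval_mono) (simp add: hom_one)

lemma peval_mult: "peval \<phi> \<iota> (p * q) = peval \<phi> \<iota> p * peval \<phi> \<iota> q"
proof -
  have m: "peval \<phi> \<iota> (mono_of s c * q) = peval \<phi> \<iota> (mono_of s c) * peval \<phi> \<iota> q" for s c
  proof -
    have "Poly_Mapping.keys q \<subseteq> UNIV" by simp
    then show ?thesis
      by (induction rule: additive_induct)
        (simp_all add: distrib_left distrib_right peval_add mult_single hom_mult mon_pow_add mult_ac)
  qed
  have "Poly_Mapping.keys p \<subseteq> UNIV" by simp
  then show ?thesis
    by (induction rule: additive_induct) (simp_all add: distrib_right peval_add m del: peval_mono)
qed

lemma peval_uminus: "peval \<phi> \<iota> (- p) = - peval \<phi> \<iota> p"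
  using peval_add[of \<phi> p "- p"] by (simp add: eq_neg_iff_add_eq_0 add.commute)

lemma peval_diff: "peval \<phi> \<iota> (p - q) = peval \<phi> \<iota> p - peval \<phi> \<iota> q"
  using peval_add[of \<phi> p "- q"] by (simp add: peval_uminus)

lemma peval_sum: "peval \<phi> \<iota> (sum f A) = (\<Sum>a\<in>A. peval \<phi> \<iota> (f a))"
  by (induction A rule: infinite_finite_induct) (simp_all add: peval_add)

lemma peval_Idl:
  assumes "p \<in> Idl\<^bsub>ring_of_type_algebra\<^esub> P" and "\<And>q. q \<in> P \<Longrightarrow> peval \<phi> \<iota> q = 0"
  shows "peval \<phi> \<iota> p = 0"
proof -
  have "Idl\<^bsub>ring_of_type_algebra\<^esub> P \<subseteq> {p. peval \<phi> \<iota> p = 0}"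
    by (rule Idl_least) (auto simp: peval_add peval_mult assms(2))
  then show ?thesis using assms(1) by blast
qed

end

definition const_poly :: "'f \<Rightarrow> ('v \<Rightarrow>\<^sub>0 nat) \<Rightarrow>\<^sub>0 'f::comm_ring_1"
  where "const_poly c = mono_of 0 c"

interpretation const_poly: coeff_hom "const_poly :: 'f::comm_ring_1 \<Rightarrow> ('v \<Rightarrow>\<^sub>0 nat) \<Rightarrow>\<^sub>0 'f"
  by unfold_locales (simp_all add: const_poly_def single_add mult_single)

lemma mat_subst_eq: "mat_subst \<sigma> p = peval (\<lambda>(k, i, j). \<sigma> k $ i $ j) const_poly p"
  unfolding mat_subst_def peval_def mon_pow_def const_poly_def
  by (intro sum.cong refl arg_cong2[where f = "(*)"] prod.cong) auto

lemma coord_nth: "coord k $ i $ j = mono_of (Poly_Mapping.single (k, i, j) 1) 1"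
  by (simp add: coord_def)

lemma mat_subst_coord [simp]: "mat_subst \<sigma> (coord k $ i $ j) = \<sigma> k $ i $ j"
  by (simp add: mat_subst_eq coord_nth const_poly.hom_one del: One_nat_def)

lemma (in coeff_hom) peval_coord: "peval \<phi> \<iota> (coord k $ i $ j) = \<phi> (k, i, j)"
  by (simp add: coord_nth hom_one del: One_nat_def)

lemma mat_subst_hom:
  "mat_subst \<sigma> (p + q) = mat_subst \<sigma> p + mat_subst \<sigma> q"
  "mat_subst \<sigma> (p * q) = mat_subst \<sigma> p * mat_subst \<sigma> q"
  "mat_subst \<sigma> (p - q) = mat_subst \<sigma> p - mat_subst \<sigma> q"
  "mat_subst \<sigma> 0 = 0"
  "mat_subst \<sigma> 1 = 1"
  by (simp_all add: mat_subst_eq const_poly.peval_add const_poly.peval_mult const_poly.peval_diff)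

unbundle no fps_syntax

subsection \<open>Straightening modulo the relations\<close>

text \<open>
  The letters \<open>LS\<close> to \<open>LA\<close> were found as the polynomials whose values at the generic point below
  are, up to sign, monomials in its parameters; see \<open>param_letter\<close>.
\<close>

datatype letter = Lf | Llam | Lx | Ly | Lz | LS | LU | LV | LD | LV' | LA

definition letter_S :: lpoly
  where "letter_S = ladd (lmult (lM 3 1) (lM 2 2)) (lscale (- 1) [] (lmult (lM 2 1) (lM 3 2)))"

definition letter_V' :: lpoly
  where "letter_V' = ladd (lmult (lM 3 1) (lN 2 1)) (lscale (- 1) [] (lmult (lN 3 1) (lM 2 1)))"

text \<open>Put \<open>P = f N - lam M\<close>, with \<open>f\<close> and \<open>lam\<close> the
  (3,1) entries of \<open>M\<close> and \<open>N\<close>; the (3,1) entry of \<open>P\<close> is 0.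
  Then \<open>LV'\<close> and \<open>LD\<close> are the entries (2,1) and (3,2) of \<open>P\<close>,
  and \<open>LA\<close> is the entry (3,1) of \<open>M P\<close>. Modulo tr(M), \<open>LS\<close> is
  minus the entry (3,1) of M^2, \<open>LU\<close> is the minor of the third rows of M and M^2 in
  columns 1 and 2, and \<open>LV\<close> is, up to sign, the minor of their first columns in rows 2
  and 3.\<close>

fun letter_poly :: "letter \<Rightarrow> lpoly" where
  "letter_poly Lf = lM 3 1"
| "letter_poly Llam = lN 3 1"
| "letter_poly Lx = lM 2 1"
| "letter_poly Ly = lM 3 2"
| "letter_poly Lz = lM 1 1"
| "letter_poly LS = letter_S"
| "letter_poly LU = ladd (lmult (lM 3 1) (ladd (lmult (lM 3 1) (lM 1 2))
    (lscale (- 1) [] (lmult (lM 3 2) (lM 1 1))))) (lmult letter_S (lM 3 2))"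
| "letter_poly LV = ladd (lmult (lM 3 1) (lmat_mult lM lM 2 1)) (lmult letter_S (lM 2 1))"
| "letter_poly LD = ladd (lmult (lM 3 1) (lN 3 2)) (lscale (- 1) [] (lmult (lN 3 1) (lM 3 2)))"
| "letter_poly LV' = letter_V'"
| "letter_poly LA = ladd (lmult (lM 3 1) (ladd (lmult (lM 3 1) (lN 1 1))
    (lscale (- 1) [] (lmult (lN 3 1) (lM 1 1))))) (lmult letter_V' (lM 3 2))"

declare letter_poly.simps [simp del]

text \<open>Of the fifteen products of two letters among \<open>LU\<close>, \<open>LV\<close>,
  \<open>LD\<close>, \<open>LV'\<close>, \<open>LA\<close>, nine are normal forms in the sense of
  \<open>tor\<close>; there is one binomial for each of the other six.\<close>

definition toric_relations :: "(letter \<Rightarrow> 'a::comm_ring_1) \<Rightarrow> 'a list"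
  where "toric_relations e = [e LU * e LV + e LS ^ 3, e LU * e LV' - e LS * e LA,
    e LD * e LV - e LS * e LA, e LA * e LU + e LS ^ 2 * e LD, e LA * e LV + e LS ^ 2 * e LV',
    e LA ^ 2 + e LS * e LD * e LV']"

lemma toric_reduce:
  "reduces fuel 1000 (ladd (lmult (letter_poly LU) (letter_poly LV))
    (lmult (letter_poly LS) (lmult (letter_poly LS) (letter_poly LS))))"
  "reduces fuel 1000 (ladd (lmult (letter_poly LU) (letter_poly LV'))
    (lscale (- 1) [] (lmult (letter_poly LS) (letter_poly LA))))"
  "reduces fuel 1000 (ladd (lmult (letter_poly LD) (letter_poly LV))
    (lscale (- 1) [] (lmult (letter_poly LS) (letter_poly LA))))"
  "reduces fuel 1000 (ladd (lmult (letter_poly LA) (letter_poly LU))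
    (lmult (letter_poly LS) (lmult (letter_poly LS) (letter_poly LD))))"
  "reduces fuel 1000 (ladd (lmult (letter_poly LA) (letter_poly LV))
    (lmult (letter_poly LS) (lmult (letter_poly LS) (letter_poly LV'))))"
  "reduces fuel 1000 (ladd (lmult (letter_poly LA) (letter_poly LA))
    (lmult (letter_poly LS) (lmult (letter_poly LD) (letter_poly LV'))))"
  by code_simp+

text \<open>Normal forms of words in \<open>LU\<close>, \<open>LV\<close>, \<open>LD\<close>, \<open>LV'\<close>, \<open>LA\<close>, up to powers of \<open>LS\<close>.\<close>

datatype tor = TU nat nat | TV nat nat | TD nat nat | TA nat nat

fun tor_val :: "(letter \<Rightarrow> 'a::comm_ring_1) \<Rightarrow> tor \<Rightarrow> 'a" where
  "tor_val e (TU j k) = e LU ^ Suc j * e LD ^ k"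
| "tor_val e (TV j k) = e LV ^ Suc j * e LV' ^ k"
| "tor_val e (TD j k) = e LD ^ j * e LV' ^ k"
| "tor_val e (TA j k) = e LA * (e LD ^ j * e LV' ^ k)"

lemma tor_step:
  fixes e :: "letter \<Rightarrow> 'a::comm_ring_1"
  assumes I: "\<And>r p. p \<in> I \<Longrightarrow> r * p \<in> I" "0 \<in> I" "\<And>p q. p \<in> I \<Longrightarrow> q \<in> I \<Longrightarrow> p + q \<in> I"
    and rel: "set (toric_relations e) \<subseteq> I"
    and L: "L \<in> {LU, LV, LD, LV', LA}"
  shows "\<exists>c\<in>{1, - 1}. \<exists>i t'. e L * tor_val e t - c * (e LS ^ i * tor_val e t') \<in> I"
proof -
  have step: "\<exists>c\<in>{1, - 1}. \<exists>i t'. p - c * (e LS ^ i * tor_val e t') \<in> I"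
    if "p - c * (e LS ^ i * tor_val e t') = r * q" "q \<in> set (toric_relations e)" "c \<in> {1, - 1}"
    for p c i t' r q
    using that rel I(1)[of q r] by (metis subsetD)
  have step0: "\<exists>c\<in>{1, - 1}. \<exists>i t'. p - c * (e LS ^ i * tor_val e t') \<in> I"
    if "p = tor_val e t'" for p t'
    using that I(2) by (intro bexI[of _ 1] exI[of _ 0] exI[of _ t']) auto
  have step2: "\<exists>c\<in>{1, - 1}. \<exists>i t'. p - c * (e LS ^ i * tor_val e t') \<in> I"
    if "p - c * (e LS ^ i * tor_val e t') = r * q + r' * q'" "q \<in> set (toric_relations e)"
      "q' \<in> set (toric_relations e)" "c \<in> {1, - 1}"
    for p c i t' r q r' q'
    using that rel I(1)[of q r] I(1)[of q' r'] I(3)[of "r * q" "r' * q'"] by (metis subsetD)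
  note defs = toric_relations_def algebra_simps power2_eq_square power3_eq_cube
  let ?UV = "e LU * e LV + e LS ^ 3" and ?UW = "e LU * e LV' - e LS * e LA"
    and ?DV = "e LD * e LV - e LS * e LA" and ?AU = "e LA * e LU + e LS ^ 2 * e LD"
    and ?AV = "e LA * e LV + e LS ^ 2 * e LV'" and ?AA = "e LA ^ 2 + e LS * e LD * e LV'"
  consider "L = LU" | "L = LV" | "L = LD" | "L = LV'" | "L = LA" using L by blast
  then show ?thesis
  proof cases
    case 1
    show ?thesis
    proof (cases t)
      case (TU j k)
      then show ?thesis by (intro step0[of _ "TU (Suc j) k"]) (simp add: 1 defs)
    next
      case (TV j k)
      show ?thesis
      proof (cases j)
        case 0
        show ?thesis by (rule step[of _ "- 1" 3 "TD 0 k" "e LV' ^ k" ?UV]) (simp_all add: 1 0 TV defs)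
      next
        case (Suc i)
        show ?thesis
          by (rule step[of _ "- 1" 3 "TV i k" "e LV ^ Suc i * e LV' ^ k" ?UV]) (simp_all add: 1 Suc TV defs)
      qed
    next
      case (TD j k)
      show ?thesis
      proof (cases k)
        case 0
        show ?thesis by (intro step0[of _ "TU 0 j"]) (simp add: 1 0 TD defs)
      next
        case (Suc i)
        show ?thesis
          by (rule step[of _ 1 1 "TA j i" "e LD ^ j * e LV' ^ i" ?UW]) (simp_all add: 1 Suc TD defs)
      qed
    next
      case (TA j k)
      show ?thesis
        by (rule step[of _ "- 1" 2 "TD (Suc j) k" "e LD ^ j * e LV' ^ k" ?AU]) (simp_all add: 1 TA defs)
    qed
  next
    case 2
    show ?thesis
    proof (cases t)
      case (TV j k)
      then show ?thesis by (intro step0[of _ "TV (Suc j) k"]) (simp add: 2 defs)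
    next
      case (TU j k)
      show ?thesis
      proof (cases j)
        case 0
        show ?thesis by (rule step[of _ "- 1" 3 "TD k 0" "e LD ^ k" ?UV]) (simp_all add: 2 0 TU defs)
      next
        case (Suc i)
        show ?thesis
          by (rule step[of _ "- 1" 3 "TU i k" "e LU ^ Suc i * e LD ^ k" ?UV]) (simp_all add: 2 Suc TU defs)
      qed
    next
      case (TD j k)
      show ?thesis
      proof (cases j)
        case 0
        show ?thesis by (intro step0[of _ "TV 0 k"]) (simp add: 2 0 TD defs)
      next
        case (Suc i)
        show ?thesis
          by (rule step[of _ 1 1 "TA i k" "e LD ^ i * e LV' ^ k" ?DV]) (simp_all add: 2 Suc TD defs)
      qed
    next
      case (TA j k)
      show ?thesis
        by (rule step[of _ "- 1" 2 "TD j (Suc k)" "e LD ^ j * e LV' ^ k" ?AV]) (simp_all add: 2 TA defs)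
    qed
  next
    case 3
    show ?thesis
    proof (cases t)
      case (TU j k)
      then show ?thesis by (intro step0[of _ "TU j (Suc k)"]) (simp add: 3 defs)
    next
      case (TD j k)
      then show ?thesis by (intro step0[of _ "TD (Suc j) k"]) (simp add: 3 defs)
    next
      case (TA j k)
      then show ?thesis by (intro step0[of _ "TA (Suc j) k"]) (simp add: 3 defs)
    next
      case (TV j k)
      consider "j = 0" | "j = 1" | i where "j = Suc (Suc i)" by (metis One_nat_def not0_implies_Suc)
      then show ?thesis
      proof cases
        case 1
        show ?thesis
          by (rule step[of _ 1 1 "TA 0 k" "e LV' ^ k" ?DV]) (simp_all add: 3 1 TV defs)
      next
        \<comment> \<open>Here \<open>LD * LV\<close> turns into \<open>LS * LA\<close>, and then
          \<open>LA * LV\<close> into \<open>- LS^2 * LV'\<close>; this explains the sign and the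
          exponent 3 of \<open>LS\<close>.\<close>
        case 2
        show ?thesis
          by (rule step2[of _ "- 1" 3 "TD 0 (Suc k)" "e LV * e LV' ^ k" ?DV "e LS * e LV' ^ k" ?AV])
            (simp_all add: 3 2 TV defs)
      next
        case (3 i)
        show ?thesis
          by (rule step2[of _ "- 1" 3 "TV i (Suc k)" "e LV ^ Suc (Suc i) * e LV' ^ k" ?DV
                "e LS * e LV ^ Suc i * e LV' ^ k" ?AV])
            (simp_all add: \<open>L = LD\<close> 3 TV defs)
      qed
    qed
  next
    case 4
    show ?thesis
    proof (cases t)
      case (TV j k)
      then show ?thesis by (intro step0[of _ "TV j (Suc k)"]) (simp add: 4 defs)
    next
      case (TD j k)
      then show ?thesis by (intro step0[of _ "TD j (Suc k)"]) (simp add: 4 defs)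
    next
      case (TA j k)
      then show ?thesis by (intro step0[of _ "TA j (Suc k)"]) (simp add: 4 defs)
    next
      case (TU j k)
      consider "j = 0" | "j = 1" | i where "j = Suc (Suc i)" by (metis One_nat_def not0_implies_Suc)
      then show ?thesis
      proof cases
        case 1
        show ?thesis
          by (rule step[of _ 1 1 "TA k 0" "e LD ^ k" ?UW]) (simp_all add: 4 1 TU defs)
      next
        case 2
        show ?thesis
          by (rule step2[of _ "- 1" 3 "TD (Suc k) 0" "e LU * e LD ^ k" ?UW "e LS * e LD ^ k" ?AU])
            (simp_all add: 4 2 TU defs)
      next
        case (3 i)
        show ?thesis
          by (rule step2[of _ "- 1" 3 "TU i (Suc k)" "e LU ^ Suc (Suc i) * e LD ^ k" ?UW
                "e LS * e LU ^ Suc i * e LD ^ k" ?AU])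
            (simp_all add: 4 3 TU defs)
      qed
    qed
  next
    case 5
    show ?thesis
    proof (cases t)
      case (TU j k)
      show ?thesis
      proof (cases j)
        case 0
        show ?thesis by (rule step[of _ "- 1" 2 "TD (Suc k) 0" "e LD ^ k" ?AU]) (simp_all add: 5 0 TU defs)
      next
        case (Suc i)
        show ?thesis
          by (rule step[of _ "- 1" 2 "TU i (Suc k)" "e LU ^ Suc i * e LD ^ k" ?AU])
            (simp_all add: 5 Suc TU defs)
      qed
    next
      case (TV j k)
      show ?thesis
      proof (cases j)
        case 0
        show ?thesis by (rule step[of _ "- 1" 2 "TD 0 (Suc k)" "e LV' ^ k" ?AV]) (simp_all add: 5 0 TV defs)
      next
        case (Suc i)
        show ?thesis
          by (rule step[of _ "- 1" 2 "TV i (Suc k)" "e LV ^ Suc i * e LV' ^ k" ?AV])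
            (simp_all add: 5 Suc TV defs)
      qed
    next
      case (TD j k)
      then show ?thesis by (intro step0[of _ "TA j k"]) (simp add: 5 defs)
    next
      case (TA j k)
      show ?thesis
        by (rule step[of _ "- 1" 1 "TD (Suc j) (Suc k)" "e LD ^ j * e LV' ^ k" ?AA])
          (simp_all add: 5 TA defs)
    qed
  qed
qed

type_synonym word = "(nat \<times> nat \<times> nat \<times> nat \<times> nat \<times> nat) \<times> tor"

fun word_val :: "(letter \<Rightarrow> 'a::comm_ring_1) \<Rightarrow> word \<Rightarrow> 'a" where
  "word_val e ((a, b, c, d, k, i), t) =
    e Lf ^ a * (e Llam ^ b * (e Lx ^ c * (e Ly ^ d * (e Lz ^ k * (e LS ^ i * tor_val e t)))))"

section \<open>The span of the words modulo the relations\<close>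

context six_invertible
begin

abbreviation le :: "letter \<Rightarrow> (gg_mat, 'f) mat_poly"
  where "le L \<equiv> leval var_pos (letter_poly L)"

abbreviation rel_ideal :: "(gg_mat, 'f) mat_poly set"
  where "rel_ideal \<equiv> Idl\<^bsub>poly_ring\<^esub> relations"

lemma toric_relations_in_ideal: "set (toric_relations le) \<subseteq> rel_ideal"
proof -
  have "leval var_pos p \<in> rel_ideal" if "reduces fuel 1000 p" for p
    using reduces_low[OF that] unfolding basis_ideal_eq[symmetric] W.basis_ideal_def by blast
  from toric_reduce[THEN this] show ?thesis
    by (simp add: toric_relations_def leval_add leval_mult leval_scale single_uminus
        power2_eq_square power3_eq_cube mult.assoc)
qed

definition word_sum :: "(word \<Rightarrow>\<^sub>0 'f) \<Rightarrow> (gg_mat, 'f) mat_poly"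
  where "word_sum h = (\<Sum>w\<in>Poly_Mapping.keys h. const_poly (Poly_Mapping.lookup h w) * word_val le w)"

lemma word_sum_superset:
  "finite A \<Longrightarrow> Poly_Mapping.keys h \<subseteq> A \<Longrightarrow>
    word_sum h = (\<Sum>w\<in>A. const_poly (Poly_Mapping.lookup h w) * word_val le w)"
  unfolding word_sum_def by (intro sum.mono_neutral_left) (auto simp: in_keys_iff const_poly_def)

lemma word_sum_add: "word_sum (g + h) = word_sum g + word_sum h"
proof -
  let ?A = "Poly_Mapping.keys g \<union> Poly_Mapping.keys h"
  have "word_sum (g + h) = (\<Sum>w\<in>?A. const_poly (Poly_Mapping.lookup (g + h) w) * word_val le w)"
    by (intro word_sum_superset) (use keys_add[of g h] in auto)
  also have "\<dots> = word_sum g + word_sum h"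
    by (simp add: lookup_add const_poly_def single_add distrib_right sum.distrib word_sum_superset[of ?A])
  finally show ?thesis .
qed

lemma word_sum_single: "word_sum (Poly_Mapping.single w c) = const_poly c * word_val le w"
  by (simp add: word_sum_def const_poly_def)

definition straight :: "(gg_mat, 'f) mat_poly set"
  where "straight = {p. \<exists>h. p - word_sum h \<in> rel_ideal}"

lemma straight_add: "p \<in> straight \<Longrightarrow> q \<in> straight \<Longrightarrow> p + q \<in> straight"
proof -
  assume "p \<in> straight" "q \<in> straight"
  then obtain g h where "p - word_sum g \<in> rel_ideal" "q - word_sum h \<in> rel_ideal"
    unfolding straight_def by blast
  from Idl_add[OF this] have "(p + q) - word_sum (g + h) \<in> rel_ideal"
    by (simp add: word_sum_add algebra_simps)
  then show ?thesis unfolding straight_def by blast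
qed

lemma straight_cong: "p - q \<in> rel_ideal \<Longrightarrow> q \<in> straight \<Longrightarrow> p \<in> straight"
proof -
  assume pq: "p - q \<in> rel_ideal" and "q \<in> straight"
  then obtain h where "q - word_sum h \<in> rel_ideal" unfolding straight_def by blast
  from Idl_add[OF pq this] show ?thesis unfolding straight_def by auto
qed

lemma straight_word: "const_poly c * word_val le w \<in> straight"
  unfolding straight_def
  by (intro CollectI exI[of _ "Poly_Mapping.single w c"]) (simp add: word_sum_single Idl_zero)

lemma straight_zero: "0 \<in> straight"
  unfolding straight_def by (intro CollectI exI[of _ 0]) (simp add: word_sum_def Idl_zero)

lemma straight_ideal: "p \<in> rel_ideal \<Longrightarrow> p \<in> straight"
  using straight_cong[of p 0] straight_zero by simp

text \<open>The set \<open>straight\<close> is a linear span and not visibly closed under products.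
  Its multipliers form a ring by construction, so only the letters have to be checked.\<close>

definition multipliers :: "(gg_mat, 'f) mat_poly set"
  where "multipliers = {r. \<forall>p\<in>straight. r * p \<in> straight}"

lemma multipliersI:
  assumes "\<And>c w. r * (const_poly c * word_val le w) \<in> straight"
  shows "r \<in> multipliers"
  unfolding multipliers_def
proof (intro CollectI ballI)
  fix p assume "p \<in> straight"
  then obtain h where h: "p - word_sum h \<in> rel_ideal" unfolding straight_def by blast
  have "Poly_Mapping.keys h \<subseteq> UNIV" by simp
  then have "r * word_sum h \<in> straight"
    by (induction rule: additive_induct)
      (simp_all add: word_sum_add distrib_left straight_add word_sum_single assms word_sum_def[of 0] straight_zero)
  moreover have "r * p - r * word_sum h \<in> rel_ideal"
    using Idl_mult[OF h, of r] by (simp add: right_diff_distrib)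
  ultimately show "r * p \<in> straight" using straight_cong by blast
qed

lemma multipliers_add: "r \<in> multipliers \<Longrightarrow> s \<in> multipliers \<Longrightarrow> r + s \<in> multipliers"
  by (simp add: multipliers_def distrib_right straight_add)

lemma multipliers_mult: "r \<in> multipliers \<Longrightarrow> s \<in> multipliers \<Longrightarrow> r * s \<in> multipliers"
  by (simp add: multipliers_def mult.assoc)

lemma multipliers_const: "const_poly c \<in> multipliers"
  by (rule multipliersI)
    (simp add: mult.assoc[symmetric] const_poly.hom_mult[symmetric] straight_word)

lemma multipliers_ideal: "r \<in> rel_ideal \<Longrightarrow> r \<in> multipliers"
  using Idl_mult[of r relations] by (auto simp: multipliers_def mult.commute[of r] intro: straight_ideal)

text \<open>Six letters merely raise an exponent of the word. The other five act on the normal form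
  through \<open>tor_step\<close>, whose sign goes into the coefficient and whose power of
  \<open>LS\<close> into the exponent \<open>i\<close>.\<close>

lemma multipliers_letter: "le L \<in> multipliers"
proof (rule multipliersI)
  fix c and w :: word
  obtain n t where nt: "w = (n, t)" by (cases w)
  obtain a b x y z i where "n = (a, b, x, y, z, i)" by (cases n rule: prod_cases6)
  with nt have w: "w = ((a, b, x, y, z, i), t)" by simp
  have simple: "le L * (const_poly c * word_val le w) \<in> straight" if "le L * word_val le w = word_val le w'" for w'
    using straight_word[of c w'] that by (simp add: mult.left_commute[of "le L"])
  show "le L * (const_poly c * word_val le w) \<in> straight"
  proof (cases "L \<in> {LU, LV, LD, LV', LA}")
    case True
    from tor_step[OF Idl_mult Idl_zero Idl_add toric_relations_in_ideal True, of t]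
    obtain s k t' where s: "s \<in> {1, - 1}"
      and I: "le L * tor_val le t - s * (le LS ^ k * tor_val le t') \<in> rel_ideal"
      by blast
    let ?m = "le Lf ^ a * (le Llam ^ b * (le Lx ^ x * (le Ly ^ y * (le Lz ^ z * le LS ^ i))))"
    let ?w' = "((a, b, x, y, z, i + k), t')"
    obtain c' where c': "const_poly c' = const_poly c * s"
    proof -
      have "const_poly c * s = const_poly c \<or> const_poly c * s = const_poly (- c)"
        using s by (auto simp: const_poly_def single_uminus)
      then show ?thesis using that by metis
    qed
    have "const_poly c * ?m * (le L * tor_val le t - s * (le LS ^ k * tor_val le t')) \<in> rel_ideal"
      by (rule Idl_mult[OF I])
    also have "const_poly c * ?m * (le L * tor_val le t - s * (le LS ^ k * tor_val le t'))
        = le L * (const_poly c * word_val le w) - const_poly c' * word_val le ?w'"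
      unfolding w c' word_val.simps power_add by (simp only: right_diff_distrib mult_ac)
    finally show ?thesis using straight_cong straight_word by blast
  next
    case False
    then consider "L = Lf" | "L = Llam" | "L = Lx" | "L = Ly" | "L = Lz" | "L = LS"
      by (cases L) auto
    then show ?thesis
    proof cases
      case 1
      then show ?thesis
        using simple[of "((Suc a, b, x, y, z, i), t)"] unfolding w word_val.simps power_Suc
        by (simp only: mult_ac)
    next
      case 2
      then show ?thesis
        using simple[of "((a, Suc b, x, y, z, i), t)"] unfolding w word_val.simps power_Suc
        by (simp only: mult_ac)
    next
      case 3
      then show ?thesis
        using simple[of "((a, b, Suc x, y, z, i), t)"] unfolding w word_val.simps power_Suc
        by (simp only: mult_ac)
    next
      case 4
      then show ?thesis
        using simple[of "((a, b, x, Suc y, z, i), t)"] unfolding w word_val.simps power_Suc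
        by (simp only: mult_ac)
    next
      case 5
      then show ?thesis
        using simple[of "((a, b, x, y, Suc z, i), t)"] unfolding w word_val.simps power_Suc
        by (simp only: mult_ac)
    next
      case 6
      then show ?thesis
        using simple[of "((a, b, x, y, z, Suc i), t)"] unfolding w word_val.simps power_Suc
        by (simp only: mult_ac)
    qed
  qed
qed

end

context six_invertible
begin

lemma multipliers_power: "r \<in> multipliers \<Longrightarrow> r ^ n \<in> multipliers"
proof (induction n)
  case 0
  then show ?case using multipliers_const[of 1] by (simp add: const_poly.hom_one)
qed (simp add: multipliers_mult)

text \<open>The multipliers after localisation at \<open>M 3 1\<close>: a ring that is also closed
  under cancelling this coordinate. Hence a coordinate is reached as soon as some power of
  \<open>M 3 1\<close> times it is expressed by elements already reached.\<close>

definition reach :: "(gg_mat, 'f) mat_poly set"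
  where "reach = {r. \<exists>k. le Lf ^ k * r \<in> multipliers}"

lemma reach_multipliers: "r \<in> multipliers \<Longrightarrow> r \<in> reach"
  unfolding reach_def by (intro CollectI exI[of _ 0]) simp

lemma reach_add: "r \<in> reach \<Longrightarrow> s \<in> reach \<Longrightarrow> r + s \<in> reach"
proof -
  assume "r \<in> reach" "s \<in> reach"
  then obtain k l where k: "le Lf ^ k * r \<in> multipliers" and l: "le Lf ^ l * s \<in> multipliers"
    unfolding reach_def by blast
  have "le Lf ^ l * (le Lf ^ k * r) + le Lf ^ k * (le Lf ^ l * s) \<in> multipliers"
    by (intro multipliers_add multipliers_mult multipliers_power multipliers_letter k l)
  also have "le Lf ^ l * (le Lf ^ k * r) + le Lf ^ k * (le Lf ^ l * s) = le Lf ^ (k + l) * (r + s)"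
    by (simp only: power_add distrib_left distrib_right mult_ac)
  finally have "le Lf ^ (k + l) * (r + s) \<in> multipliers" .
  then show ?thesis unfolding reach_def by blast
qed

lemma reach_mult: "r \<in> reach \<Longrightarrow> s \<in> reach \<Longrightarrow> r * s \<in> reach"
proof -
  assume "r \<in> reach" "s \<in> reach"
  then obtain k l where k: "le Lf ^ k * r \<in> multipliers" and l: "le Lf ^ l * s \<in> multipliers"
    unfolding reach_def by blast
  from multipliers_mult[OF this] have "le Lf ^ (k + l) * (r * s) \<in> multipliers"
    by (simp only: power_add mult_ac)
  then show ?thesis unfolding reach_def by blast
qed

lemma reach_const: "const_poly c \<in> reach"
  by (intro reach_multipliers multipliers_const)

lemma reach_uminus: "r \<in> reach \<Longrightarrow> - r \<in> reach"
  using reach_mult[OF reach_const[of "- 1"], of r] by (simp add: const_poly_def single_uminus)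

lemma reach_diff: "r \<in> reach \<Longrightarrow> s \<in> reach \<Longrightarrow> r - s \<in> reach"
  using reach_add[of r "- s"] reach_uminus[of s] by simp

lemma reach_cancel: "le Lf * r \<in> reach \<Longrightarrow> r \<in> reach"
proof -
  assume "le Lf * r \<in> reach"
  then obtain k where "le Lf ^ k * (le Lf * r) \<in> multipliers"
    unfolding reach_def by blast
  then have "le Lf ^ Suc k * r \<in> multipliers" by (simp only: power_Suc mult_ac)
  then show ?thesis unfolding reach_def by blast
qed

lemma reach_half: "r + r \<in> reach \<Longrightarrow> r \<in> reach"
proof -
  assume "r + r \<in> reach"
  with reach_const[of "1 / 2"] have "const_poly (1 / 2) * (r + r) \<in> reach"
    by (rule reach_mult)
  also have "const_poly (1 / 2) * (r + r) = const_poly (1 / 2 + 1 / 2) * r"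
    by (simp only: const_poly.hom_add distrib_left distrib_right)
  also have "(1 / 2 + 1 / 2 :: 'f) = 1"
    unfolding add_divide_distrib[symmetric] using two_nonzero by simp
  finally show ?thesis by (simp add: const_poly.hom_one)
qed

lemma le_coord:
  "le Lf = coord gg_M $ 3 $ 1" "le Llam = coord gg_N $ 3 $ 1" "le Lx = coord gg_M $ 2 $ 1"
  "le Ly = coord gg_M $ 3 $ 2" "le Lz = coord gg_M $ 1 $ 1"
  by (simp_all add: letter_poly.simps representsD[OF represents_coord(1)] representsD[OF represents_coord(2)])

lemma le_derived:
  "le LS = le Lf * coord gg_M $ 2 $ 2 - le Lx * le Ly"
  "le LU = le Lf * (le Lf * coord gg_M $ 1 $ 2 - le Ly * le Lz) + le LS * le Ly"
  "le LV = le Lf * (le Lx * le Lz + (coord gg_M $ 2 $ 2 * le Lx + coord gg_M $ 2 $ 3 * le Lf))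
    + le LS * le Lx"
  "le LD = le Lf * coord gg_N $ 3 $ 2 - le Llam * le Ly"
  "le LV' = le Lf * coord gg_N $ 2 $ 1 - le Llam * le Lx"
  "le LA = le Lf * (le Lf * coord gg_N $ 1 $ 1 - le Llam * le Lz) + le LV' * le Ly"
  by (simp_all add: letter_poly.simps leval_add leval_mult leval_scale single_uminus lmat_mult_def
      letter_S_def letter_V'_def representsD[OF represents_coord(1)] representsD[OF represents_coord(2)])

lemma relations_in_ideal:
  fixes M N :: "(gg_mat, 'f) mat_poly ^ 3 ^ 3"
  defines "M \<equiv> coord gg_M" and "N \<equiv> coord gg_N"
  shows "M $ 1 $ 1 + M $ 2 $ 2 + M $ 3 $ 3 \<in> rel_ideal"
    and "N $ 1 $ 1 + N $ 2 $ 2 + N $ 3 $ 3 \<in> rel_ideal"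
    and "(M ** M) $ 1 $ 1 + (M ** M) $ 2 $ 2 + (M ** M) $ 3 $ 3 \<in> rel_ideal"
    and "(M ** N) $ i $ j - (N ** M) $ i $ j \<in> rel_ideal"
proof -
  have "trace M \<in> relations" "trace N \<in> relations" "trace (M ** M) \<in> relations"
    "(M ** N - N ** M) $ i $ j \<in> relations"
    by (auto simp: relations_def Let_def M_def N_def entries_def)
  then show "M $ 1 $ 1 + M $ 2 $ 2 + M $ 3 $ 3 \<in> rel_ideal"
    "N $ 1 $ 1 + N $ 2 $ 2 + N $ 3 $ 3 \<in> rel_ideal"
    "(M ** M) $ 1 $ 1 + (M ** M) $ 2 $ 2 + (M ** M) $ 3 $ 3 \<in> rel_ideal"
    "(M ** N) $ i $ j - (N ** M) $ i $ j \<in> rel_ideal"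
    using Idl_self[of "relations :: (gg_mat, 'f) mat_poly set"]
    by (auto simp: trace_def sum_3)
qed

text \<open>Five coordinates are letters. Each of the other thirteen occurs linearly, in a derived
  letter or in a relation, with a coefficient that is a power of \<open>M 3 1\<close> (twice
  \<open>M 3 1\<close> for \<open>M 1 3\<close>, and 1 where a trace is used). The order matters:
  each equation involves only coordinates settled before.\<close>

lemma reach_coord: "coord gg_M $ i $ j \<in> reach" "coord gg_N $ i $ j \<in> reach"
proof -
  let ?m = "\<lambda>i j. (coord gg_M :: (gg_mat, 'f) mat_poly ^ 3 ^ 3) $ i $ j"
  let ?n = "\<lambda>i j. (coord gg_N :: (gg_mat, 'f) mat_poly ^ 3 ^ 3) $ i $ j"
  have L: "le L \<in> reach" for L by (intro reach_multipliers multipliers_letter)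
  have I: "p \<in> reach" if "p \<in> rel_ideal" for p
    by (intro reach_multipliers multipliers_ideal that)
  note ring = reach_add reach_mult reach_diff L
  note coords = L[of Lf, unfolded le_coord] L[of Llam, unfolded le_coord] L[of Lx, unfolded le_coord]
    L[of Ly, unfolded le_coord] L[of Lz, unfolded le_coord]
  note defs = matrix_matrix_mult_def sum_3
  have m22: "?m 2 2 \<in> reach"
  proof (rule reach_cancel)
    have "le Lf * ?m 2 2 = le LS + le Lx * le Ly" by (simp add: le_derived)
    then show "le Lf * ?m 2 2 \<in> reach" by (simp only: ring)
  qed
  have m33: "?m 3 3 \<in> reach"
  proof -
    have "?m 3 3 = (?m 1 1 + ?m 2 2 + ?m 3 3) - ?m 1 1 - ?m 2 2" by simp
    also have "\<dots> \<in> reach"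
      by (simp only: reach_diff I[OF relations_in_ideal(1)] coords m22)
    finally show ?thesis .
  qed
  have m12: "?m 1 2 \<in> reach"
  proof (rule reach_cancel, rule reach_cancel)
    have "le Lf * (le Lf * ?m 1 2) = le LU - le LS * le Ly + le Lf * (le Ly * le Lz)"
      by (simp add: le_derived(2) algebra_simps)
    then show "le Lf * (le Lf * ?m 1 2) \<in> reach" by (simp only: ring)
  qed
  have m23: "?m 2 3 \<in> reach"
  proof (rule reach_cancel, rule reach_cancel)
    have "le Lf * (le Lf * ?m 2 3) = le LV - le LS * le Lx - le Lf * (le Lx * le Lz + ?m 2 2 * le Lx)"
      by (simp add: le_derived(3) algebra_simps)
    then show "le Lf * (le Lf * ?m 2 3) \<in> reach" by (simp only: ring m22)
  qed
  \<comment> \<open>The trace of M^2 contains \<open>M 3 1 * M 1 3\<close> twice, which is why a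
    factor 2 has to be cancelled as well.\<close>
  have m13: "?m 1 3 \<in> reach"
  proof (rule reach_cancel, rule reach_half)
    have "le Lf * ?m 1 3 + le Lf * ?m 1 3
      = ((coord gg_M ** coord gg_M) $ 1 $ 1 + (coord gg_M ** coord gg_M) $ 2 $ 2
        + (coord gg_M ** coord gg_M) $ 3 $ 3)
        - (?m 1 1 * ?m 1 1 + ?m 2 2 * ?m 2 2 + ?m 3 3 * ?m 3 3
          + (?m 1 2 * ?m 2 1 + ?m 1 2 * ?m 2 1) + (?m 2 3 * ?m 3 2 + ?m 2 3 * ?m 3 2))"
      by (simp add: le_coord defs algebra_simps)
    then show "le Lf * ?m 1 3 + le Lf * ?m 1 3 \<in> reach"
      by (simp only: reach_diff[OF I[OF relations_in_ideal(3)]] ring coords m12 m22 m23 m33)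
  qed
  have n21: "?n 2 1 \<in> reach"
  proof (rule reach_cancel)
    have "le Lf * ?n 2 1 = le LV' + le Llam * le Lx" by (simp add: le_derived(5))
    then show "le Lf * ?n 2 1 \<in> reach" by (simp only: ring)
  qed
  have n32: "?n 3 2 \<in> reach"
  proof (rule reach_cancel)
    have "le Lf * ?n 3 2 = le LD + le Llam * le Ly" by (simp add: le_derived(4))
    then show "le Lf * ?n 3 2 \<in> reach" by (simp only: ring)
  qed
  have n11: "?n 1 1 \<in> reach"
  proof (rule reach_cancel, rule reach_cancel)
    have "le Lf * (le Lf * ?n 1 1) = le LA - le LV' * le Ly + le Lf * (le Llam * le Lz)"
      by (simp add: le_derived(6) algebra_simps)
    then show "le Lf * (le Lf * ?n 1 1) \<in> reach" by (simp only: ring)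
  qed
  \<comment> \<open>The entries (3,1), (3,2), (2,1), (1,1) of the commutator contain
    \<open>M 3 1\<close> times \<open>N 3 3\<close>, \<open>N 1 2\<close>, \<open>N 2 3\<close>,
    \<open>N 1 3\<close> respectively.\<close>
  have comm: "(coord gg_M ** coord gg_N) $ i $ j - (coord gg_N ** coord gg_M) $ i $ j \<in> reach" for i j
    by (intro I relations_in_ideal(4))
  have n33: "?n 3 3 \<in> reach"
  proof (rule reach_cancel)
    have "le Lf * ?n 3 3 = ?m 3 1 * ?n 1 1 + ?m 3 2 * ?n 2 1 + ?m 3 3 * ?n 3 1
        - ?n 3 1 * ?m 1 1 - ?n 3 2 * ?m 2 1
        - ((coord gg_M ** coord gg_N) $ 3 $ 1 - (coord gg_N ** coord gg_M) $ 3 $ 1)"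
      by (simp add: le_coord defs algebra_simps)
    then show "le Lf * ?n 3 3 \<in> reach"
      by (simp only: ring coords comm m33 n11 n21 n32)
  qed
  have n22: "?n 2 2 \<in> reach"
  proof -
    have "?n 2 2 = (?n 1 1 + ?n 2 2 + ?n 3 3) - ?n 1 1 - ?n 3 3" by simp
    also have "\<dots> \<in> reach"
      by (simp only: reach_diff I[OF relations_in_ideal(2)] n11 n33)
    finally show ?thesis .
  qed
  have n12: "?n 1 2 \<in> reach"
  proof (rule reach_cancel)
    have "le Lf * ?n 1 2 = ((coord gg_M ** coord gg_N) $ 3 $ 2 - (coord gg_N ** coord gg_M) $ 3 $ 2)
        - ?m 3 2 * ?n 2 2 - ?m 3 3 * ?n 3 2
        + (?n 3 1 * ?m 1 2 + ?n 3 2 * ?m 2 2 + ?n 3 3 * ?m 3 2)"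
      by (simp add: le_coord defs algebra_simps)
    then show "le Lf * ?n 1 2 \<in> reach"
      by (simp only: ring coords comm m33 m22 m12 n22 n33 n32)
  qed
  have n23: "?n 2 3 \<in> reach"
  proof (rule reach_cancel)
    have "le Lf * ?n 2 3 = ?m 2 1 * ?n 1 1 + ?m 2 2 * ?n 2 1 + ?m 2 3 * ?n 3 1
        - ?n 2 1 * ?m 1 1 - ?n 2 2 * ?m 2 1
        - ((coord gg_M ** coord gg_N) $ 2 $ 1 - (coord gg_N ** coord gg_M) $ 2 $ 1)"
      by (simp add: le_coord defs algebra_simps)
    then show "le Lf * ?n 2 3 \<in> reach"
      by (simp only: ring coords comm m23 m22 n11 n21 n22)
  qed
  have n13: "?n 1 3 \<in> reach"
  proof (rule reach_cancel)
    have "le Lf * ?n 1 3 = ?m 1 2 * ?n 2 1 + ?m 1 3 * ?n 3 1 - ?n 1 2 * ?m 2 1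
        - ((coord gg_M ** coord gg_N) $ 1 $ 1 - (coord gg_N ** coord gg_M) $ 1 $ 1)"
      by (simp add: le_coord defs algebra_simps)
    then show "le Lf * ?n 1 3 \<in> reach"
      by (simp only: ring coords comm m12 m13 n12 n21)
  qed
  show "coord gg_M $ i $ j \<in> reach"
    using exhaust_3[of i] exhaust_3[of j] coords m12 m13 m22 m23 m33 by auto
  show "coord gg_N $ i $ j \<in> reach"
    using exhaust_3[of i] exhaust_3[of j] coords n11 n12 n13 n21 n22 n23 n32 n33 by auto
qed

lemma mono_of_mon_pow: "mon_pow (\<lambda>v. mono_of (Poly_Mapping.single v 1) (1::'f)) m = mono_of m 1"
proof -
  have p: "mono_of (Poly_Mapping.single v 1) (1::'f) ^ n = mono_of (Poly_Mapping.single v n) 1" for v :: 'v and n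
    by (induction n) (simp_all add: mult_single single_add[symmetric])
  have q: "(\<Prod>v\<in>A. mono_of (h v) (1::'f)) = mono_of (\<Sum>v\<in>A. h v) 1" for A and h :: "'v \<Rightarrow> 'v \<Rightarrow>\<^sub>0 nat"
    by (induction A rule: infinite_finite_induct) (simp_all add: mult_single)
  have "(\<Sum>v\<in>Poly_Mapping.keys m. Poly_Mapping.single v (Poly_Mapping.lookup m v)) = m"
    by (rule poly_mapping_eqI)
      (simp add: lookup_sum lookup_single when_def sum.delta in_keys_iff)
  then show ?thesis unfolding mon_pow_def p q by simp
qed

lemma reach_all: "p \<in> reach"
proof -
  have mon: "mono_of m (1::'f) \<in> reach" for m
  proof -
    have "(\<Prod>v\<in>A. mono_of (Poly_Mapping.single v 1) (1::'f) ^ Poly_Mapping.lookup m v) \<in> reach" for A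
    proof (induction A rule: infinite_finite_induct)
      case (insert v A)
      obtain k i j where v: "v = (k, i, j)" by (cases v)
      have "mono_of (Poly_Mapping.single v 1) (1::'f) \<in> reach"
        unfolding v coord_nth[symmetric] by (cases k) (simp_all only: reach_coord)
      then have "mono_of (Poly_Mapping.single v 1) (1::'f) ^ n \<in> reach" for n
        by (induction n) (use reach_const[of 1] in \<open>simp_all add: reach_mult const_poly.hom_one\<close>)
      then show ?case using insert by (simp add: reach_mult)
    qed (use reach_const[of 1] in \<open>simp_all add: const_poly.hom_one\<close>)
    then show ?thesis by (subst mono_of_mon_pow[symmetric]) (simp only: mon_pow_def)
  qed
  have "Poly_Mapping.keys p \<subseteq> UNIV" by simp
  then show ?thesis
  proof (induction rule: additive_induct)
    case zero
    then show ?case using reach_const[of 0] by (simp add: const_poly.hom_zero)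
  next
    case (single t c)
    have "const_poly c * mono_of t 1 \<in> reach" by (intro reach_mult reach_const mon)
    then show ?case by (simp add: const_poly_def mult_single)
  qed (rule reach_add)
qed

text \<open>A multiplier is itself straight, being its own product with the empty word 1.\<close>

theorem power_mult_straight: "\<exists>k. coord gg_M $ 3 $ 1 ^ k * p \<in> straight"
proof -
  obtain k where "le Lf ^ k * p \<in> multipliers"
    using reach_all[of p] unfolding reach_def by blast
  moreover have "1 \<in> straight"
    using straight_word[of 1 "((0, 0, 0, 0, 0, 0), TD 0 0)"] by (simp add: const_poly.hom_one)
  ultimately have "le Lf ^ k * p * 1 \<in> straight" unfolding multipliers_def by blast
  then show ?thesis by (auto simp: le_coord)
qed

end

section \<open>Matrices under evaluation; vanishing of the relations on Y\<close>

context coeff_hom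
begin

definition pmat :: "('v \<Rightarrow> 'l) \<Rightarrow> (('v \<Rightarrow>\<^sub>0 nat) \<Rightarrow>\<^sub>0 'f) ^ 3 ^ 3 \<Rightarrow> 'l ^ 3 ^ 3"
  where "pmat \<phi> A = (\<chi> i j. peval \<phi> \<iota> (A $ i $ j))"

lemma pmat_nth [simp]: "pmat \<phi> A $ i $ j = peval \<phi> \<iota> (A $ i $ j)"
  by (simp add: pmat_def)

lemma pmat_mult: "pmat \<phi> (A ** B) = pmat \<phi> A ** pmat \<phi> B"
  by (simp add: vec_eq_iff matrix_matrix_mult_def sum_3 peval_add peval_mult)

lemma peval_det: "peval \<phi> \<iota> (det A) = det (pmat \<phi> A)"
  by (simp add: det_3 peval_add peval_mult peval_diff)

lemma pmat_adj3: "pmat \<phi> (adj3 A) = adj3 (pmat \<phi> A)"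
proof -
  have "peval \<phi> \<iota> (adj3 A $ i $ j) = adj3 (pmat \<phi> A) $ i $ j" for i j
  proof -
    have "pmat \<phi> (\<chi> k l. if k = j then if l = i then 1 else 0 else A $ k $ l)
        = (\<chi> k l. if k = j then if l = i then 1 else 0 else pmat \<phi> A $ k $ l)"
      by (simp add: vec_eq_iff)
    then show ?thesis by (simp add: adj3_def peval_det)
  qed
  then show ?thesis by (simp add: vec_eq_iff)
qed

lemma pmat_conj3: "pmat \<phi> (conj3 g A) = conj3 (pmat \<phi> g) (pmat \<phi> A)"
  by (simp add: conj3_def pmat_mult pmat_adj3)

end

lemma Idl_sum: "(\<And>a. a \<in> A \<Longrightarrow> f a \<in> Idl\<^bsub>ring_of_type_algebra\<^esub> P) \<Longrightarrow>
    sum f A \<in> Idl\<^bsub>ring_of_type_algebra\<^esub> (P :: 'a::comm_ring_1 set)"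
  by (induction A rule: infinite_finite_induct) (simp_all add: Idl_zero Idl_add)

lemma Idl_mult_right:
  "x \<in> Idl\<^bsub>ring_of_type_algebra\<^esub> P \<Longrightarrow> x * r \<in> Idl\<^bsub>ring_of_type_algebra\<^esub> (P :: 'a::comm_ring_1 set)"
  using Idl_mult[of x P r] by (simp add: mult.commute)

lemma mult_mat_nth: "(A ** mat d) $ i $ j = d * A $ i $ j" "(mat d ** A) $ i $ j = d * A $ i $ j"
  for A :: "'a::comm_ring_1 ^ 3 ^ 3"
  using exhaust_3[of i] exhaust_3[of j]
  by (auto simp: matrix_matrix_mult_def mat_def sum_3 mult.commute)

lemma mult_mat_commute: "A ** mat d = mat d ** (A :: 'a::comm_ring_1 ^ 3 ^ 3)"
  by (simp add: vec_eq_iff mult_mat_nth)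

text \<open>The adjugate inverts \<open>g\<close> only up to \<open>det g\<close>, so conjugation is
  multiplicative up to this factor. A factor does no harm to membership in an ideal.\<close>

lemma conj3_mult: "conj3 g A ** conj3 g B = mat (det g) ** conj3 g (A ** B)"
proof -
  have "conj3 g A ** conj3 g B = g ** A ** (adj3 g ** g) ** B ** adj3 g"
    by (simp add: conj3_def matrix_mul_assoc)
  also have "\<dots> = g ** (A ** mat (det g)) ** B ** adj3 g"
    by (simp add: adj3_mult matrix_mul_assoc)
  also have "\<dots> = (g ** mat (det g)) ** A ** B ** adj3 g"
    by (simp only: mult_mat_commute[of A] matrix_mul_assoc)
  also have "\<dots> = mat (det g) ** conj3 g (A ** B)"
    by (simp only: mult_mat_commute[of g] conj3_def matrix_mul_assoc)
  finally show ?thesis .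
qed

lemma trace_conj3: "trace (conj3 g A) = det g * trace A"
proof -
  have "trace (conj3 g A) = trace (adj3 g ** (g ** A))"
    unfolding conj3_def by (rule trace_mul_sym)
  also have "\<dots> = trace (mat (det g) ** A)"
    by (simp add: matrix_mul_assoc adj3_mult)
  finally show ?thesis by (simp add: trace_def mult_mat_nth sum_distrib_left)
qed

lemma trace_mat_mult: "trace (mat d ** A) = d * trace (A :: 'a::comm_ring_1 ^ 3 ^ 3)"
  by (simp add: trace_def mult_mat_nth sum_distrib_left)

text \<open>Pigeonhole on three indices. In a product of three strictly upper triangular matrices
  every summand therefore has a factor on or below the diagonal.\<close>

lemma four_chain_3: "\<not> ((i::3) < a \<and> a < b \<and> b < j)"
proof
  assume "i < a \<and> a < b \<and> b < j"
  then have "i < a" "i < b" "i < j" "a < b" "a < j" "b < j"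
    by (blast intro: less_trans)+
  then have "i \<noteq> a" "i \<noteq> b" "i \<noteq> j" "a \<noteq> b" "a \<noteq> j" "b \<noteq> j"
    by (blast dest: less_imp_neq)+
  then have "card {i, a, b, j} = 4" by simp
  moreover have "card {i, a, b, j} \<le> card (UNIV :: 3 set)"
    by (rule card_mono) auto
  ultimately show False by simp
qed

text \<open>Conjugation reduces the claim to the pair in C(n). There diagonal entries of one or two
  strictly triangular factors vanish, triple products vanish entirely, and the commutator is among
  the equations.\<close>

lemma relations_pullback:
  fixes r :: "(gg_mat, 'f::comm_ring_1) mat_poly"
  assumes "r \<in> relations"
  shows "mat_subst Y_map r \<in> Idl\<^bsub>poly_ring\<^esub> GC_eqs"
proof -
  let ?K = "Idl\<^bsub>poly_ring\<^esub> (GC_eqs :: (GC_mat, 'f) mat_poly set)"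
  let ?g = "coord GC_g :: (GC_mat, 'f) mat_poly ^ 3 ^ 3"
    and ?A = "coord GC_M :: (GC_mat, 'f) mat_poly ^ 3 ^ 3"
    and ?B = "coord GC_N :: (GC_mat, 'f) mat_poly ^ 3 ^ 3"
  let ?M = "coord gg_M :: (gg_mat, 'f) mat_poly ^ 3 ^ 3" and ?N = "coord gg_N :: (gg_mat, 'f) mat_poly ^ 3 ^ 3"
  let ?\<phi> = "\<lambda>(k, i, j). (Y_map k :: (GC_mat, 'f) mat_poly ^ 3 ^ 3) $ i $ j"
  let ?h = "mat_subst Y_map :: (gg_mat, 'f) mat_poly \<Rightarrow> (GC_mat, 'f) mat_poly"
  have h: "?h p = peval ?\<phi> const_poly p" for p
    by (rule mat_subst_eq)
  have M: "const_poly.pmat ?\<phi> ?M = conj3 ?g ?A" and N: "const_poly.pmat ?\<phi> ?N = conj3 ?g ?B"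
    by (simp_all add: vec_eq_iff h[symmetric])
  have tr: "?h (trace P) = trace (const_poly.pmat ?\<phi> P)" for P
    by (simp add: trace_def h const_poly.peval_sum)
  have nth: "?h (P $ i $ j) = const_poly.pmat ?\<phi> P $ i $ j" for P :: "(gg_mat, 'f) mat_poly ^ 3 ^ 3" and i j
    by (simp add: h)
  note pm = const_poly.pmat_mult M N conj3_mult
  have A: "?A $ i $ j \<in> ?K" and B: "?B $ i $ j \<in> ?K" if "j \<le> i" for i j
  proof -
    have "?A $ i $ j \<in> GC_eqs" "?B $ i $ j \<in> GC_eqs"
      unfolding GC_eqs_def Cn_eqs_def using that by blast+
    then show "?A $ i $ j \<in> ?K" "?B $ i $ j \<in> ?K" by (auto intro: subsetD[OF Idl_self])
  qed
  have AB: "(?A ** ?B - ?B ** ?A) $ i $ j \<in> ?K" for i j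
  proof -
    have "(?A ** ?B - ?B ** ?A) $ i $ j \<in> GC_eqs"
      unfolding GC_eqs_def Cn_eqs_def entries_def by blast
    then show ?thesis by (rule subsetD[OF Idl_self])
  qed
  note K = Idl_mult[of _ GC_eqs] Idl_mult_right[of _ GC_eqs]
  have two: "P $ i $ a * Q $ a $ i \<in> ?K" if "P \<in> {?A, ?B}" "Q \<in> {?A, ?B}" for P Q :: "(GC_mat, 'f) mat_poly ^ 3 ^ 3" and i a
  proof (cases "a \<le> i")
    case True
    then have "P $ i $ a \<in> ?K" using A B that by auto
    then show ?thesis by (rule K)
  next
    case False
    then have "Q $ a $ i \<in> ?K" using A B that by auto
    then show ?thesis by (rule K)
  qed
  have three: "P $ i $ a * Q $ a $ b * R $ b $ j \<in> ?K"
    if "P \<in> {?A, ?B}" "Q \<in> {?A, ?B}" "R \<in> {?A, ?B}" for P Q R :: "(GC_mat, 'f) mat_poly ^ 3 ^ 3" and i a b j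
  proof -
    consider "a \<le> i" | "b \<le> a" | "j \<le> b"
      using four_chain_3[of i a b j] by (meson not_le)
    then show ?thesis
    proof cases
      case 1
      then have "P $ i $ a \<in> ?K" using A B that by auto
      then show ?thesis by (intro K(2))
    next
      case 2
      then have "Q $ a $ b \<in> ?K" using A B that by auto
      then show ?thesis by (intro K(2) K(1))
    next
      case 3
      then have "R $ b $ j \<in> ?K" using A B that by auto
      then show ?thesis by (intro K(1))
    qed
  qed
  have tr1: "trace P \<in> ?K" if "P \<in> {?A, ?B}" for P :: "(GC_mat, 'f) mat_poly ^ 3 ^ 3"
    unfolding trace_def using that A B by (intro Idl_sum) auto
  have tr2: "trace (P ** Q) \<in> ?K" if "P \<in> {?A, ?B}" "Q \<in> {?A, ?B}" for P Q :: "(GC_mat, 'f) mat_poly ^ 3 ^ 3"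
    unfolding trace_def matrix_matrix_mult_def using two that by (simp add: Idl_sum)
  have nth3: "(P ** Q ** R) $ i $ j \<in> ?K"
    if "P \<in> {?A, ?B}" "Q \<in> {?A, ?B}" "R \<in> {?A, ?B}" for P Q R :: "(GC_mat, 'f) mat_poly ^ 3 ^ 3" and i j
    unfolding matrix_matrix_mult_def using three[OF that] by (simp add: sum_distrib_right Idl_sum)
  have tr3: "trace (P ** Q ** R) \<in> ?K"
    if "P \<in> {?A, ?B}" "Q \<in> {?A, ?B}" "R \<in> {?A, ?B}" for P Q R :: "(GC_mat, 'f) mat_poly ^ 3 ^ 3"
    unfolding trace_def using nth3[OF that] by (intro Idl_sum)
  have conj: "conj3 ?g P $ i $ j \<in> ?K" if "\<And>i j. P $ i $ j \<in> ?K" for P :: "(GC_mat, 'f) mat_poly ^ 3 ^ 3" and i j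
    unfolding conj3_def matrix_matrix_mult_def
    using that by (simp add: sum_distrib_right Idl_sum K)
  have conj_diff: "conj3 ?g P - conj3 ?g Q = conj3 ?g (P - Q)" for P Q
    by (simp add: conj3_def vec_eq_iff matrix_matrix_mult_def sum_3 algebra_simps)
  have comm: "(const_poly.pmat ?\<phi> (?M ** ?N - ?N ** ?M)) = mat (det ?g) ** conj3 ?g (?A ** ?B - ?B ** ?A)"
  proof -
    have "const_poly.pmat ?\<phi> (?M ** ?N - ?N ** ?M)
        = const_poly.pmat ?\<phi> (?M ** ?N) - const_poly.pmat ?\<phi> (?N ** ?M)"
      by (simp add: vec_eq_iff const_poly.peval_diff)
    then show ?thesis
      unfolding pm conj_diff[symmetric] by (simp add: vec_eq_iff mult_mat_nth right_diff_distrib)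
  qed
  have three_conj: "const_poly.pmat ?\<phi> (P ** Q ** R) = mat (det ?g) ** (mat (det ?g) ** conj3 ?g (P' ** Q' ** R'))"
    if "const_poly.pmat ?\<phi> P = conj3 ?g P'" "const_poly.pmat ?\<phi> Q = conj3 ?g Q'"
      "const_poly.pmat ?\<phi> R = conj3 ?g R'" for P Q R P' Q' R'
  proof -
    have "const_poly.pmat ?\<phi> (P ** Q ** R) = mat (det ?g) ** conj3 ?g (P' ** Q') ** conj3 ?g R'"
      by (simp only: const_poly.pmat_mult that conj3_mult)
    also have "\<dots> = mat (det ?g) ** (conj3 ?g (P' ** Q') ** conj3 ?g R')"
      by (rule matrix_mul_assoc[symmetric])
    finally show ?thesis by (simp only: conj3_mult)
  qed
  consider "r = trace ?M" | "r = trace ?N" | "r = trace (?M ** ?M)" | "r = trace (?M ** ?N)"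
    | "r = trace (?N ** ?N)" | i j where "r = (?M ** ?N - ?N ** ?M) $ i $ j"
    | "r = trace (?M ** ?M ** ?M)" | "r = trace (?N ** ?N ** ?N)"
    | i j where "r = (?M ** ?M ** ?N) $ i $ j" | i j where "r = (?M ** ?N ** ?N) $ i $ j"
    using assms unfolding relations_def Let_def entries_def by blast
  then show ?thesis
  proof cases
    case 1
    then show ?thesis by (simp add: tr M trace_conj3 K tr1)
  next
    case 2
    then show ?thesis by (simp add: tr N trace_conj3 K tr1)
  next
    case 3
    then show ?thesis by (simp add: tr pm trace_mat_mult trace_conj3 K tr2)
  next
    case 4
    then show ?thesis by (simp add: tr pm trace_mat_mult trace_conj3 K tr2)
  next
    case 5
    then show ?thesis by (simp add: tr pm trace_mat_mult trace_conj3 K tr2)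
  next
    case (6 i j)
    show ?thesis unfolding 6 nth comm mult_mat_nth using conj[OF AB] by (intro K(1))
  next
    case 7
    show ?thesis unfolding 7 tr three_conj[OF M M M] trace_mat_mult trace_conj3
      by (intro K(1) tr3) simp_all
  next
    case 8
    show ?thesis unfolding 8 tr three_conj[OF N N N] trace_mat_mult trace_conj3
      by (intro K(1) tr3) simp_all
  next
    case (9 i j)
    show ?thesis unfolding 9 nth three_conj[OF M M N] mult_mat_nth
      by (intro K(1) conj nth3) simp_all
  next
    case (10 i j)
    show ?thesis unfolding 10 nth three_conj[OF M N N] mult_mat_nth
      by (intro K(1) conj nth3) simp_all
  qed
qed

lemma Idl_pullback:
  assumes "p \<in> Idl\<^bsub>poly_ring\<^esub> relations"
  shows "mat_subst Y_map p \<in> Idl\<^bsub>poly_ring\<^esub> GC_eqs"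
proof -
  have "Idl\<^bsub>poly_ring\<^esub> relations \<subseteq> {p. mat_subst Y_map p \<in> Idl\<^bsub>poly_ring\<^esub> GC_eqs}"
    by (rule Idl_least) (auto simp: mat_subst_hom Idl_zero Idl_add Idl_mult relations_pullback)
  then show ?thesis using assms by blast
qed

section \<open>Exponents of the words at the generic point\<close>

fun tor_sign :: "tor \<Rightarrow> nat" where
  "tor_sign (TU j k) = Suc j + k"
| "tor_sign (TV j k) = 0"
| "tor_sign (TD j k) = j"
| "tor_sign (TA j k) = 1 + j"

text \<open>The exponents of \<open>f\<close>, \<open>v\<close>, \<open>w\<close>, \<open>b\<close>,
  in this order, in the monomial that a normal form becomes.\<close>

fun tor_expo :: "tor \<Rightarrow> nat \<times> nat \<times> nat \<times> nat" where
  "tor_expo (TU j k) = (Suc j, 2 * Suc j + 2 * k, 3 * Suc j + 3 * k, k)"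
| "tor_expo (TV j k) = (2 * Suc j + k, Suc j + k, 0, k)"
| "tor_expo (TD j k) = (k, 2 * j + k, 3 * j, j + k)"
| "tor_expo (TA j k) = (1 + k, 2 + (2 * j + k), 2 + 3 * j, 1 + (j + k))"

fun word_expo :: "word \<Rightarrow> nat list" where
  "word_expo ((a, b, c, d, k, i), t) = (case tor_expo t of (tf, tv, tw, tb) \<Rightarrow>
    [a + i + tf, b, c, d, k, i + tv, i + tw, tb])"

text \<open>
  The difference of the exponents of \<open>w\<close> and \<open>v\<close> does not change under multiplication by
  \<open>LS\<close>, and together with the exponent of \<open>b\<close> it determines the normal form.
\<close>

fun tor_skew :: "tor \<Rightarrow> int" where
  "tor_skew (TU j k) = int j + 1 + int k"
| "tor_skew (TV j k) = - (int j + 1 + int k)"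
| "tor_skew (TD j k) = int j - int k"
| "tor_skew (TA j k) = int j - int k"

fun tor_last :: "tor \<Rightarrow> int" where
  "tor_last (TU j k) = int k"
| "tor_last (TV j k) = int k"
| "tor_last (TD j k) = int j + int k"
| "tor_last (TA j k) = 1 + int j + int k"

text \<open>The skew exceeds \<open>tor_last\<close> exactly for \<open>TU\<close>, and its negative
  does so exactly for \<open>TV\<close>. In the remaining range the parity of skew plus last
  separates \<open>TD\<close> (even) from \<open>TA\<close> (odd). Within each shape
  \<open>j\<close> and \<open>k\<close> are then read off.\<close>

lemma tor_skew_last_inj: "tor_skew t = tor_skew t' \<Longrightarrow> tor_last t = tor_last t' \<Longrightarrow> t = t'"
  by (cases t; cases t'; simp; presburger)

lemma tor_expo_skew_last:
  assumes "tor_expo t = (tf, tv, tw, tb)"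
  shows "int tw - int tv = tor_skew t" "int tb = tor_last t"
  using assms by (cases t; clarsimp)+

text \<open>Since \<open>LS\<close> becomes \<open>f * v * w\<close>, it shifts the exponents of
  \<open>v\<close> and \<open>w\<close> equally, so their difference and the exponent of
  \<open>b\<close> give the normal form. The exponent of \<open>v\<close> then gives
  \<open>i\<close>, and that of \<open>f\<close> gives \<open>a\<close>.\<close>

lemma word_expo_inj: "word_expo w = word_expo w' \<Longrightarrow> w = w'"
proof -
  assume eq: "word_expo w = word_expo w'"
  obtain n t where w: "w = (n, t)" by (cases w)
  obtain n' t' where w': "w' = (n', t')" by (cases w')
  obtain a b c d k i where n: "n = (a, b, c, d, k, i)" by (cases n rule: prod_cases6)
  obtain a' b' c' d' k' i' where n': "n' = (a', b', c', d', k', i')" by (cases n' rule: prod_cases6)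
  obtain tf tv tw tb where t: "tor_expo t = (tf, tv, tw, tb)" by (cases "tor_expo t" rule: prod_cases4)
  obtain tf' tv' tw' tb' where t': "tor_expo t' = (tf', tv', tw', tb')"
    by (cases "tor_expo t'" rule: prod_cases4)
  have e: "a + i + tf = a' + i' + tf'" "b = b'" "c = c'" "d = d'" "k = k'" "i + tv = i' + tv'"
    "i + tw = i' + tw'" "tb = tb'"
    using eq unfolding w w' n n' word_expo.simps t t' prod.case list.inject by blast+
  have "int tw - int tv = int tw' - int tv'" using e(6,7) by linarith
  then have tt: "t = t'"
    using tor_expo_skew_last[OF t] tor_expo_skew_last[OF t'] e(8) by (intro tor_skew_last_inj) linarith+
  then have "tf = tf'" "tv = tv'" using t t' by simp_all
  then show ?thesis using e tt unfolding w w' n n' by simp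
qed

text \<open>Signs are kept as a separate factor \<open>- 1\<close>, so that distributing powers
  collects them into the power of \<open>- 1\<close> counted by \<open>tor_sign\<close>.\<close>

fun param_letter :: "'l::comm_ring_1 \<Rightarrow> 'l \<Rightarrow> 'l \<Rightarrow> 'l \<Rightarrow> 'l \<Rightarrow> 'l \<Rightarrow> 'l \<Rightarrow> 'l \<Rightarrow> letter \<Rightarrow> 'l" where
  "param_letter f lam x y z v w b Lf = f"
| "param_letter f lam x y z v w b Llam = lam"
| "param_letter f lam x y z v w b Lx = x"
| "param_letter f lam x y z v w b Ly = y"
| "param_letter f lam x y z v w b Lz = z"
| "param_letter f lam x y z v w b LS = f * v * w"
| "param_letter f lam x y z v w b LU = - 1 * (f * v ^ 2 * w ^ 3)"
| "param_letter f lam x y z v w b LV = f ^ 2 * v"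
| "param_letter f lam x y z v w b LD = - 1 * (b * v ^ 2 * w ^ 3)"
| "param_letter f lam x y z v w b LV' = f * b * v"
| "param_letter f lam x y z v w b LA = - 1 * (f * b * v ^ 2 * w ^ 2)"

lemma tor_val_param:
  "tor_val (param_letter f lam x y z v w b) t = (case tor_expo t of (tf, tv, tw, tb) \<Rightarrow>
    (- 1) ^ tor_sign t * (f ^ tf * (v ^ tv * (w ^ tw * b ^ tb))))"
proof -
  note expand = tor_val.simps tor_expo.simps tor_sign.simps param_letter.simps prod.case
    power_mult_distrib power_add power_mult power_0 power_one_right mult_1_left mult_1_right
  show ?thesis
  proof (cases t)
    case (TU j k)
    show ?thesis unfolding TU by (simp only: expand, simp only: mult_ac)
  next
    case (TV j k)
    show ?thesis unfolding TV by (simp only: expand, simp only: mult_ac)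
  next
    case (TD j k)
    show ?thesis unfolding TD by (simp only: expand, simp only: mult_ac)
  next
    case (TA j k)
    show ?thesis unfolding TA by (simp only: expand, simp only: mult_ac)
  qed
qed

lemma word_val_param:
  "word_val (param_letter f lam x y z v w b) n =
    (- 1) ^ tor_sign (snd n) * prod_list (map2 (^) [f, lam, x, y, z, v, w, b] (word_expo n))"
proof -
  obtain m t where n: "n = (m, t)" by (cases n)
  obtain a i1 i2 i3 i4 i where m: "m = (a, i1, i2, i3, i4, i)" by (cases m rule: prod_cases6)
  obtain tf tv tw tb where t: "tor_expo t = (tf, tv, tw, tb)" by (cases "tor_expo t" rule: prod_cases4)
  show ?thesis
    unfolding n m word_val.simps word_expo.simps tor_val_param t prod.case snd_conv
      zip_Cons_Cons list.map prod_list.Cons zip_Nil prod_list.Nil mult_1_right param_letter.simps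
      power_add power_mult_distrib
    by (simp only: mult_ac)
qed

definition horner :: "nat \<Rightarrow> nat list \<Rightarrow> nat"
  where "horner B es = foldr (\<lambda>e n. e + B * n) es 0"

lemma horner_inj:
  assumes "length es = length es'" "\<forall>e\<in>set es. e < B" "\<forall>e\<in>set es'. e < B" "horner B es = horner B es'"
  shows "es = es'"
  using assms
proof (induction es es' rule: list_induct2)
  case (Cons e es e' es')
  have eq: "e + B * horner B es = e' + B * horner B es'" and lt: "e < B" "e' < B"
    using Cons.prems by (simp_all add: horner_def)
  from arg_cong[OF eq, of "\<lambda>n. n mod B"] have "e = e'" using lt by simp
  moreover from arg_cong[OF eq, of "\<lambda>n. n div B"] have "horner B es = horner B es'" using lt by simp
  ultimately show ?case using Cons by simp
qed simp

text \<open>The first two rows suffice for the conjugates below, because the third columns of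
  \<open>pM\<close> and \<open>pN\<close> are zero.\<close>

lemma adj3_nth:
  fixes A :: "'a::comm_ring_1 ^ 3 ^ 3"
  shows "adj3 A $ 1 $ 1 = A $ 2 $ 2 * A $ 3 $ 3 - A $ 2 $ 3 * A $ 3 $ 2"
    "adj3 A $ 1 $ 2 = A $ 1 $ 3 * A $ 3 $ 2 - A $ 1 $ 2 * A $ 3 $ 3"
    "adj3 A $ 1 $ 3 = A $ 1 $ 2 * A $ 2 $ 3 - A $ 1 $ 3 * A $ 2 $ 2"
    "adj3 A $ 2 $ 1 = A $ 2 $ 3 * A $ 3 $ 1 - A $ 2 $ 1 * A $ 3 $ 3"
    "adj3 A $ 2 $ 2 = A $ 1 $ 1 * A $ 3 $ 3 - A $ 1 $ 3 * A $ 3 $ 1"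
    "adj3 A $ 2 $ 3 = A $ 1 $ 3 * A $ 2 $ 1 - A $ 1 $ 1 * A $ 2 $ 3"
proof -
  have d: "(1::3) \<noteq> 2" "(1::3) \<noteq> 3" "(2::3) \<noteq> 3" "(2::3) \<noteq> 1" "(3::3) \<noteq> 1" "(3::3) \<noteq> 2"
    by simp_all
  show "adj3 A $ 1 $ 1 = A $ 2 $ 2 * A $ 3 $ 3 - A $ 2 $ 3 * A $ 3 $ 2"
    "adj3 A $ 1 $ 2 = A $ 1 $ 3 * A $ 3 $ 2 - A $ 1 $ 2 * A $ 3 $ 3"
    "adj3 A $ 1 $ 3 = A $ 1 $ 2 * A $ 2 $ 3 - A $ 1 $ 3 * A $ 2 $ 2"
    "adj3 A $ 2 $ 1 = A $ 2 $ 3 * A $ 3 $ 1 - A $ 2 $ 1 * A $ 3 $ 3"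
    "adj3 A $ 2 $ 2 = A $ 1 $ 1 * A $ 3 $ 3 - A $ 1 $ 3 * A $ 3 $ 1"
    "adj3 A $ 2 $ 3 = A $ 1 $ 3 * A $ 2 $ 1 - A $ 1 $ 1 * A $ 2 $ 3"
    by (simp_all add: adj3_def det_3 d)
qed

subsection \<open>The generic point\<close>

text \<open>
  Row and column \<open>3 = 0\<close> come first, so the entries of \<open>pM\<close> and \<open>pN\<close> above the diagonal are those at
  (3, 1), (3, 2) and (1, 2). The parameters \<open>f\<close>, \<open>x\<close>, \<open>y\<close>, \<open>z\<close> and \<open>lam\<close> are the values of
  \<open>M 3 1\<close>, \<open>M 2 1\<close>, \<open>M 3 2\<close>, \<open>M 1 1\<close> and \<open>N 3 1\<close>.
\<close>

locale generic_point =
  fixes f lam x y z v w b :: "'l::field"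
  assumes f_nonzero: "f \<noteq> 0"
begin

text \<open>For the conjugated matrix \<open>M\<close> the first standard basis vector
  \<open>u\<close> is cyclic: the columns 2, 1, 3 of \<open>pg\<close> are \<open>u\<close>,
  \<open>M u\<close> and \<open>M^2 u\<close> divided by \<open>f^2 * v\<close>, a factor that makes
  the determinant 1. The number of parameters is the dimension of Y: 3 for the flag and 5 for the
  commuting pair.\<close>

definition pg :: "'l ^ 3 ^ 3"
  where "pg = vector [vector [z, 1, - (v * w ^ 2 + y + z * w) / f ^ 2],
    vector [x, 0, (f - x * w) / f ^ 2], vector [f, 0, - (w / f)]]"

definition pM :: "'l ^ 3 ^ 3"
  where "pM = vector [vector [0, 1, 0], vector [0, 0, 0], vector [f ^ 2 * v, 0, 0]]"

text \<open>This is \<open>c * pM + b / f * pM^2\<close> with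
  \<open>c = (lam + b * v * w) / f\<close>, the general strictly upper triangular matrix that
  commutes with the regular nilpotent \<open>pM\<close>. The value of \<open>c\<close> is chosen so
  that the (3,1) entry of the conjugate becomes \<open>lam\<close>.\<close>

definition pN :: "'l ^ 3 ^ 3"
  where "pN = vector [vector [0, (lam + b * v * w) / f, 0], vector [0, 0, 0],
    vector [(lam + b * v * w) / f * (f ^ 2 * v), b / f * (f ^ 2 * v), 0]]"

lemma det_pg: "det pg = 1"
  using f_nonzero by (simp add: det_3 pg_def vector_3 field_simps power2_eq_square)

lemma pM_pN_zero:
  assumes "j \<le> i"
  shows "pM $ i $ j = 0" "pN $ i $ j = 0"
proof -
  have "\<not> (2::3) \<le> 1" "\<not> (1::3) \<le> 3" "\<not> (2::3) \<le> 3"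
    by (simp_all add: less_eq_bit1_def bit1.Rep_1 bit1.Rep_numeral)
  then show "pM $ i $ j = 0" "pN $ i $ j = 0"
    using assms exhaust_3[of i] exhaust_3[of j]
    by (auto simp: pM_def pN_def vector_3)
qed

lemma pM_pN_commute: "pM ** pN = pN ** pM"
  unfolding vec_eq_iff forall_3
  by (simp add: pM_def pN_def vector_3 matrix_matrix_mult_def sum_3)

lemma pg_nth:
  "pg $ 1 $ 1 = z" "pg $ 1 $ 2 = 1" "pg $ 1 $ 3 = - (v * w ^ 2 + y + z * w) / f ^ 2"
  "pg $ 2 $ 1 = x" "pg $ 2 $ 2 = 0" "pg $ 2 $ 3 = (f - x * w) / f ^ 2"
  "pg $ 3 $ 1 = f" "pg $ 3 $ 2 = 0" "pg $ 3 $ 3 = - (w / f)"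
  by (simp_all add: pg_def vector_3)

lemma adj_pg_nth:
  "adj3 pg $ 1 $ 1 = 0" "adj3 pg $ 1 $ 2 = w / f" "adj3 pg $ 1 $ 3 = (f - x * w) / f ^ 2"
  "adj3 pg $ 2 $ 1 = 1" "adj3 pg $ 2 $ 2 = (v * w ^ 2 + y) / f"
  "adj3 pg $ 2 $ 3 = - (z * f + x * v * w ^ 2 + x * y) / f ^ 2"
  using f_nonzero by (simp_all add: adj3_nth pg_nth field_simps power2_eq_square)

lemma conj_pM_nth:
  "conj3 pg pM $ i $ j = pg $ i $ 3 * (f ^ 2 * v) * adj3 pg $ 1 $ j + pg $ i $ 1 * adj3 pg $ 2 $ j"
  by (simp add: conj3_def matrix_matrix_mult_def sum_3 pM_def vector_3)

lemma conj_pN_nth: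
  "conj3 pg pN $ i $ j = pg $ i $ 3 * ((lam + b * v * w) / f * (f ^ 2 * v)) * adj3 pg $ 1 $ j
    + (pg $ i $ 1 * ((lam + b * v * w) / f) + pg $ i $ 3 * (b / f * (f ^ 2 * v))) * adj3 pg $ 2 $ j"
  by (simp add: conj3_def matrix_matrix_mult_def sum_3 pN_def vector_3)

lemma conj_pM:
  "conj3 pg pM $ 1 $ 1 = z" "conj3 pg pM $ 2 $ 1 = x" "conj3 pg pM $ 3 $ 1 = f"
  "conj3 pg pM $ 3 $ 2 = y"
  "f * conj3 pg pM $ 2 $ 2 = f * v * w + x * y"
  "f * conj3 pg pM $ 1 $ 2 = y * z - v * w * y - v ^ 2 * w ^ 3"
  "f ^ 2 * conj3 pg pM $ 2 $ 3 = f ^ 2 * v - f * v * w * x - f * x * z - x * (f * v * w + x * y)"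
  and conj_pN:
  "conj3 pg pN $ 3 $ 1 = lam"
  "f * conj3 pg pN $ 2 $ 1 = lam * x + f * b * v"
  "f * conj3 pg pN $ 1 $ 1 = lam * z - b * (v ^ 2 * w ^ 2 + y * v)"
  "f * conj3 pg pN $ 3 $ 2 = lam * y - b * v ^ 2 * w ^ 3"
proof -
  \<comment> \<open>The name \<open>fa\<close> sorts directly after \<open>f\<close>, so that ordered rewriting brings the two together.\<close>
  define fa where "fa = inverse f"
  have inv: "f * fa = 1" "f * (fa * t) = t" for t
    using f_nonzero by (simp_all add: fa_def)
  have eqs: "t / f = t * fa" "t / f ^ 2 = t * (fa * fa)" for t
    by (simp_all add: fa_def divide_inverse power2_eq_square)
  show "conj3 pg pM $ 1 $ 1 = z"
    "conj3 pg pM $ 2 $ 1 = x"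
    "conj3 pg pM $ 3 $ 1 = f"
    "conj3 pg pM $ 3 $ 2 = y"
    "f * conj3 pg pM $ 2 $ 2 = f * v * w + x * y"
    "f * conj3 pg pM $ 1 $ 2 = y * z - v * w * y - v ^ 2 * w ^ 3"
    "f ^ 2 * conj3 pg pM $ 2 $ 3 = f ^ 2 * v - f * v * w * x - f * x * z - x * (f * v * w + x * y)"
    "conj3 pg pN $ 3 $ 1 = lam"
    "f * conj3 pg pN $ 2 $ 1 = lam * x + f * b * v"
    "f * conj3 pg pN $ 1 $ 1 = lam * z - b * (v ^ 2 * w ^ 2 + y * v)"
    "f * conj3 pg pN $ 3 $ 2 = lam * y - b * v ^ 2 * w ^ 3"
    unfolding conj_pM_nth conj_pN_nth pg_nth adj_pg_nth eqs
    by (simp_all add: algebra_simps power2_eq_square power3_eq_cube inv)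
qed

fun point_val :: "GC_mat \<times> 3 \<times> 3 \<Rightarrow> 'l" where
  "point_val (GC_g, i, j) = pg $ i $ j"
| "point_val (GC_M, i, j) = pM $ i $ j"
| "point_val (GC_N, i, j) = pN $ i $ j"

end

context coeff_hom
begin

lemma pmat_coord: "pmat \<phi> (coord k) = (\<chi> i j. \<phi> (k, i, j))"
  by (simp add: vec_eq_iff peval_coord)

end

locale six_invertible_point = six_invertible field_type + generic_point f lam x y z v w b
    + coeff_hom \<iota>
  for field_type :: "'f::field itself" and f lam x y z v w b :: "'l::field" and \<iota> :: "'f \<Rightarrow> 'l"
begin

abbreviation ev :: "(gg_mat, 'f) mat_poly \<Rightarrow> 'l"
  where "ev p \<equiv> peval point_val \<iota> (mat_subst Y_map p)"

lemma pmat_point: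
  "pmat point_val (coord GC_g) = pg" "pmat point_val (coord GC_M) = pM" "pmat point_val (coord GC_N) = pN"
  by (simp_all add: pmat_coord vec_eq_iff)

lemma ev_GC: "p \<in> Idl\<^bsub>poly_ring\<^esub> GC_eqs \<Longrightarrow> peval point_val \<iota> p = 0"
proof (erule peval_Idl)
  fix q :: "(GC_mat, 'f) mat_poly" assume "q \<in> GC_eqs"
  then have "(q = det (coord GC_g) - 1 \<or> False)
      \<or> ((\<exists>i j. q = coord GC_M $ i $ j \<and> j \<le> i) \<or> (\<exists>i j. q = coord GC_N $ i $ j \<and> j \<le> i))
        \<or> (\<exists>i j. q = (coord GC_M ** coord GC_N - coord GC_N ** coord GC_M) $ i $ j \<and> True)"
    unfolding GC_eqs_def Cn_eqs_def entries_def
    by (simp only: Un_iff insert_iff empty_iff mem_Collect_eq)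
  then consider "q = det (coord GC_g) - 1" | i j where "q = coord GC_M $ i $ j" "j \<le> i"
    | i j where "q = coord GC_N $ i $ j" "j \<le> i"
    | i j where "q = (coord GC_M ** coord GC_N - coord GC_N ** coord GC_M) $ i $ j"
    by (elim disjE exE conjE FalseE) assumption+
  then show "peval point_val \<iota> q = 0"
  proof cases
    case 1
    then show ?thesis by (simp add: peval_diff peval_det pmat_point det_pg)
  next
    case (2 i j)
    then show ?thesis by (simp add: peval_coord pM_pN_zero)
  next
    case (3 i j)
    then show ?thesis by (simp add: peval_coord pM_pN_zero)
  next
    case (4 i j)
    then have "peval point_val \<iota> q
        = pmat point_val (coord GC_M ** coord GC_N) $ i $ j - pmat point_val (coord GC_N ** coord GC_M) $ i $ j"
      by (simp add: peval_diff)
    then show ?thesis by (simp only: pmat_mult pmat_point pM_pN_commute diff_self)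
  qed
qed

lemma ev_hom: "ev (p + q) = ev p + ev q" "ev (p * q) = ev p * ev q" "ev (p - q) = ev p - ev q"
  "ev 0 = 0" "ev 1 = 1"
  by (simp_all add: mat_subst_hom peval_add peval_mult peval_diff)

lemma ev_power: "ev (p ^ n) = ev p ^ n"
  by (induction n) (simp_all only: power_0 power_Suc ev_hom)

lemma ev_const: "ev (const_poly c) = \<iota> c"
  by (simp add: mat_subst_eq const_poly_def)

lemma ev_coord:
  "ev (coord gg_M $ i $ j) = conj3 pg pM $ i $ j" "ev (coord gg_N $ i $ j) = conj3 pg pN $ i $ j"
proof -
  have "ev (coord gg_M $ i $ j) = pmat point_val (conj3 (coord GC_g) (coord GC_M)) $ i $ j"
    "ev (coord gg_N $ i $ j) = pmat point_val (conj3 (coord GC_g) (coord GC_N)) $ i $ j"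
    by simp_all
  then show "ev (coord gg_M $ i $ j) = conj3 pg pM $ i $ j" "ev (coord gg_N $ i $ j) = conj3 pg pN $ i $ j"
    by (simp_all only: pmat_conj3 pmat_point)
qed

lemma ev_letter: "ev (le L) = param_letter f lam x y z v w b L"
proof -
  have basic: "ev (le Lf) = f" "ev (le Llam) = lam" "ev (le Lx) = x" "ev (le Ly) = y" "ev (le Lz) = z"
    by (simp_all only: le_coord ev_coord conj_pM conj_pN)
  have S: "ev (le LS) = f * v * w"
    by (simp only: le_derived ev_hom ev_coord basic conj_pM) simp
  have V': "ev (le LV') = f * b * v"
    by (simp only: le_derived ev_hom ev_coord basic conj_pN) simp
  have U: "ev (le LU) = - 1 * (f * v ^ 2 * w ^ 3)"
    by (simp only: le_derived(2) ev_hom ev_coord basic conj_pM S) (simp add: algebra_simps)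
  have D: "ev (le LD) = - 1 * (b * v ^ 2 * w ^ 3)"
    by (simp only: le_derived(4) ev_hom ev_coord basic conj_pN) simp
  have A: "ev (le LA) = - 1 * (f * b * v ^ 2 * w ^ 2)"
    by (simp only: le_derived(6) ev_hom ev_coord basic conj_pN V') (simp add: algebra_simps)
  \<comment> \<open>The entries (2,2) and (2,3) are known at the point only after multiplication by
    \<open>f\<close> and \<open>f^2\<close>, so the terms are regrouped before
    \<open>conj_pM\<close> applies.\<close>
  have V: "ev (le LV) = f ^ 2 * v"
  proof -
    have "ev (le LV) = f * (x * z + conj3 pg pM $ 2 $ 2 * x + conj3 pg pM $ 2 $ 3 * f) + f * v * w * x"
      by (simp only: le_derived(3) ev_hom ev_coord basic S add.assoc)
    also have "\<dots> = f * x * z + x * (f * conj3 pg pM $ 2 $ 2) + f ^ 2 * conj3 pg pM $ 2 $ 3 + f * v * w * x"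
      by (simp add: algebra_simps power2_eq_square)
    finally show ?thesis by (simp only: conj_pM) (simp add: algebra_simps)
  qed
  show ?thesis
    by (cases L) (simp_all only: basic S U V D V' A param_letter.simps)
qed

lemma ev_word: "ev (word_val le n) = word_val (param_letter f lam x y z v w b) n"
proof -
  obtain k t where n: "n = (k, t)" by (cases n)
  obtain a i1 i2 i3 i4 i where k: "k = (a, i1, i2, i3, i4, i)" by (cases k rule: prod_cases6)
  show ?thesis unfolding n k
    by (cases t) (simp_all only: word_val.simps tor_val.simps ev_hom ev_power ev_letter)
qed

lemma ev_word_sum:
  "ev (word_sum h) = (\<Sum>n\<in>Poly_Mapping.keys h. \<iota> (Poly_Mapping.lookup h n)
    * word_val (param_letter f lam x y z v w b) n)"
proof -
  have "ev (sum g A) = (\<Sum>a\<in>A. ev (g a))" for g :: "word \<Rightarrow> _" and A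
    by (induction A rule: infinite_finite_induct) (simp_all add: ev_hom)
  then show ?thesis
    unfolding word_sum_def by (simp only: ev_hom ev_const ev_word)
qed

end

section \<open>Independence of the words\<close>

lemma prod_list_power_horner:
  "prod_list (map2 (^) (map (\<lambda>j. t ^ (c * B ^ j)) [0..<length es]) es) = (t::'a::comm_monoid_mult) ^ (c * horner B es)"
proof (induction es arbitrary: c)
  case Nil
  then show ?case by (simp add: horner_def)
next
  case (Cons e es)
  have "prod_list (map2 (^) (map (\<lambda>j. t ^ (c * B ^ j)) [0..<length (e # es)]) (e # es))
      = t ^ (c * e) * prod_list (map2 (^) (map (\<lambda>j. t ^ ((c * B) * B ^ j)) [0..<length es]) es)"
    by (simp only: length_Cons map_upt_Suc zip_Cons_Cons list.map prod.case prod_list.Cons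
        power_0 power_Suc power_one_right mult_1_right mult.assoc power_mult)
  also have "\<dots> = t ^ (c * horner B (e # es))"
    unfolding Cons.IH by (simp add: horner_def power_add[symmetric] distrib_left mult.assoc)
  finally show ?case .
qed

lemma length_word_expo: "length (word_expo n) = 8"
proof -
  obtain m t where m: "n = (m, t)" by (cases n)
  obtain a i1 i2 i3 i4 i where n: "m = (a, i1, i2, i3, i4, i)" by (cases m rule: prod_cases6)
  obtain tf tv tw tb where t: "tor_expo t = (tf, tv, tw, tb)" by (cases "tor_expo t" rule: prod_cases4)
  show ?thesis unfolding m n by (simp add: t)
qed

lemma Fract_one_hom:
  fixes p q :: "'a::idom" and g :: "'b \<Rightarrow> 'a"
  shows "Fract (p + q) 1 = Fract p 1 + Fract q 1" "Fract (p * q) 1 = Fract p 1 * Fract q 1"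
    "Fract (p ^ n) 1 = Fract p 1 ^ n" "Fract (sum g A) 1 = (\<Sum>a\<in>A. Fract (g a) 1)"
    "Fract (- p) 1 = - Fract p 1"
proof -
  show a: "Fract (p + q) 1 = Fract p 1 + Fract q 1" for p q :: 'a by simp
  show m: "Fract (p * q) 1 = Fract p 1 * Fract q 1" for p q :: 'a by simp
  show "Fract (p ^ n) 1 = Fract p 1 ^ n"
    by (induction n) (simp_all add: m One_fract_def)
  show "Fract (sum g A) 1 = (\<Sum>a\<in>A. Fract (g a) 1)"
    by (induction A rule: infinite_finite_induct) (simp_all only: sum.infinite sum.empty sum.insert a Zero_fract_def not_False_eq_True)
  show "Fract (- p) 1 = - Fract p 1" by simp
qed

lemma Fract_one_eq_zero: "Fract p 1 = 0 \<Longrightarrow> p = (0::'a::idom)"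
  by (simp add: Zero_fract_def eq_fract)

context six_invertible
begin

text \<open>Kronecker substitution: the eight parameters of the generic point are taken to be
  \<open>T ^ (B ^ j)\<close> for large \<open>B\<close>, which keeps distinct words distinct as powers of \<open>T\<close>.\<close>

lemma word_sum_pullback_zero:
  fixes h :: "word \<Rightarrow>\<^sub>0 'f"
  assumes "mat_subst Y_map (word_sum h) \<in> Idl\<^bsub>poly_ring\<^esub> GC_eqs"
  shows "h = 0"
proof -
  \<comment> \<open>Larger than every exponent in the words of \<open>h\<close>, so that these
    exponents are digits in base \<open>B\<close>.\<close>
  define B where "B = Suc (\<Sum>n\<in>Poly_Mapping.keys h. sum_list (word_expo n))"
  define T :: "'f poly fract" where "T = Fract [:0, 1:] 1"
  define \<iota> :: "'f \<Rightarrow> 'f poly fract" where "\<iota> c = Fract [:c:] 1" for c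
  \<comment> \<open>The factor 1 matches the scaling \<open>c\<close> in
    \<open>prod_list_power_horner\<close>.\<close>
  define P where "P j = T ^ (1 * B ^ j)" for j
  define code where "code n = horner B (word_expo n)" for n
  have "T \<noteq> 0" unfolding T_def using Fract_one_eq_zero[of "[:0, 1:]"] by auto
  then have "P 0 \<noteq> 0" by (simp add: P_def)
  then interpret pt: six_invertible_point field_type "P 0" "P 1" "P 2" "P 3" "P 4" "P 5" "P 6" "P 7" \<iota>
    by unfold_locales (simp_all add: \<iota>_def One_fract_def one_pCons mult.commute)
  have list: "[P 0, P 1, P 2, P 3, P 4, P 5, P 6, P 7] = map P [0..<8]"
    by (simp add: upt_rec numeral_eq_Suc)
  have T_pow: "T ^ k = Fract (Polynomial.monom 1 k) 1" for k
    by (simp only: T_def Fract_one_hom(3)[symmetric] monom_altdef) simp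
  have "prod_list (map2 (^) (map P [0..<8]) (word_expo n)) = T ^ code n" for n
    using prod_list_power_horner[of T 1 B "word_expo n"]
    by (simp add: length_word_expo P_def[abs_def] code_def del: upt.simps)
  then have val: "word_val (param_letter (P 0) (P 1) (P 2) (P 3) (P 4) (P 5) (P 6) (P 7)) n
      = (- 1) ^ tor_sign (snd n) * T ^ code n" for n
    by (simp only: word_val_param list)
  have term_eq: "\<iota> c * ((- 1) ^ s * T ^ k) = Fract (Polynomial.monom (c * (- 1) ^ s) k) 1" for c k s
  proof -
    have "Polynomial.monom (c * (- 1) ^ s) k = [:c:] * ((- 1) ^ s * Polynomial.monom 1 k)"
      by (cases "even s") (simp_all add: smult_monom minus_monom)
    then show ?thesis
      by (simp only: \<iota>_def T_pow Fract_one_hom One_fract_def)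
  qed
  have "0 = pt.ev (word_sum h)" using pt.ev_GC[OF assms] by simp
  also have "\<dots> = (\<Sum>n\<in>Poly_Mapping.keys h. Fract (Polynomial.monom (Poly_Mapping.lookup h n * (- 1) ^ tor_sign (snd n)) (code n)) 1)"
    by (simp only: pt.ev_word_sum val term_eq)
  also have "\<dots> = Fract (\<Sum>n\<in>Poly_Mapping.keys h. Polynomial.monom (Poly_Mapping.lookup h n * (- 1) ^ tor_sign (snd n)) (code n)) 1"
    by (simp only: Fract_one_hom)
  finally have zero: "(\<Sum>n\<in>Poly_Mapping.keys h. Polynomial.monom (Poly_Mapping.lookup h n * (- 1) ^ tor_sign (snd n)) (code n)) = 0"
    by (rule Fract_one_eq_zero[OF sym])
  have bound: "\<forall>e\<in>set (word_expo n). e < B" if "n \<in> Poly_Mapping.keys h" for n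
  proof
    fix e assume "e \<in> set (word_expo n)"
    then have "e \<le> sum_list (word_expo n)" by (intro member_le_sum_list) simp_all
    also have "\<dots> \<le> (\<Sum>n\<in>Poly_Mapping.keys h. sum_list (word_expo n))"
      using that by (intro member_le_sum) simp_all
    finally show "e < B" by (simp add: B_def)
  qed
  have code_inj: "code n = code m \<longleftrightarrow> n = m" if "n \<in> Poly_Mapping.keys h" "m \<in> Poly_Mapping.keys h" for n m
    using horner_inj[of "word_expo n" "word_expo m" B] word_expo_inj[of n m] bound that
    by (auto simp: code_def length_word_expo)
  have "Poly_Mapping.lookup h m = 0" if m: "m \<in> Poly_Mapping.keys h" for m
  proof -
    have "0 = Polynomial.coeff (\<Sum>n\<in>Poly_Mapping.keys h. Polynomial.monom (Poly_Mapping.lookup h n * (- 1) ^ tor_sign (snd n)) (code n)) (code m)"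
      by (simp add: zero)
    also have "\<dots> = (\<Sum>n\<in>Poly_Mapping.keys h. if n = m then Poly_Mapping.lookup h n * (- 1) ^ tor_sign (snd n) else 0)"
      unfolding coeff_sum coeff_monom by (intro sum.cong refl) (simp add: code_inj m)
    also have "\<dots> = Poly_Mapping.lookup h m * (- 1) ^ tor_sign (snd m)"
      using m by simp
    finally show ?thesis by simp
  qed
  then show ?thesis by (intro poly_mapping_eqI) (metis in_keys_iff lookup_zero)
qed

lemma pullback_imp_relation:
  assumes p: "mat_subst Y_map p \<in> Idl\<^bsub>poly_ring\<^esub> GC_eqs"
  shows "p \<in> rel_ideal"
proof -
  obtain k h where h: "coord gg_M $ 3 $ 1 ^ k * p - word_sum h \<in> rel_ideal"
    using power_mult_straight[of p] unfolding straight_def by blast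
  have "mat_subst Y_map (word_sum h) = mat_subst Y_map (coord gg_M $ 3 $ 1 ^ k) * mat_subst Y_map p
      + - 1 * mat_subst Y_map (coord gg_M $ 3 $ 1 ^ k * p - word_sum h)"
    by (simp add: mat_subst_hom)
  then have "mat_subst Y_map (word_sum h) \<in> Idl\<^bsub>poly_ring\<^esub> GC_eqs"
    by (simp only: Idl_add Idl_mult p Idl_pullback[OF h])
  then have "h = 0" by (rule word_sum_pullback_zero)
  then have "coord gg_M $ 3 $ 1 ^ k * p \<in> rel_ideal" using h by (simp add: word_sum_def)
  then show ?thesis
  proof (induction k)
    case (Suc k)
    then have "mono_of (Poly_Mapping.single (gg_M, 3, 1) 1) 1 * (coord gg_M $ 3 $ 1 ^ k * p) \<in> W.basis_ideal"
      by (simp only: power_Suc mult.assoc basis_ideal_eq coord_nth)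
    then show ?case
      by (intro Suc.IH) (simp only: M31_nonzerodivisor basis_ideal_eq[symmetric])
  qed simp
qed

end

subsection \<open>Passage to the quotient rings\<close>

lemma quot_class_eq: "quot_class E p = {q. q - p \<in> Idl\<^bsub>poly_ring\<^esub> E}"
proof -
  have add: "x \<oplus>\<^bsub>poly_ring\<^esub> y = x + y" for x y :: "('a, 'b) mat_poly"
    by (simp add: ring_of_type_algebra_def)
  show ?thesis
  proof (rule Set.set_eqI, rule iffI)
    fix q assume "q \<in> quot_class E p"
    then obtain h where "h \<in> Idl\<^bsub>poly_ring\<^esub> E" "q = h + p"
      unfolding quot_class_def a_r_coset_def' add by blast
    then show "q \<in> {q. q - p \<in> Idl\<^bsub>poly_ring\<^esub> E}" by simp
  next
    fix q assume "q \<in> {q. q - p \<in> Idl\<^bsub>poly_ring\<^esub> E}"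
    then have "q - p \<in> Idl\<^bsub>poly_ring\<^esub> E" "q = (q - p) + p" by simp_all
    then show "q \<in> quot_class E p"
      unfolding quot_class_def a_r_coset_def' add by blast
  qed
qed

lemma quot_class_zero: "quot_class E 0 = Idl\<^bsub>poly_ring\<^esub> E"
  by (simp add: quot_class_eq)

lemma quot_class_self: "p \<in> quot_class E p"
  by (simp add: quot_class_eq Idl_zero)

lemma quot_class_cong: "quot_class E p = quot_class E q \<longleftrightarrow> p - q \<in> Idl\<^bsub>poly_ring\<^esub> E"
proof
  assume "quot_class E p = quot_class E q"
  then show "p - q \<in> Idl\<^bsub>poly_ring\<^esub> E"
    using quot_class_self[of p E] by (simp add: quot_class_eq)
next
  assume d: "p - q \<in> Idl\<^bsub>poly_ring\<^esub> E"
  have "r - p \<in> Idl\<^bsub>poly_ring\<^esub> E \<longleftrightarrow> r - q \<in> Idl\<^bsub>poly_ring\<^esub> E" for r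
    using Idl_add[OF _ d, of "r - p"] Idl_add[OF _ Idl_mult[OF d, of "- 1"], of "r - q"] by auto
  then show "quot_class E p = quot_class E q" by (simp add: quot_class_eq)
qed

lemma carrier_quot_ring: "carrier (quot_ring E) = range (quot_class E)"
  unfolding quot_ring_def FactRing_simps quot_class_def by (auto simp: ring_of_type_algebra_def)

lemma quot_class_hom: "ring_hom_ring poly_ring (quot_ring E) (quot_class E)"
proof -
  interpret cring "poly_ring :: ('a, 'b) mat_poly ring" by (rule cring_from_type_algebra)
  have "ideal (Idl\<^bsub>poly_ring\<^esub> E) (poly_ring :: ('a, 'b) mat_poly ring)"
    by (rule genideal_ideal) (simp add: ring_of_type_algebra_def)
  from ideal.rcos_ring_hom_ring[OF this] show ?thesis
    unfolding quot_ring_def quot_class_def[abs_def] .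
qed

text \<open>The quotient map is surjective, so the image of an ideal is again an ideal; for the
  other inclusion, the preimage of the ideal generated by the images is an ideal containing
  \<open>P\<close>.\<close>

lemma Idl_quot_ring:
  "Idl\<^bsub>quot_ring E\<^esub> (quot_class E ` P) = quot_class E ` (Idl\<^bsub>poly_ring\<^esub> P)"
proof -
  let ?R = "poly_ring :: ('a, 'b) mat_poly ring"
  let ?Q = "quot_ring E"
  interpret cring ?R by (rule cring_from_type_algebra)
  interpret h: ring_hom_ring ?R ?Q "quot_class E" by (rule quot_class_hom)
  have carrier: "p \<in> carrier ?R" for p by (simp add: ring_of_type_algebra_def)
  have ops: "x \<oplus>\<^bsub>?R\<^esub> y = x + y" "x \<otimes>\<^bsub>?R\<^esub> y = x * y" "\<zero>\<^bsub>?R\<^esub> = 0" for x y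
    by (simp_all add: ring_of_type_algebra_def)
  have ideal_P: "ideal (Idl\<^bsub>?R\<^esub> P) ?R" by (rule genideal_ideal) (simp add: ring_of_type_algebra_def)
  have sub: "quot_class E ` P \<subseteq> carrier ?Q" by (auto simp: carrier_quot_ring)
  interpret K: ideal "Idl\<^bsub>?Q\<^esub> (quot_class E ` P)" ?Q by (rule h.S.genideal_ideal[OF sub])
  show ?thesis
  proof
    have mult: "x \<otimes>\<^bsub>?Q\<^esub> a \<in> quot_class E ` (Idl\<^bsub>?R\<^esub> P)" "a \<otimes>\<^bsub>?Q\<^esub> x \<in> quot_class E ` (Idl\<^bsub>?R\<^esub> P)"
      if a: "a \<in> quot_class E ` (Idl\<^bsub>?R\<^esub> P)" and x: "x \<in> carrier ?Q" for a x
    proof -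
      obtain p q where p: "p \<in> Idl\<^bsub>?R\<^esub> P" "a = quot_class E p" and q: "x = quot_class E q"
        using a x unfolding carrier_quot_ring by blast
      have "x \<otimes>\<^bsub>?Q\<^esub> a = quot_class E (q * p)" "a \<otimes>\<^bsub>?Q\<^esub> x = quot_class E (p * q)"
        unfolding p q ops[symmetric] by (simp_all only: h.hom_mult[OF carrier carrier])
      then show "x \<otimes>\<^bsub>?Q\<^esub> a \<in> quot_class E ` (Idl\<^bsub>?R\<^esub> P)" "a \<otimes>\<^bsub>?Q\<^esub> x \<in> quot_class E ` (Idl\<^bsub>?R\<^esub> P)"
        using Idl_mult[OF p(1), of q] by (simp_all add: mult.commute)
    qed
    have "subgroup (quot_class E ` (Idl\<^bsub>?R\<^esub> P)) (add_monoid ?Q)"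
      by (rule h.img_is_add_subgroup)
        (rule additive_subgroup.a_subgroup[OF ideal.axioms(1)[OF ideal_P]])
    then have "ideal (quot_class E ` (Idl\<^bsub>?R\<^esub> P)) ?Q"
      by (rule idealI[OF h.S.ring_axioms _ mult])
    then show "Idl\<^bsub>?Q\<^esub> (quot_class E ` P) \<subseteq> quot_class E ` (Idl\<^bsub>?R\<^esub> P)"
      by (rule h.S.genideal_minimal) (rule image_mono[OF Idl_self])
    have "Idl\<^bsub>?R\<^esub> P \<subseteq> {p. quot_class E p \<in> Idl\<^bsub>?Q\<^esub> (quot_class E ` P)}"
    proof (rule Idl_least)
      show "0 \<in> {p. quot_class E p \<in> Idl\<^bsub>?Q\<^esub> (quot_class E ` P)}"
        using h.hom_zero K.zero_closed by (simp add: ops)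
      show "x + y \<in> {p. quot_class E p \<in> Idl\<^bsub>?Q\<^esub> (quot_class E ` P)}"
        if "x \<in> {p. quot_class E p \<in> Idl\<^bsub>?Q\<^esub> (quot_class E ` P)}"
          "y \<in> {p. quot_class E p \<in> Idl\<^bsub>?Q\<^esub> (quot_class E ` P)}" for x y
        using h.hom_add[OF carrier carrier, of x y] K.a_closed that by (simp add: ops)
      show "r * x \<in> {p. quot_class E p \<in> Idl\<^bsub>?Q\<^esub> (quot_class E ` P)}"
        if "x \<in> {p. quot_class E p \<in> Idl\<^bsub>?Q\<^esub> (quot_class E ` P)}" for r x
        using h.hom_mult[OF carrier carrier, of r x] K.I_l_closed[OF _ h.hom_closed[OF carrier]] that
        by (simp add: ops)
      show "P \<subseteq> {p. quot_class E p \<in> Idl\<^bsub>?Q\<^esub> (quot_class E ` P)}"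
        using h.S.genideal_self[OF sub] by blast
    qed
    then show "quot_class E ` (Idl\<^bsub>?R\<^esub> P) \<subseteq> Idl\<^bsub>?Q\<^esub> (quot_class E ` P)" by blast
  qed
qed

text \<open>Well-definedness: the two trace equations are among the relations and hence pull back
  into the ideal of \<open>GC_eqs\<close>, so the image of a class under \<open>the_elem\<close> is
  that of a singleton.\<close>

lemma S_to_H0_quot_class:
  "S_to_H0 (quot_class gg_eqs p) = quot_class GC_eqs (mat_subst Y_map p)"
proof -
  have "gg_eqs \<subseteq> relations" by (auto simp: gg_eqs_def relations_def Let_def)
  then have gg: "Idl\<^bsub>poly_ring\<^esub> gg_eqs \<subseteq> Idl\<^bsub>poly_ring\<^esub> relations"
    by (intro Idl_least Idl_zero Idl_add Idl_mult) (use Idl_self in blast)+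
  have "quot_class GC_eqs (mat_subst Y_map q) = quot_class GC_eqs (mat_subst Y_map p)"
    if "q \<in> quot_class gg_eqs p" for q
    using that gg Idl_pullback[of "q - p"]
    by (auto simp: quot_class_cong mat_subst_hom(3)[symmetric] quot_class_eq[of gg_eqs])
  then have "(\<lambda>q. quot_class GC_eqs (mat_subst Y_map q)) ` quot_class gg_eqs p
      = {quot_class GC_eqs (mat_subst Y_map p)}"
    using quot_class_self[of p gg_eqs] by blast
  then show ?thesis by (simp add: S_to_H0_def quot_pullback_def)
qed

text \<open>The ring of invariants inherits its zero from the coordinate ring of G x C(n), so the
  kernel is decided there, by membership of the pullback in the ideal of
  \<open>GC_eqs\<close>.\<close>

lemma J_ideal_eq:
  "(J_ideal :: (gg_mat, 'f::comm_ring_1) mat_poly set set) =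
    quot_class gg_eqs ` {p. mat_subst Y_map p \<in> Idl\<^bsub>poly_ring\<^esub> GC_eqs}"
proof -
  have "\<zero>\<^bsub>H0_Y\<^esub> = quot_class GC_eqs (0 :: (GC_mat, 'f) mat_poly)"
    by (simp add: H0_Y_def GC_ring_def quot_ring_def FactRing_def quot_class_zero)
  then have "(J_ideal :: (gg_mat, 'f) mat_poly set set) = {c \<in> range (quot_class gg_eqs). S_to_H0 c = quot_class GC_eqs 0}"
    by (simp add: J_ideal_def a_kernel_def' S_ring_def carrier_quot_ring)
  also have "\<dots> = quot_class gg_eqs ` {p. S_to_H0 (quot_class gg_eqs p) = quot_class GC_eqs 0}"
    by blast
  finally show ?thesis by (simp add: S_to_H0_quot_class quot_class_cong)
qed

theorem theorem5p7:
  fixes l :: nat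
    and M N :: "(gg_mat, 'f::field) mat_poly ^ 3 ^ 3"
  assumes "CHAR('f) = l" and "l \<ge> 5"
  defines "M \<equiv> coord gg_M" and "N \<equiv> coord gg_N"
  shows "J_ideal = Idl\<^bsub>S_ring\<^esub> (quot_class gg_eqs `
    ({trace M, trace N}
      \<union> {trace (M ** M), trace (M ** N), trace (N ** N)} \<union> entries (M ** N - N ** M)
      \<union> {trace (M ** M ** M), trace (N ** N ** N)}
      \<union> entries (M ** M ** N) \<union> entries (M ** N ** N)))"
proof -
  have "of_nat 2 \<noteq> (0::'f)" "of_nat 3 \<noteq> (0::'f)"
    unfolding of_nat_eq_0_iff_char_dvd using assms(1,2) by (auto dest!: dvd_imp_le)
  then interpret six_invertible "TYPE('f)" by unfold_locales simp_all
  have "{p. mat_subst Y_map p \<in> Idl\<^bsub>poly_ring\<^esub> GC_eqs} = rel_ideal"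
    using pullback_imp_relation Idl_pullback by blast
  then show ?thesis
    unfolding J_ideal_eq S_ring_def M_def N_def
    by (simp only: Idl_quot_ring relations_def Let_def)
qed

end
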